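(* Let $n\in\mathbb{Z}_{\ge1}$ and $\varepsilon\in\{\pm1\}$. For the irreducible Seifert form pairs $(H_{\mathbb R},L)$ the signature of the symmetric form $I_s(a,b)=L(a,b)+L(b,a)$ and, in all cases where $\mathrm{Rad}\,I_s=\{0\}$, the type of the (irreducible) isometric triple $(H_{\mathbb R},M,I_s)$ are as follows. - $\mathrm{Seif}(1,1,n,\varepsilon)$ ($n$ odd) with $n\equiv\varepsilon \bmod 4$: $(\frac{n+1}2,0,\frac{n-1}2)$, $\mathrm{Tr}(1,1,n,\varepsilon)$. - $\mathrm{Seif}(1,1,n,\varepsilon)$ ($n$ odd) with $n\equiv-\varepsilon \bmod 4$: $(\frac{n-1}2,0,\frac{n+1}2)$, $\mathrm{Tr}(1,1,n,\varepsilon)$. - $\mathrm{Seif}(-1,1,n,\varepsilon)$ ($n$ even) with $n-1\equiv\varepsilon \bmod 4$: $(\frac n2,1,\frac{n-2}2)$. - $\mathrm{Seif}(-1,1,n,\varepsilon)$ ($n$ even) with $n-1\equiv-\varepsilon \bmod 4$: $(\frac{n-2}2,1,\frac n2)$. - $\mathrm{Seif}(1,2,n)$ ($n$ even): $(n,0,n)$, $\mathrm{Tr}(1,2,n,0,1)$. - $\mathrm{Seif}(-1,2,n)$ ($n$ odd): $(n-1,2,n-1)$. - For $\lambda\in S^1\setminus\{\pm1\}$ put $\zeta:=\frac{\overline\lambda+1}{|\lambda+1|}\cdot i^{n+1}$. Then $\mathrm{Seif}(\lambda,2,n,\zeta\varepsilon)$ with $n$ even: $(n,0,n)$, $\mathrm{Tr}(\lambda,2,n,0,\varepsilon)$;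 $\mathrm{Seif}(\lambda,2,n,\zeta)$ with $n$ odd: $(n-1,0,n+1)$, $\mathrm{Tr}(\lambda,2,n,0,1)$; $\mathrm{Seif}(\lambda,2,n,-\zeta)$ with $n$ odd: $(n+1,0,n-1)$, $\mathrm{Tr}(\lambda,2,n,0,-1)$. - $\mathrm{Seif}(\lambda,2,n)$ with $\lambda\in\mathbb{R}_{>1}\cup\mathbb{R}_{<-1}$: $(n,0,n)$, $\mathrm{Tr}(\lambda,2,n,0)$. - $\mathrm{Seif}(\lambda,4,n)$ with $|\lambda|>1$, $\mathrm{Im}\,\lambda>0$: $(2n,0,2n)$, $\mathrm{Tr}(\lambda,4,n,0)$.
   Context: The signature of a symmetric form $I_s$ on $H_{\mathbb R}$ is the triple $(p,q,r)$ with $p$ the maximal dimension of a positive definite subspace, $q=\dim\mathrm{Rad}\,I_s$, and $r=\dim H_{\mathbb R}-p-q$ the maximal dimension of a negative definite subspace. A Seifert form pair $(H_{\mathbb R},L)$ is a finite dimensional real vector space with a nondegenerate bilinear form $L$. It is irreducible if nonzero and not a direct sum of two nonzero $L$-orthogonal subspaces. Its monodromy $M$ is defined by $L(Ma,b)=L(b,a)$. $H_{\mathbb C}=H_{\mathbb R}\otimes\mathbb{C}$, $M=M_sM_u$ (semisimple, unipotent part), $N=\log M_u$, $H_\lambda=\ker(M_s-\lambda\,\mathrm{id})\subset H_{\mathbb C}$. The irreducible Seifert form pairs are the following, each determined up to isomorphism by the listed properties: $\mathrm{Seif}(\lambda,1,n,\varepsilon)$, $\lambda=(-1)^{n-1}$: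 $\dim H_{\mathbb R}=n$, $H_{\mathbb C}=H_\lambda$, one Jordan block of $M$, $L(a,N^{n-1}a)\in\varepsilon\mathbb{R}_{>0}$ for $a\in H_{\mathbb R}\setminus\mathrm{Im}\,N$. $\mathrm{Seif}(\lambda,2,n)$, $\lambda=(-1)^n$: $\dim H_{\mathbb R}=2n$, $H_{\mathbb C}=H_\lambda$, two Jordan blocks of size $n$. $\mathrm{Seif}(\lambda,2,n,\zeta)$, $\lambda,\zeta\in S^1\setminus\{\pm1\}$, $\zeta^2=\overline\lambda(-1)^{n+1}$: $\dim H_{\mathbb R}=2n$, $H_{\mathbb C}=H_\lambda\oplus H_{\overline\lambda}$, two Jordan blocks, $L(a,N^{n-1}\overline a)\in\zeta\mathbb{R}_{>0}$ for $a\in H_\lambda\setminus\mathrm{Im}\,N$. $\mathrm{Seif}(\lambda,2,n)$, $\lambda\in\mathbb{R}_{>1}\cup\mathbb{R}_{<-1}$: $\dim H_{\mathbb R}=2n$, $H_{\mathbb C}=H_\lambda\oplus H_{\lambda^{-1}}$, two Jordan blocks of size $n$. $\mathrm{Seif}(\lambda,4,n)$, $|\lambda|>1$, $\mathrm{Im}\,\lambda>0$: $\dim H_{\mathbb R}=4n$, $H_{\mathbb C}=H_\lambda\oplus H_{\lambda^{-1}}\oplus H_{\overline\lambda}\oplus H_{\overline\lambda^{-1}}$, four Jordan blocks of size $n$. An isometric triple $(H_{\mathbb R},M,S)$ is a finite dimensional real vector space with a nondegenerate symmetric or antisymmetric form $S$ and an isometry $M$ of it. Let $J_n=(\delta_{j,k+1})_{j,k=1,\dots,n}$,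 $E_n^{per}=((-1)^{j-1}\delta_{j,n+1-k})_{j,k=1,\dots,n}$. For a row $\underline a=(a_1,\dots,a_n)$, $N\underline a=\underline aJ_n$ means $Na_k=a_{k+1}$ ($k<n$), $Na_n=0$; $S(\underline a^t,\underline b)=(S(a_j,b_k))_{j,k}$. Types (with $m\in\{0,1\}$): $\mathrm{Tr}(\lambda,1,n,\varepsilon)$, $\lambda\in\{\pm1\}$: basis $\underline a$ of $H_{\mathbb R}$, $M_s=\lambda\,\mathrm{id}$, $N\underline a=\underline aJ_n$, $S(\underline a^t,\underline a)=\varepsilon E_n^{per}$. $\mathrm{Tr}(\lambda,2,n,m,\varepsilon)$, $\lambda\in S^1$: $\dim H_{\mathbb R}=2n$, $H_{\mathbb C}=H^{(1)}\oplus\overline{H^{(1)}}$, $\underline a$ a basis of $H^{(1)}$, $M_s=\lambda$ on $H^{(1)}$ and $\overline\lambda$ on $\overline{H^{(1)}}$, $N\underline a=\underline aJ_n$, $N\overline{\underline a}=\overline{\underline a}J_n$, $S(\underline a^t,\underline a)=0=S(\overline{\underline a}^t,\overline{\underline a})$, $S(\underline a^t,\overline{\underline a})=i^{n+m+1}\varepsilon E_n^{per}$, $S(\overline{\underline a}^t,\underline a)=i^{n+m+1}\varepsilon(-1)^{n+m+1}E_n^{per}$. $\mathrm{Tr}(\lambda,2,n,m)$, $\lambda\in\mathbb{R}_{>1}\cup\mathbb{R}_{<-1}$: $H_{\mathbb R}=H^{(1)}\oplus H^{(2)}$ with bases $\underline a,\underline b$ of length $n$, $M_s=\lambda$ on $H^{(1)}$,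 $\lambda^{-1}$ on $H^{(2)}$, $N$ acting by $J_n$ on both bases, $S(\underline a^t,\underline b)=E_n^{per}$, $S(\underline b^t,\underline a)=(-1)^{n+m+1}E_n^{per}$, other blocks zero. $\mathrm{Tr}(\lambda,4,n,m)$: $H_{\mathbb C}=H^{(1)}\oplus H^{(2)}\oplus\overline{H^{(1)}}\oplus\overline{H^{(2)}}$ with bases $\underline a,\underline b,\overline{\underline a},\overline{\underline b}$ of length $n$, $M_s=\lambda,\lambda^{-1},\overline\lambda,\overline\lambda^{-1}$ respectively, $N$ acting by $J_n$ on all bases, $S(\underline a^t,\underline b)=E_n^{per}=S(\overline{\underline a}^t,\overline{\underline b})$, $S(\underline b^t,\underline a)=(-1)^{n+m+1}E_n^{per}=S(\overline{\underline b}^t,\overline{\underline a})$, other blocks zero. *)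

theory Defs
  imports
    "HOL-Analysis.Linear_Algebra"
    "HOL-Number_Theory.Cong"
    "HOL-Library.Product_Plus"
    "Jordan_Normal_Form.Jordan_Normal_Form"
begin

text \<open>
  The real vector space \<open>H_R\<close> is the whole type \<open>'v::real_vector\<close>; finite dimension is a
  hypothesis. Its complexification is the type \<open>'v \<times> 'v\<close>, the pair \<open>(x, y)\<close> standing for
  \<open>x + i y\<close>. Real endomorphisms and forms are extended complex linearly and bilinearly.
\<close>

definition cscale :: "complex \<Rightarrow> 'v::real_vector \<times> 'v \<Rightarrow> 'v \<times> 'v" where
  "cscale c v = (Re c *\<^sub>R fst v - Im c *\<^sub>R snd v, Re c *\<^sub>R snd v + Im c *\<^sub>R fst v)"

lemma vector_space_cscale: "vector_space cscale"
  by unfold_locales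
    (auto simp: cscale_def prod_eq_iff algebra_simps)

definition cconj :: "'v::real_vector \<times> 'v \<Rightarrow> 'v \<times> 'v" where
  "cconj v = (fst v, - snd v)"

definition cmap :: "('v::real_vector \<Rightarrow> 'v) \<Rightarrow> 'v \<times> 'v \<Rightarrow> 'v \<times> 'v" where
  "cmap f v = (f (fst v), f (snd v))"

definition cform :: "('v::real_vector \<Rightarrow> 'v \<Rightarrow> real) \<Rightarrow> 'v \<times> 'v \<Rightarrow> 'v \<times> 'v \<Rightarrow> complex" where
  "cform B v w = Complex (B (fst v) (fst w) - B (snd v) (snd w))
                         (B (fst v) (snd w) + B (snd v) (fst w))"


subsection \<open>Linear algebra over a given scalar multiplication\<close>

text \<open>
  In the following definitions \<open>s\<close> is the scalar multiplication: \<open>(*\<^sub>R)\<close> on the real space or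
  \<open>cscale\<close> on its complexification.
\<close>

definition is_basis_of :: "('k::field \<Rightarrow> 'w::ab_group_add \<Rightarrow> 'w) \<Rightarrow> 'w list \<Rightarrow> 'w set \<Rightarrow> bool" where
  "is_basis_of s as W \<longleftrightarrow>
     distinct as \<and> \<not> module.dependent s (set as) \<and> module.span s (set as) = W"

text \<open>\<open>f as = as A\<close> for the row \<open>as\<close> of vectors; the columns of \<open>A\<close> are the images.\<close>

definition acts_by :: "('k::field \<Rightarrow> 'w::ab_group_add \<Rightarrow> 'w) \<Rightarrow> ('w \<Rightarrow> 'w) \<Rightarrow> 'w list \<Rightarrow> 'k mat \<Rightarrow> bool" where
  "acts_by s f as A \<longleftrightarrow> A \<in> carrier_mat (length as) (length as) \<and>
     (\<forall>k<length as. f (as ! k) = (\<Sum>j<length as. s (A $$ (j, k)) (as ! j)))"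

definition acts_as_scalar :: "('k \<Rightarrow> 'w \<Rightarrow> 'w) \<Rightarrow> ('w \<Rightarrow> 'w) \<Rightarrow> 'k \<Rightarrow> 'w set \<Rightarrow> bool" where
  "acts_as_scalar s f c W \<longleftrightarrow> (\<forall>w\<in>W. f w = s c w)"

text \<open>The whole space is the internal direct sum of the listed subspaces.\<close>

definition direct_sum :: "'w::monoid_add set list \<Rightarrow> bool" where
  "direct_sum Ws \<longleftrightarrow> (\<forall>v. \<exists>!ws. list_all2 (\<in>) ws Ws \<and> sum_list ws = v)"

definition gram :: "('w \<Rightarrow> 'w \<Rightarrow> 'k) \<Rightarrow> 'w list \<Rightarrow> 'w list \<Rightarrow> 'k mat" where
  "gram S as bs = mat (length as) (length bs) (\<lambda>(j, k). S (as ! j) (bs ! k))"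

definition gram_blocks :: "('w \<Rightarrow> 'w \<Rightarrow> 'k) \<Rightarrow> 'w list list \<Rightarrow> 'k mat list list" where
  "gram_blocks S ass = map (\<lambda>as. map (gram S as) ass) ass"

definition J_mat :: "nat \<Rightarrow> 'k::zero_neq_one mat" where
  "J_mat n = mat n n (\<lambda>(j, k). if j = k + 1 then 1 else 0)"

text \<open>With indices from \<open>0\<close>, \<open>(-1)\<^sup>j\<^sup>-\<^sup>1\<close> and \<open>j = n + 1 - k\<close> become \<open>(-1)\<^sup>j\<close> and \<open>j + k + 1 = n\<close>.\<close>

definition E_per :: "nat \<Rightarrow> 'k::ring_1 mat" where
  "E_per n = mat n n (\<lambda>(j, k). if j + k + 1 = n then (-1) ^ j else 0)"


subsection \<open>Forms and signature\<close>

definition finite_dim :: "'v::real_vector itself \<Rightarrow> bool" where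
  "finite_dim _ \<longleftrightarrow> (\<exists>B::'v set. finite B \<and> span B = UNIV)"

definition nondegenerate :: "('v::real_vector \<Rightarrow> 'v \<Rightarrow> real) \<Rightarrow> bool" where
  "nondegenerate B \<longleftrightarrow>
     (\<forall>a. (\<forall>b. B a b = 0) \<longrightarrow> a = 0) \<and> (\<forall>b. (\<forall>a. B a b = 0) \<longrightarrow> b = 0)"

definition radical :: "('v::real_vector \<Rightarrow> 'v \<Rightarrow> real) \<Rightarrow> 'v set" where
  "radical B = {a. \<forall>b. B a b = 0}"

definition orthogonal_sets :: "('v \<Rightarrow> 'v \<Rightarrow> real) \<Rightarrow> 'v set \<Rightarrow> 'v set \<Rightarrow> bool" where
  "orthogonal_sets B U V \<longleftrightarrow> (\<forall>u\<in>U. \<forall>v\<in>V. B u v = 0 \<and> B v u = 0)"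

definition max_pos_dim :: "('v::real_vector \<Rightarrow> 'v \<Rightarrow> real) \<Rightarrow> nat \<Rightarrow> bool" where
  "max_pos_dim B p \<longleftrightarrow>
     (\<exists>W. subspace W \<and> (\<forall>w\<in>W. w \<noteq> 0 \<longrightarrow> B w w > 0) \<and> dim W = p) \<and>
     (\<forall>W. subspace W \<and> (\<forall>w\<in>W. w \<noteq> 0 \<longrightarrow> B w w > 0) \<longrightarrow> dim W \<le> p)"

text \<open>
  The last two conjuncts are the two descriptions of \<open>r\<close>: as \<open>dim H_R - p - q\<close>
  and as the maximal dimension of a negative definite subspace.
\<close>

definition has_signature :: "('v::real_vector \<Rightarrow> 'v \<Rightarrow> real) \<Rightarrow> nat \<times> nat \<times> nat \<Rightarrow> bool" where
  "has_signature B = (\<lambda>(p, q, r).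
     max_pos_dim B p \<and> q = dim (radical B) \<and>
     p + q + r = dim (UNIV :: 'v set) \<and> max_pos_dim (\<lambda>a b. - B a b) r)"

definition I_s :: "('v \<Rightarrow> 'v \<Rightarrow> real) \<Rightarrow> 'v \<Rightarrow> 'v \<Rightarrow> real" where
  "I_s L a b = L a b + L b a"


subsection \<open>Jordan decomposition\<close>

text \<open>Semisimplicity of a real endomorphism is diagonalizability on the complexification.\<close>

definition semisimple :: "('v::real_vector \<Rightarrow> 'v) \<Rightarrow> bool" where
  "semisimple f \<longleftrightarrow> linear f \<and> module.span cscale {v. \<exists>c. cmap f v = cscale c v} = UNIV"

definition unipotent :: "('v::real_vector \<Rightarrow> 'v) \<Rightarrow> bool" where
  "unipotent f \<longleftrightarrow> linear f \<and> (\<exists>k. \<forall>x. ((\<lambda>y. f y - y) ^^ k) x = 0)"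

text \<open>
  On a finite dimensional space every automorphism \<open>M\<close> has exactly one such pair \<open>(Ms, Mu)\<close>;
  it is defined over the reals and its complexification is the decomposition of \<open>cmap M\<close>.
\<close>

definition jordan_parts :: "('v::real_vector \<Rightarrow> 'v) \<Rightarrow> ('v \<Rightarrow> 'v) \<Rightarrow> ('v \<Rightarrow> 'v) \<Rightarrow> bool" where
  "jordan_parts M Ms Mu \<longleftrightarrow> semisimple Ms \<and> unipotent Mu \<and> M = Ms \<circ> Mu \<and> Ms \<circ> Mu = Mu \<circ> Ms"

text \<open>\<open>log(1 + X) = \<Sum>\<^sub>k\<^sub>\<ge>\<^sub>1 (-1)\<^sup>k\<^sup>+\<^sup>1 X\<^sup>k / k\<close>; for unipotent \<open>f\<close> the index set below is finite.\<close>

definition log_unipotent :: "('v::real_vector \<Rightarrow> 'v) \<Rightarrow> 'v \<Rightarrow> 'v" where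
  "log_unipotent f x =
     (\<Sum>k | k \<ge> 1 \<and> ((\<lambda>y. f y - y) ^^ k) x \<noteq> 0.
        ((-1) ^ (k + 1) / real k) *\<^sub>R ((\<lambda>y. f y - y) ^^ k) x)"

definition eig_space :: "('v::real_vector \<Rightarrow> 'v) \<Rightarrow> complex \<Rightarrow> ('v \<times> 'v) set" where
  "eig_space Ms c = {v. cmap Ms v = cscale c v}"

text \<open>\<open>bs\<close> lists the Jordan blocks of \<open>M\<close> on the complexification as pairs (size, eigenvalue).\<close>

definition has_jordan_blocks :: "('v::real_vector \<Rightarrow> 'v) \<Rightarrow> (nat \<times> complex) list \<Rightarrow> bool" where
  "has_jordan_blocks M bs \<longleftrightarrow> 0 \<notin> fst ` set bs \<and>
     (\<exists>es. is_basis_of cscale es UNIV \<and> acts_by cscale (cmap M) es (jordan_matrix bs))"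


subsection \<open>Seifert form pairs\<close>

definition seifert_pair :: "('v::real_vector \<Rightarrow> 'v \<Rightarrow> real) \<Rightarrow> bool" where
  "seifert_pair L \<longleftrightarrow> finite_dim TYPE('v) \<and> bilinear L \<and> nondegenerate L"

definition irreducible_seifert_pair :: "('v::real_vector \<Rightarrow> 'v \<Rightarrow> real) \<Rightarrow> bool" where
  "irreducible_seifert_pair L \<longleftrightarrow> seifert_pair L \<and> (\<exists>x::'v. x \<noteq> 0) \<and>
     \<not> (\<exists>U V. subspace U \<and> subspace V \<and> U \<noteq> {0} \<and> V \<noteq> {0} \<and>
          direct_sum [U, V] \<and> orthogonal_sets L U V)"

text \<open>For a Seifert form pair there is exactly one such \<open>M\<close>.\<close>

definition monodromy :: "('v::real_vector \<Rightarrow> 'v \<Rightarrow> real) \<Rightarrow> ('v \<Rightarrow> 'v) \<Rightarrow> bool" where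
  "monodromy L M \<longleftrightarrow> (\<forall>a b. L (M a) b = L b a)"

text \<open>
  The predicates below list the properties characterizing each type among irreducible Seifert
  form pairs \<open>L\<close> with monodromy \<open>M\<close>. In order: \<open>Seif(\<lambda>,1,n,\<epsilon>)\<close>; \<open>Seif(\<lambda>,2,n)\<close> with
  \<open>\<lambda> = (-1)\<^sup>n\<close>; \<open>Seif(\<lambda>,2,n,\<zeta>)\<close>; \<open>Seif(\<lambda>,2,n)\<close> with real \<open>|\<lambda>| > 1\<close>; \<open>Seif(\<lambda>,4,n)\<close>.
\<close>

definition Seif_1 :: "real \<Rightarrow> nat \<Rightarrow> int \<Rightarrow> ('v::real_vector \<Rightarrow> 'v \<Rightarrow> real) \<Rightarrow> ('v \<Rightarrow> 'v) \<Rightarrow> bool" where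
  "Seif_1 lam n \<epsilon> L M \<longleftrightarrow> lam = (-1) ^ (n - 1) \<and> dim (UNIV :: 'v set) = n \<and>
     (\<exists>bs. has_jordan_blocks M bs \<and> length bs = 1) \<and>
     (\<exists>Ms Mu. jordan_parts M Ms Mu \<and> (let N = log_unipotent Mu in
        eig_space Ms (of_real lam) = UNIV \<and>
        (\<forall>a. a \<notin> range N \<longrightarrow> (\<exists>t>0. L a ((N ^^ (n - 1)) a) = of_int \<epsilon> * t))))"

definition Seif_2_sign :: "real \<Rightarrow> nat \<Rightarrow> ('v::real_vector \<Rightarrow> 'v \<Rightarrow> real) \<Rightarrow> ('v \<Rightarrow> 'v) \<Rightarrow> bool" where
  "Seif_2_sign lam n L M \<longleftrightarrow> lam = (-1) ^ n \<and> dim (UNIV :: 'v set) = 2 * n \<and>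
     (\<exists>bs. has_jordan_blocks M bs \<and> map fst bs = [n, n]) \<and>
     (\<exists>Ms Mu. jordan_parts M Ms Mu \<and> eig_space Ms (of_real lam) = UNIV)"

definition Seif_2_circle ::
    "complex \<Rightarrow> nat \<Rightarrow> complex \<Rightarrow> ('v::real_vector \<Rightarrow> 'v \<Rightarrow> real) \<Rightarrow> ('v \<Rightarrow> 'v) \<Rightarrow> bool" where
  "Seif_2_circle lam n \<zeta> L M \<longleftrightarrow>
     norm lam = 1 \<and> lam \<notin> {1, -1} \<and> norm \<zeta> = 1 \<and> \<zeta> \<notin> {1, -1} \<and> \<zeta>\<^sup>2 = cnj lam * (-1) ^ (n + 1) \<and>
     dim (UNIV :: 'v set) = 2 * n \<and>
     (\<exists>bs. has_jordan_blocks M bs \<and> length bs = 2) \<and>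
     (\<exists>Ms Mu. jordan_parts M Ms Mu \<and> (let N = cmap (log_unipotent Mu) in
        direct_sum [eig_space Ms lam, eig_space Ms (cnj lam)] \<and>
        (\<forall>a \<in> eig_space Ms lam - range N.
           \<exists>t>0. cform L a ((N ^^ (n - 1)) (cconj a)) = \<zeta> * of_real t)))"

definition Seif_2_real :: "real \<Rightarrow> nat \<Rightarrow> ('v::real_vector \<Rightarrow> 'v \<Rightarrow> real) \<Rightarrow> ('v \<Rightarrow> 'v) \<Rightarrow> bool" where
  "Seif_2_real lam n L M \<longleftrightarrow> (lam > 1 \<or> lam < -1) \<and> dim (UNIV :: 'v set) = 2 * n \<and>
     (\<exists>bs. has_jordan_blocks M bs \<and> map fst bs = [n, n]) \<and>
     (\<exists>Ms Mu. jordan_parts M Ms Mu \<and>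
        direct_sum [eig_space Ms (of_real lam), eig_space Ms (of_real (inverse lam))])"

definition Seif_4 :: "complex \<Rightarrow> nat \<Rightarrow> ('v::real_vector \<Rightarrow> 'v \<Rightarrow> real) \<Rightarrow> ('v \<Rightarrow> 'v) \<Rightarrow> bool" where
  "Seif_4 lam n L M \<longleftrightarrow> norm lam > 1 \<and> Im lam > 0 \<and> dim (UNIV :: 'v set) = 4 * n \<and>
     (\<exists>bs. has_jordan_blocks M bs \<and> map fst bs = [n, n, n, n]) \<and>
     (\<exists>Ms Mu. jordan_parts M Ms Mu \<and>
        direct_sum [eig_space Ms lam, eig_space Ms (inverse lam),
                    eig_space Ms (cnj lam), eig_space Ms (inverse (cnj lam))])"


subsection \<open>Isometric triples\<close>

definition isometric_triple :: "('v::real_vector \<Rightarrow> 'v) \<Rightarrow> ('v \<Rightarrow> 'v \<Rightarrow> real) \<Rightarrow> bool" where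
  "isometric_triple M S \<longleftrightarrow> finite_dim TYPE('v) \<and> bilinear S \<and> nondegenerate S \<and>
     ((\<forall>a b. S b a = S a b) \<or> (\<forall>a b. S b a = - S a b)) \<and>
     linear M \<and> bij M \<and> (\<forall>a b. S (M a) (M b) = S a b)"

definition irreducible_isometric_triple ::
    "('v::real_vector \<Rightarrow> 'v) \<Rightarrow> ('v \<Rightarrow> 'v \<Rightarrow> real) \<Rightarrow> bool" where
  "irreducible_isometric_triple M S \<longleftrightarrow> isometric_triple M S \<and> (\<exists>x::'v. x \<noteq> 0) \<and>
     \<not> (\<exists>U V. subspace U \<and> subspace V \<and> U \<noteq> {0} \<and> V \<noteq> {0} \<and> M ` U \<subseteq> U \<and> M ` V \<subseteq> V \<and>
          direct_sum [U, V] \<and> orthogonal_sets S U V)"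

definition Tr_1 :: "real \<Rightarrow> nat \<Rightarrow> int \<Rightarrow> ('v::real_vector \<Rightarrow> 'v) \<Rightarrow> ('v \<Rightarrow> 'v \<Rightarrow> real) \<Rightarrow> bool" where
  "Tr_1 lam n \<epsilon> M S \<longleftrightarrow> isometric_triple M S \<and> lam \<in> {1, -1} \<and>
     (\<exists>Ms Mu as. jordan_parts M Ms Mu \<and>
        length as = n \<and> is_basis_of scaleR as UNIV \<and>
        acts_as_scalar scaleR Ms lam UNIV \<and>
        acts_by scaleR (log_unipotent Mu) as (J_mat n) \<and>
        gram S as as = of_int \<epsilon> \<cdot>\<^sub>m E_per n)"

text \<open>\<open>Tr(\<lambda>,2,n,m,\<epsilon>)\<close> with \<open>\<lambda>\<close> on the unit circle (\<open>\<lambda> = \<plusminus>1\<close> allowed).\<close>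

definition Tr_2_circle ::
    "complex \<Rightarrow> nat \<Rightarrow> nat \<Rightarrow> int \<Rightarrow> ('v::real_vector \<Rightarrow> 'v) \<Rightarrow> ('v \<Rightarrow> 'v \<Rightarrow> real) \<Rightarrow> bool" where
  "Tr_2_circle lam n m \<epsilon> M S \<longleftrightarrow> isometric_triple M S \<and> norm lam = 1 \<and>
     dim (UNIV :: 'v set) = 2 * n \<and>
     (\<exists>Ms Mu H1 as. jordan_parts M Ms Mu \<and> (let N = cmap (log_unipotent Mu); as' = map cconj as in
        direct_sum [H1, cconj ` H1] \<and>
        length as = n \<and> is_basis_of cscale as H1 \<and>
        acts_as_scalar cscale (cmap Ms) lam H1 \<and>
        acts_as_scalar cscale (cmap Ms) (cnj lam) (cconj ` H1) \<and>
        acts_by cscale N as (J_mat n) \<and> acts_by cscale N as' (J_mat n) \<and>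
        gram_blocks (cform S) [as, as'] =
          [[0\<^sub>m n n, (\<i> ^ (n + m + 1) * of_int \<epsilon>) \<cdot>\<^sub>m E_per n],
           [(\<i> ^ (n + m + 1) * of_int \<epsilon> * (-1) ^ (n + m + 1)) \<cdot>\<^sub>m E_per n, 0\<^sub>m n n]]))"

text \<open>\<open>Tr(\<lambda>,2,n,m)\<close> with real \<open>|\<lambda>| > 1\<close>.\<close>

definition Tr_2_real ::
    "real \<Rightarrow> nat \<Rightarrow> nat \<Rightarrow> ('v::real_vector \<Rightarrow> 'v) \<Rightarrow> ('v \<Rightarrow> 'v \<Rightarrow> real) \<Rightarrow> bool" where
  "Tr_2_real lam n m M S \<longleftrightarrow> isometric_triple M S \<and> (lam > 1 \<or> lam < -1) \<and>
     (\<exists>Ms Mu H1 H2 as bs. jordan_parts M Ms Mu \<and> (let N = log_unipotent Mu in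
        direct_sum [H1, H2] \<and>
        length as = n \<and> is_basis_of scaleR as H1 \<and>
        length bs = n \<and> is_basis_of scaleR bs H2 \<and>
        acts_as_scalar scaleR Ms lam H1 \<and> acts_as_scalar scaleR Ms (inverse lam) H2 \<and>
        acts_by scaleR N as (J_mat n) \<and> acts_by scaleR N bs (J_mat n) \<and>
        gram_blocks S [as, bs] =
          [[0\<^sub>m n n, E_per n],
           [(-1) ^ (n + m + 1) \<cdot>\<^sub>m E_per n, 0\<^sub>m n n]]))"

definition Tr_4 ::
    "complex \<Rightarrow> nat \<Rightarrow> nat \<Rightarrow> ('v::real_vector \<Rightarrow> 'v) \<Rightarrow> ('v \<Rightarrow> 'v \<Rightarrow> real) \<Rightarrow> bool" where
  "Tr_4 lam n m M S \<longleftrightarrow> isometric_triple M S \<and>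
     (\<exists>Ms Mu H1 H2 as bs. jordan_parts M Ms Mu \<and>
       (let N = cmap (log_unipotent Mu); as' = map cconj as; bs' = map cconj bs;
            Z = 0\<^sub>m n n; E = E_per n; E' = (-1) ^ (n + m + 1) \<cdot>\<^sub>m E_per n in
        direct_sum [H1, H2, cconj ` H1, cconj ` H2] \<and>
        length as = n \<and> is_basis_of cscale as H1 \<and>
        length bs = n \<and> is_basis_of cscale bs H2 \<and>
        acts_as_scalar cscale (cmap Ms) lam H1 \<and>
        acts_as_scalar cscale (cmap Ms) (inverse lam) H2 \<and>
        acts_as_scalar cscale (cmap Ms) (cnj lam) (cconj ` H1) \<and>
        acts_as_scalar cscale (cmap Ms) (inverse (cnj lam)) (cconj ` H2) \<and>
        acts_by cscale N as (J_mat n) \<and> acts_by cscale N bs (J_mat n) \<and>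
        acts_by cscale N as' (J_mat n) \<and> acts_by cscale N bs' (J_mat n) \<and>
        gram_blocks (cform S) [as, bs, as', bs'] =
          [[Z,  E, Z,  Z],
           [E', Z, Z,  Z],
           [Z,  Z, Z,  E],
           [Z,  Z, E', Z]]))"

end

theory Submission
  imports Defs
begin

text \<open>
  Write \<open>M = Ms Mu\<close>, \<open>Y = Mu - 1\<close>, \<open>N = log Mu\<close> and \<open>S = I_s L\<close>. Since \<open>M\<close> is an isometry of \<open>L\<close>, the
  eigenspaces of \<open>Ms\<close> for \<open>\<alpha>\<close> and \<open>\<beta>\<close> are \<open>L\<close>-orthogonal unless \<open>\<alpha> \<beta> = 1\<close> (\<open>eig_orthogonal\<close>). So \<open>Ms\<close>
  is an isometry too, then \<open>Mu\<close>, and \<open>N\<close> is antisymmetric: \<open>L (N a) b = - L a (N b)\<close>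
  (\<open>log_antisymmetric\<close>).

  Everything about \<open>S\<close> comes from \<open>S a b = L (a + M a) b\<close>. The radical of \<open>S\<close> is the kernel of \<open>1 + M\<close>.
  If it vanishes, \<open>1 + M\<close> maps each invariant subspace onto itself, so an \<open>S\<close>-orthogonal invariant
  splitting is \<open>L\<close>-orthogonal, and irreducibility of \<open>(H, L)\<close> gives that of \<open>(H, M, S)\<close>.

  The Jordan blocks enter only through \<open>N^n = 0\<close> and \<open>N^(n-1) \<noteq> 0\<close> (\<open>jordan_blocks\<close>); counting
  dimensions does the rest. For the signature, \<open>S (N^k x) (N^k x) = \<plusminus> S x (N^(2k) x)\<close> shows that the
  ranges of \<open>N^k\<close> with \<open>2 k\<close> near \<open>n\<close> are isotropic or semidefinite. A semidefinite subspace bounds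
  the dimension of definite subspaces of the opposite sign, and the bounds obtained from two such
  ranges add up to the codimension of the radical, so both are attained
  (\<open>has_signature_of_semidefinite\<close>). Where a sign decides, it is that of \<open>S x (N^(n-1) x)\<close>, which is
  \<open>L x (N^(n-1) x)\<close> up to the factor \<open>1 + \<lambda>\<close>; for \<open>\<lambda> = -1\<close> the operator \<open>1 + M = - Y\<close> takes the place of
  this factor and shifts the exponent by one. Off the unit circle the real parts of two eigenspaces
  are isotropic and span the space.

  For the type of the triple, a generator \<open>a\<close> is normalized by adding multiples of \<open>N^k a\<close>, which
  removes the products \<open>S a (N^j b)\<close> one by one (\<open>kill_lower_coefficients\<close>). The Gram matrix of the
  chains \<open>a, N a, N^2 a, ...\<close> is then the prescribed one. Being invertible, it shows that the chains
  are independent, and they form a basis because their number is the dimension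
  (\<open>paired_chains_basis\<close>).
\<close>

section \<open>Finite-dimensional real spaces\<close>

lemma linear_funpow: "linear N \<Longrightarrow> linear (N ^^ k)" for N :: "'v::real_vector \<Rightarrow> 'v"
  by (induction k) (simp_all add: linear_iff)

locale finite_dim_real =
  fixes carrier_type :: "'v::real_vector itself"
  assumes finite_dim: "finite_dim TYPE('v)"
begin

text \<open>An arbitrary basis: it makes the theory of finite-dimensional vector spaces available for the type.\<close>
definition some_basis :: "'v set" where
  "some_basis = (SOME B. finite B \<and> independent B \<and> span B = UNIV)"

lemma some_basis: "finite some_basis" "independent some_basis" "span some_basis = UNIV"
proof -
  obtain B :: "'v set" where B: "finite B" "span B = UNIV"
    using finite_dim unfolding finite_dim_def by auto
  obtain C where "C \<subseteq> B" "independent C" "B \<subseteq> span C"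
    using real_vector.maximal_independent_subset[of B] by blast
  then have "finite C \<and> independent C \<and> span C = UNIV"
    using B finite_subset by (metis real_vector.span_mono real_vector.span_span top.extremum_uniqueI)
  then have "finite some_basis \<and> independent some_basis \<and> span some_basis = UNIV"
    unfolding some_basis_def by (rule someI)
  then show "finite some_basis" "independent some_basis" "span some_basis = UNIV" by auto
qed

sublocale rv: finite_dimensional_vector_space "(*\<^sub>R) :: real \<Rightarrow> 'v \<Rightarrow> 'v" some_basis
  rewrites "module.dependent ((*\<^sub>R) :: real \<Rightarrow> 'v \<Rightarrow> 'v) = dependent"
    and "module.subspace ((*\<^sub>R) :: real \<Rightarrow> 'v \<Rightarrow> 'v) = subspace"
    and "module.span ((*\<^sub>R) :: real \<Rightarrow> 'v \<Rightarrow> 'v) = span"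
    and "vector_space.dim ((*\<^sub>R) :: real \<Rightarrow> 'v \<Rightarrow> 'v) = dim"
    and "Vector_Spaces.linear ((*\<^sub>R) :: real \<Rightarrow> 'v \<Rightarrow> 'v) ((*\<^sub>R) :: real \<Rightarrow> 'v \<Rightarrow> 'v) = linear"
proof -
  show "finite_dimensional_vector_space ((*\<^sub>R) :: real \<Rightarrow> 'v \<Rightarrow> 'v) some_basis"
    by unfold_locales
      (use some_basis in \<open>simp_all add: dependent_raw_def span_raw_def\<close>)
qed (simp_all add: dependent_raw_def span_raw_def subspace_raw_def dim_raw_def linear_def fun_eq_iff)

text \<open>
  A basis of the kernel in \<open>W\<close> extends to a basis of \<open>W\<close>, and \<open>f\<close> is injective on the span of the
  vectors that were added.
\<close>
lemma rank_nullity: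
  fixes f :: "'v \<Rightarrow> 'w::real_vector"
  assumes f: "linear f" and W: "subspace W"
  shows "dim (f ` W) + dim {x \<in> W. f x = 0} = dim W"
proof -
  interpret f: linear f by fact
  interpret pair: finite_dimensional_vector_space_pair_1 "(*\<^sub>R) :: real \<Rightarrow> 'v \<Rightarrow> 'v" some_basis
      "(*\<^sub>R) :: real \<Rightarrow> 'w \<Rightarrow> 'w"
    by unfold_locales
  let ?K = "{x \<in> W. f x = 0}"
  have K: "subspace ?K"
    using W by (auto simp: real_vector.subspace_def f.add f.scale f.zero)
  obtain B0 where B0: "B0 \<subseteq> ?K" "independent B0" "?K \<subseteq> span B0" "card B0 = dim ?K"
    using real_vector.basis_exists by blast
  obtain B where B: "B0 \<subseteq> B" "B \<subseteq> W" "independent B" "W \<subseteq> span B"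
    using real_vector.maximal_independent_subset_extend[of B0 W] B0 by auto
  have fin: "finite B" using B rv.finiteI_independent by auto
  define C where "C = B - B0"
  have ind: "independent C" using B C_def real_vector.dependent_mono by blast
  have W': "span B = W" using B W by (simp add: real_vector.span_subspace)
  have K': "span B0 = ?K" using B0 K by (simp add: real_vector.span_subspace)
  have BC: "B = B0 \<union> C" "B0 \<inter> C = {}" using B C_def by auto
  have card: "card B = card B0 + card C"
    using BC fin by (metis card_Un_disjoint finite_Un)
  have sum: "{x + y |x y. x \<in> span B0 \<and> y \<in> span C} = W"
    using W' BC real_vector.span_Un[of B0 C] by auto
  have "dim W + dim (span B0 \<inter> span C) = card B0 + card C"
    using rv.dim_sums_Int[of "span B0" "span C"] sum B0(2) ind
    by (simp add: real_vector.dim_eq_card_independent)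
  moreover have "dim W = card B"
    using W' B(3) by (metis real_vector.dim_eq_card_independent real_vector.dim_span)
  ultimately have "dim (span B0 \<inter> span C) = 0" using card by auto
  then have int: "?K \<inter> span C \<subseteq> {0}" using K' by simp
  have CW: "span C \<subseteq> W" using W' BC real_vector.span_mono by (metis sup_ge2)
  have inj: "inj_on f (span C)"
  proof (rule inj_onI)
    fix x y assume xy: "x \<in> span C" "y \<in> span C" "f x = f y"
    have "x - y \<in> span C" using xy by (simp add: real_vector.span_diff)
    moreover have "f (x - y) = 0" using xy by (simp add: f.diff)
    ultimately have "x - y \<in> {0}" using int CW by blast
    then show "x = y" by simp
  qed
  have "dim (f ` C) = dim C"
    using pair.dim_image_eq[of f C] f inj
    by (simp add: linear_def span_raw_def dim_raw_def)
  then have "dim (f ` span C) = dim (span C)"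
    by (simp add: linear_span_image[OF f, symmetric])
  moreover have "f ` W = f ` span C"
  proof
    show "f ` W \<subseteq> f ` span C"
    proof
      fix z assume "z \<in> f ` W"
      then obtain x y where "x \<in> span B0" "y \<in> span C" "z = f (x + y)" using sum by blast
      moreover have "f x = 0" using \<open>x \<in> span B0\<close> K' by blast
      ultimately show "z \<in> f ` span C" by (simp add: f.add)
    qed
  qed (use CW in auto)
  ultimately have "dim (f ` W) = card C"
    using ind by (simp add: real_vector.dim_eq_card_independent)
  then show ?thesis using B0(4) card \<open>dim W = card B\<close> by simp
qed

lemma dim_add_le_of_disjoint:
  assumes "subspace W" "subspace T" "W \<inter> T \<subseteq> {0 :: 'v}"
  shows "dim W + dim T \<le> dim (UNIV :: 'v set)"
proof -
  have "dim (W \<inter> T) = 0" using assms(3) by simp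
  then show ?thesis
    using rv.dim_sums_Int[OF assms(1,2)] rv.dim_subset_UNIV
    by (metis (no_types, lifting) add.right_neutral rv.dim_subset subset_UNIV)
qed

lemma sum_UNIV_of_dim:
  assumes "subspace W" "subspace T" "W \<inter> T \<subseteq> {0 :: 'v}" "dim (UNIV :: 'v set) \<le> dim W + dim T"
  shows "\<exists>x\<in>W. \<exists>y\<in>T. v = x + y"
proof -
  let ?S = "{x + y |x y. x \<in> W \<and> y \<in> T}"
  have "dim (W \<inter> T) = 0" using assms(3) by simp
  then have "dim (UNIV :: 'v set) \<le> dim ?S"
    using rv.dim_sums_Int[OF assms(1,2)] assms(4) by linarith
  moreover have "subspace ?S" using real_vector.subspace_sums assms by blast
  ultimately have "?S = UNIV"
    using rv.subspace_dim_equal[of ?S UNIV] by simp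
  then show ?thesis by blast
qed

text \<open>Every basis vector of \<open>W\<close> imposes one linear equation, which lowers the dimension by at most one.\<close>
lemma dim_annihilator:
  fixes S :: "'v \<Rightarrow> 'v \<Rightarrow> real"
  assumes S: "bilinear S" and W: "subspace W"
  shows "dim (UNIV :: 'v set) \<le> dim W + dim {x. \<forall>w\<in>W. S x w = 0}"
proof -
  have lin: "linear (\<lambda>x. S x w)" for w using S by (simp add: bilinear_def)
  have *: "dim (UNIV :: 'v set) \<le> card B + dim {x. \<forall>w\<in>B. S x w = 0}" if "finite B" for B
    using that
  proof induction
    case (insert b B)
    let ?U = "{x. \<forall>w\<in>B. S x w = 0}"
    have "subspace ?U"
      by (auto simp: real_vector.subspace_def linear_0[OF lin] linear_add[OF lin] linear_scale[OF lin])
    then have "dim ((\<lambda>x. S x b) ` ?U) + dim {x \<in> ?U. S x b = 0} = dim ?U"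
      by (rule rank_nullity[OF lin])
    moreover have "dim ((\<lambda>x. S x b) ` ?U) \<le> 1"
      using dim_subset_UNIV[of "(\<lambda>x. S x b) ` ?U"] by simp
    moreover have "{x \<in> ?U. S x b = 0} = {x. \<forall>w\<in>insert b B. S x w = 0}" by auto
    ultimately show ?case using insert by auto
  qed simp
  obtain B where B: "B \<subseteq> W" "independent B" "W \<subseteq> span B" "card B = dim W"
    using real_vector.basis_exists by blast
  have "S x w = 0" if "\<forall>b\<in>B. S x b = 0" "w \<in> W" for x w
  proof -
    have "linear (\<lambda>w. S x w)" using S by (simp add: bilinear_def)
    then show ?thesis
      using real_vector.linear_eq_0_on_span[of "\<lambda>w. S x w" B w] that B by auto
  qed
  then have "{x. \<forall>w\<in>B. S x w = 0} = {x. \<forall>w\<in>W. S x w = 0}" using B(1) by auto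
  then show ?thesis using *[of B] B rv.finiteI_independent by auto
qed

text \<open>
  This replaces a Jordan basis of \<open>N\<close>. From \<open>range (N^k)\<close> to \<open>range (N^(k+1))\<close> at least the \<open>m\<close>
  dimensions of \<open>range (N^(n-1))\<close> are lost, because that space lies in the kernel of \<open>N\<close>. There are
  \<open>n\<close> steps and \<open>m n\<close> dimensions, so each step loses exactly \<open>m\<close>.
\<close>
lemma dim_range_funpow_nilpotent:
  fixes N :: "'v \<Rightarrow> 'v"
  assumes N: "linear N" and nil: "\<And>x :: 'v. (N ^^ n) x = 0"
    and V: "dim (UNIV :: 'v set) = m * n" and last: "m \<le> dim (range (N ^^ (n - 1)))" and n: "n \<ge> 1"
  shows "k \<le> n \<Longrightarrow> dim (range (N ^^ k)) = m * (n - k)" and "dim {x. N x = 0} = m"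
proof -
  have lin: "linear (N ^^ k)" for k using linear_funpow[OF N] .
  have sub: "subspace (range (N ^^ k))" for k
    using linear_subspace_image[OF lin] by simp
  have step: "dim (range (N ^^ Suc k)) + dim {x \<in> range (N ^^ k). N x = 0} = dim (range (N ^^ k))" for k
    using rank_nullity[OF N sub[of k]] by (simp add: image_image)
  have drop: "dim (range (N ^^ Suc k)) + m \<le> dim (range (N ^^ k))" if "k < n" for k
  proof -
    have "range (N ^^ (n - 1)) \<subseteq> {x \<in> range (N ^^ k). N x = 0}"
    proof
      fix y assume "y \<in> range (N ^^ (n - 1))"
      then obtain x where y: "y = (N ^^ (n - 1)) x" by auto
      have "y = (N ^^ k) ((N ^^ (n - 1 - k)) x)"
        using that by (simp add: y funpow_add[symmetric, THEN fun_cong, unfolded o_def])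
      moreover have "N y = (N ^^ Suc (n - 1)) x" using y by simp
      ultimately show "y \<in> {x \<in> range (N ^^ k). N x = 0}" using nil n by auto
    qed
    then have "m \<le> dim {x \<in> range (N ^^ k). N x = 0}"
      using last rv.dim_subset le_trans by blast
    then show ?thesis using step[of k] by linarith
  qed
  have upper: "dim (range (N ^^ k)) + m * k \<le> m * n" if "k \<le> n" for k
    using that
  proof (induction k)
    case (Suc k)
    then show ?case using drop[of k] by simp
  qed (use V in simp)
  have lower: "m * i \<le> dim (range (N ^^ (n - i)))" if "i \<le> n" for i
    using that
  proof (induction i)
    case (Suc i)
    then have "Suc (n - Suc i) = n - i" by simp
    then show ?case using drop[of "n - Suc i"] Suc by simp
  qed simp
  show eq: "dim (range (N ^^ k)) = m * (n - k)" if "k \<le> n" for k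
    using upper[OF that] lower[of "n - k"] that by (simp add: diff_mult_distrib2)
  show "dim {x. N x = 0} = m"
  proof -
    have "dim (range N) + dim {x. N x = 0} = m * n" using step[of 0] V by simp
    moreover have "dim (range N) = m * (n - 1)" using eq[of 1] n by simp
    moreover have "m * n = m * (n - 1) + m" using n by (cases n) auto
    ultimately show ?thesis by linarith
  qed
qed

end

section \<open>Signatures\<close>

lemma bilinear_linear_left: "bilinear S \<Longrightarrow> linear (\<lambda>x. S x w)"
  and bilinear_linear_right: "bilinear S \<Longrightarrow> linear (S x)"
  by (simp_all add: bilinear_def)

lemmas bilinear_simps = bilinear_ladd bilinear_radd bilinear_lmul bilinear_rmul
  bilinear_lneg bilinear_rneg bilinear_lzero bilinear_rzero bilinear_lsub bilinear_rsub

text \<open>The Cauchy-Schwarz argument: otherwise the form takes a positive value on the line \<open>t r + y\<close>.\<close>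
lemma semidefinite_isotropic_orthogonal:
  assumes S: "bilinear S" and sym: "\<And>a b. S a b = S b a" and U: "subspace U"
    and neg: "\<And>x. x \<in> U \<Longrightarrow> S x x \<le> (0::real)"
    and r: "r \<in> U" "S r r = 0" and y: "y \<in> U"
  shows "S r y = 0"
proof (rule ccontr)
  assume ne: "S r y \<noteq> 0"
  (* for this t the form takes the value 1 at t r + y *)
  define t where "t = (1 - S y y) / (2 * S r y)"
  have "t *\<^sub>R r + y \<in> U" using U r y by (simp add: real_vector.subspace_add real_vector.subspace_scale)
  then have "S (t *\<^sub>R r + y) (t *\<^sub>R r + y) \<le> 0" by (rule neg)
  moreover have "S (t *\<^sub>R r + y) (t *\<^sub>R r + y) = 2 * (t * S r y) + S y y"
    using r(2) by (simp add: bilinear_simps[OF S] sym[of y r])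
  moreover have "t * S r y = (1 - S y y) / 2" using ne by (simp add: t_def)
  ultimately show False by (simp add: field_simps)
qed

context finite_dim_real
begin

text \<open>
  \<open>P\<close> is a positive definite subspace of maximal dimension. By maximality the form is negative
  semidefinite on the orthogonal complement of \<open>P\<close>; its isotropic vectors there form the radical, so
  every complement of the radical in it is negative definite.
\<close>
lemma exists_definite_splitting:
  fixes S :: "'v \<Rightarrow> 'v \<Rightarrow> real"
  assumes S: "bilinear S" and sym: "\<And>a b. S a b = S b a"
  obtains P R where "subspace P" "\<And>x. x \<in> P \<Longrightarrow> x \<noteq> 0 \<Longrightarrow> S x x > 0"
    "subspace R" "\<And>x. x \<in> R \<Longrightarrow> x \<noteq> 0 \<Longrightarrow> S x x < 0"
    "dim P + dim R + dim (radical S) = dim (UNIV :: 'v set)"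
proof -
  let ?pos = "\<lambda>W. subspace W \<and> (\<forall>x\<in>W. x \<noteq> 0 \<longrightarrow> S x x > 0)"
  have "\<exists>W. ?pos W \<and> (\<forall>W'. ?pos W' \<longrightarrow> dim W' \<le> dim W)"
  proof -
    have 1: "?pos {0}" by auto
    have 2: "\<forall>W. ?pos W \<longrightarrow> dim W < Suc (dim (UNIV :: 'v set))"
      using rv.dim_subset by (metis le_imp_less_Suc subset_UNIV)
    show ?thesis using ex_has_greatest_nat[of ?pos "{0}" dim, OF 1 2] by blast
  qed
  then obtain P where P: "subspace P" "\<And>x. x \<in> P \<Longrightarrow> x \<noteq> 0 \<Longrightarrow> S x x > 0"
    and max: "\<And>W. ?pos W \<Longrightarrow> dim W \<le> dim P" by blast
  let ?U = "{x. \<forall>w\<in>P. S x w = 0}"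
  have U: "subspace ?U" by (auto simp: real_vector.subspace_def bilinear_simps[OF S])
  have PU: "P \<inter> ?U \<subseteq> {0}" using P(2) by force
  have dU: "dim (UNIV :: 'v set) \<le> dim P + dim ?U" by (rule dim_annihilator[OF S P(1)])
  then have dU': "dim P + dim ?U = dim (UNIV :: 'v set)"
    using dim_add_le_of_disjoint[OF P(1) U PU] by simp
  have split: "\<exists>x\<in>P. \<exists>y\<in>?U. v = x + y" for v
    by (rule sum_UNIV_of_dim[OF P(1) U PU dU])
  have neg: "S x x \<le> 0" if x: "x \<in> ?U" for x
  proof (rule ccontr)
    assume "\<not> S x x \<le> 0"
    then have pos: "S x x > 0" by simp
    have "x \<notin> P" using pos PU x by (auto simp: bilinear_simps[OF S])
    then have "x \<notin> span P" using P(1) by (simp add: real_vector.span_eq_iff[THEN iffD2])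
    then have "dim (insert x P) = dim P + 1" by (simp add: rv.dim_insert)
    moreover have "?pos (span (insert x P))"
    proof (intro conjI ballI impI)
      fix y assume y: "y \<in> span (insert x P)" "y \<noteq> 0"
      then obtain k where k: "y - k *\<^sub>R x \<in> span P" by (auto simp: real_vector.span_insert)
      define p where "p = y - k *\<^sub>R x"
      have p: "p \<in> P" using k P(1) by (simp add: p_def real_vector.span_eq_iff[THEN iffD2])
      have "S x p = 0" "S p x = 0" using x p sym by auto
      then have "S y y = S p p + k * k * S x x"
        by (simp add: p_def bilinear_simps[OF S] algebra_simps)
      moreover have "S p p \<ge> 0" using P(2)[OF p] by (cases "p = 0") (auto simp: bilinear_simps[OF S])
      moreover have "S p p > 0 \<or> k \<noteq> 0" using y P(2)[OF p] p_def by force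
      moreover have "k * k * S x x > 0" if "k \<noteq> 0" using pos that zero_less_mult_iff[of k k] by auto
      ultimately show "S y y > 0" by fastforce
    qed simp
    ultimately show False using max[of "span (insert x P)"] by simp
  qed
  have rad: "radical S \<subseteq> ?U" by (auto simp: radical_def)
  have subrad: "subspace (radical S)"
    by (auto simp: radical_def real_vector.subspace_def bilinear_simps[OF S])
  obtain B0 where B0: "B0 \<subseteq> radical S" "independent B0" "radical S \<subseteq> span B0" "card B0 = dim (radical S)"
    using real_vector.basis_exists by blast
  have B0U: "B0 \<subseteq> ?U" using B0(1) rad by blast
  obtain B where B: "B0 \<subseteq> B" "B \<subseteq> ?U" "independent B" "?U \<subseteq> span B"
    using real_vector.maximal_independent_subset_extend[OF B0U B0(2)] by blast
  define R where "R = span (B - B0)"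
  have fin: "finite B" using B rv.finiteI_independent by auto
  have ind: "independent (B - B0)" using B real_vector.dependent_mono by blast
  have dR: "dim R = card B - card B0"
    using ind fin B(1) by (simp add: R_def real_vector.dim_eq_card_independent card_Diff_subset finite_subset)
  have dB: "card B = dim ?U" using real_vector.basis_card_eq_dim B by auto
  have sumR: "{x + y |x y. x \<in> span B0 \<and> y \<in> R} = span B"
    using real_vector.span_Un[of B0 "B - B0"] B(1) by (simp add: R_def Un_absorb1)
  have "dim (span B) + dim (span B0 \<inter> R) = card B0 + dim R"
    using rv.dim_sums_Int[of "span B0" R] sumR B0(2)
    by (simp add: real_vector.dim_eq_card_independent R_def)
  then have "dim (span B0 \<inter> R) = 0"
    using dR card_mono[OF fin B(1)] B(3) by (simp add: real_vector.dim_eq_card_independent)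
  then have int: "radical S \<inter> R \<subseteq> {0}" using B0(3) by auto
  have RU: "R \<subseteq> ?U" using B(2) U by (simp add: R_def) (meson Diff_subset order_trans real_vector.span_minimal)
  have negR: "S x x < 0" if x: "x \<in> R" "x \<noteq> 0" for x
  proof (rule ccontr)
    assume "\<not> S x x < 0"
    then have x0: "S x x = 0" using neg RU x by force
    have "S x v = 0" for v
    proof -
      obtain p u where "p \<in> P" "u \<in> ?U" "v = p + u" using split by blast
      moreover have "S x u = 0" using semidefinite_isotropic_orthogonal[OF S sym U neg _ x0] x RU \<open>u \<in> ?U\<close> by blast
      moreover have "S x p = 0" using x RU \<open>p \<in> P\<close> by blast
      ultimately show ?thesis by (simp add: bilinear_simps[OF S])
    qed
    then show False using int x by (auto simp: radical_def)
  qed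
  show ?thesis
  proof
    show "dim P + dim R + dim (radical S) = dim (UNIV :: 'v set)"
      using dR dB dU' B0(4) card_mono[OF fin B(1)] by linarith
  qed (use P negR in \<open>auto simp: R_def\<close>)
qed

text \<open>
  A definite subspace meets a semidefinite one of the opposite sign only in \<open>0\<close>, which bounds its
  dimension. The bounds \<open>p\<close> and \<open>r\<close> add up to the codimension of the radical, and by
  \<open>exists_definite_splitting\<close> the indices do so too; hence the bounds are sharp.
\<close>
lemma has_signature_of_semidefinite:
  fixes S :: "'v \<Rightarrow> 'v \<Rightarrow> real"
  assumes S: "bilinear S" and sym: "\<And>a b. S a b = S b a"
    and T1: "subspace T1" "\<And>x. x \<in> T1 \<Longrightarrow> S x x \<ge> 0" "p + q \<le> dim T1"
    and T2: "subspace T2" "\<And>x. x \<in> T2 \<Longrightarrow> S x x \<le> 0" "q + r \<le> dim T2"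
    and q: "dim (radical S) = q" and d: "p + q + r = dim (UNIV :: 'v set)"
  shows "has_signature S (p, q, r)"
proof -
  have posle: "dim W \<le> p" if "subspace W" "\<forall>w\<in>W. w \<noteq> 0 \<longrightarrow> S w w > 0" for W
  proof -
    have "W \<inter> T2 \<subseteq> {0}" using that(2) T2(2) by (metis IntE not_less singletonI subsetI)
    then show ?thesis using dim_add_le_of_disjoint[OF that(1) T2(1)] T2(3) d by linarith
  qed
  have negle: "dim W \<le> r" if "subspace W" "\<forall>w\<in>W. w \<noteq> 0 \<longrightarrow> S w w < 0" for W
  proof -
    have "W \<inter> T1 \<subseteq> {0}" using that(2) T1(2) by (metis IntE not_less singletonI subsetI)
    then show ?thesis using dim_add_le_of_disjoint[OF that(1) T1(1)] T1(3) d by linarith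
  qed
  obtain P R where PR: "subspace P" "\<And>x. x \<in> P \<Longrightarrow> x \<noteq> 0 \<Longrightarrow> S x x > 0"
    "subspace R" "\<And>x. x \<in> R \<Longrightarrow> x \<noteq> 0 \<Longrightarrow> S x x < 0"
    "dim P + dim R + dim (radical S) = dim (UNIV :: 'v set)"
    using exists_definite_splitting[OF S sym] by metis
  have "dim P \<le> p" "dim R \<le> r" using posle negle PR by auto
  then have "dim P = p" "dim R = r" using PR(5) q d by auto
  then show ?thesis
    unfolding has_signature_def max_pos_dim_def using PR posle negle q d by auto
qed

text \<open>
  Isotropic subspaces of a nondegenerate form have at most half the dimension, so two of them that
  span the space have exactly half.
\<close>
lemma has_signature_of_isotropic_sum:
  fixes S :: "'v \<Rightarrow> 'v \<Rightarrow> real"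
  assumes S: "bilinear S" and sym: "\<And>a b. S a b = S b a" and nondeg: "radical S = {0}"
    and A: "subspace A" "\<And>x. x \<in> A \<Longrightarrow> S x x = 0" and B: "subspace B" "\<And>x. x \<in> B \<Longrightarrow> S x x = 0"
    and AB: "\<And>v. \<exists>x\<in>A. \<exists>y\<in>B. v = x + y" and d: "dim (UNIV :: 'v set) = 2 * m"
  shows "has_signature S (m, 0, m)"
proof -
  obtain P R where PR: "subspace P" "\<And>x. x \<in> P \<Longrightarrow> x \<noteq> 0 \<Longrightarrow> S x x > 0"
    "subspace R" "\<And>x. x \<in> R \<Longrightarrow> x \<noteq> 0 \<Longrightarrow> S x x < 0"
    "dim P + dim R + dim (radical S) = dim (UNIV :: 'v set)"
    using exists_definite_splitting[OF S sym] by metis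
  have PR_dim: "dim P + dim R = 2 * m" using PR(5) nondeg d by simp
  have le: "dim P + dim C \<le> 2 * m" "dim R + dim C \<le> 2 * m"
    if C: "subspace C" "\<And>x. x \<in> C \<Longrightarrow> S x x = 0" for C
  proof -
    have "P \<inter> C \<subseteq> {0}" using C(2) PR(2) by (metis IntE less_irrefl singletonI subsetI)
    then show "dim P + dim C \<le> 2 * m" using dim_add_le_of_disjoint[OF PR(1) C(1)] d by simp
    have "R \<inter> C \<subseteq> {0}" using C(2) PR(4) by (metis IntE less_irrefl singletonI subsetI)
    then show "dim R + dim C \<le> 2 * m" using dim_add_le_of_disjoint[OF PR(3) C(1)] d by simp
  qed
  have "{x + y |x y. x \<in> A \<and> y \<in> B} = UNIV" using AB by blast
  then have "2 * m \<le> dim A + dim B"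
    using rv.dim_sums_Int[OF A(1) B(1)] d by (simp only:)
  then have "dim A = m" using PR_dim le[OF A] le[OF B] by linarith
  then show ?thesis
    using has_signature_of_semidefinite[OF S sym A(1) _ _ A(1), of m 0 m] A(2) nondeg d by simp
qed

end

section \<open>The logarithm of a unipotent map\<close>

definition log_coeff :: "nat \<Rightarrow> real" where "log_coeff k = (-1) ^ (k + 1) / real k"

locale unipotent_map =
  fixes f :: "'v::real_vector \<Rightarrow> 'v"
  assumes unipotent: "unipotent f"
begin

definition Y :: "'v \<Rightarrow> 'v" where "Y x = f x - x"

text \<open>Some exponent that annihilates \<open>Y\<close>, used as a bound of summation.\<close>
definition height :: nat where "height = (SOME k. \<forall>x. (Y ^^ k) x = 0)"

abbreviation logf :: "'v \<Rightarrow> 'v" where "logf \<equiv> log_unipotent f"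

lemma linear_f: "linear f"
  using unipotent by (simp add: unipotent_def)

lemma linear_Y: "linear Y"
  using linear_f unfolding Y_def[abs_def] by (simp add: linear_iff algebra_simps)

lemmas linear_Y_funpow = linear_funpow[OF linear_Y]

lemma Y_height: "(Y ^^ height) x = 0"
proof -
  have "\<exists>k. \<forall>x. (Y ^^ k) x = 0"
    using unipotent by (simp add: unipotent_def Y_def[abs_def])
  then have "\<forall>x. (Y ^^ height) x = 0" unfolding height_def by (rule someI_ex)
  then show ?thesis by simp
qed

lemma Y_funpow_eq_0: "height \<le> k \<Longrightarrow> (Y ^^ k) x = 0"
  using funpow_add[of "k - height" height Y] Y_height linear_0[OF linear_Y_funpow] by simp

text \<open>The index set of the defining sum depends on \<open>x\<close>; a common one makes the linearity visible.\<close>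
lemma log_eq_sum: "logf x = (\<Sum>k<height. log_coeff k *\<^sub>R (Y ^^ k) x)"
proof -
  have Y: "(\<lambda>y. f y - y) = Y" by (simp add: Y_def[abs_def])
  have "{k. k \<ge> 1 \<and> (Y ^^ k) x \<noteq> 0} \<subseteq> {..<height}"
    using Y_funpow_eq_0 by (auto simp: not_less[symmetric])
  then show ?thesis
    unfolding log_unipotent_def Y log_coeff_def
    by (intro sum.mono_neutral_left) auto
qed

lemma linear_log: "linear logf"
  unfolding log_eq_sum[abs_def]
  by (intro linear_compose_sum ballI linear_compose_scale_right linear_Y_funpow)

lemma log_commute:
  assumes "linear g" "\<And>x. g (f x) = f (g x)"
  shows "g (logf x) = logf (g x)"
proof -
  have gY: "g (Y x) = Y (g x)" for x using assms by (simp add: Y_def linear_diff)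
  have "g ((Y ^^ k) x) = (Y ^^ k) (g x)" for k by (induction k) (simp_all add: gY)
  then show ?thesis
    by (simp add: log_eq_sum linear_sum[OF assms(1)] linear_scale[OF assms(1)])
qed

lemma log_factor:
  obtains Q where "linear Q" "\<And>x. Q (Y x) = Y (Q x)" "\<And>x. logf x = Y x + Y (Y (Q x))"
proof
  let ?Q = "\<lambda>x. \<Sum>k<height. log_coeff (k + 2) *\<^sub>R (Y ^^ k) x"
  show "linear ?Q" by (intro linear_compose_sum ballI linear_compose_scale_right linear_Y_funpow)
  show "?Q (Y x) = Y (?Q x)" for x
    by (simp add: linear_sum[OF linear_Y] linear_scale[OF linear_Y] funpow_swap1)
  show "logf x = Y x + Y (Y (?Q x))" for x
  proof -
    have "logf x = (\<Sum>k<height + 2. log_coeff k *\<^sub>R (Y ^^ k) x)"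
      unfolding log_eq_sum by (rule sum.mono_neutral_left) (auto simp: Y_funpow_eq_0 simp del: funpow.simps)
    also have "\<dots> = log_coeff 0 *\<^sub>R x + (log_coeff 1 *\<^sub>R Y x + (\<Sum>k<height. log_coeff (k + 2) *\<^sub>R (Y ^^ (k + 2)) x))"
      by (simp add: sum.lessThan_Suc_shift add_2_eq_Suc' del: sum.lessThan_Suc)
    also have "\<dots> = Y x + Y (Y (?Q x))"
      by (simp add: log_coeff_def linear_sum[OF linear_Y] linear_scale[OF linear_Y] linear_neg[OF linear_Y])
    finally show ?thesis .
  qed
qed

lemma log_Y: "logf (Y x) = Y (logf x)"
proof -
  have "f (Y x) = Y (f x)" for x by (simp add: Y_def linear_diff[OF linear_f])
  then show ?thesis using log_commute[of Y x] linear_Y by simp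
qed

text \<open>
  The logarithm is \<open>Y G\<close> with \<open>G = 1 + Y Q\<close>, and \<open>G\<close> is injective: \<open>G z = 0\<close> means \<open>z = - Y (Q z)\<close>, which
  can be iterated until a vanishing power of \<open>Y\<close> appears.
\<close>
lemma log_funpow_eq_0_iff: "(logf ^^ n) x = 0 \<longleftrightarrow> (Y ^^ n) x = 0"
proof -
  obtain Q where Q: "linear Q" "\<And>x. Q (Y x) = Y (Q x)" "\<And>x. logf x = Y x + Y (Y (Q x))"
    using log_factor by metis
  define G where "G x = x + Y (Q x)" for x
  have lG: "linear G"
    using Q(1) linear_Y by (simp add: G_def[abs_def] linear_iff algebra_simps)
  have logG: "logf x = Y (G x)" and GY: "G (Y x) = Y (G x)" for x
    using Q by (simp_all add: G_def linear_add[OF linear_Y])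
  have GYn: "G ((Y ^^ n) x) = (Y ^^ n) (G x)" for n x
    by (induction n) (simp_all add: GY)
  have GnY: "(G ^^ n) (Y x) = Y ((G ^^ n) x)" for n x
    by (induction n) (simp_all add: GY)
  have pow: "(logf ^^ n) x = (Y ^^ n) ((G ^^ n) x)" for n x
    by (induction n) (simp_all add: logG GYn)
  have GnYm: "(G ^^ n) ((Y ^^ m) x) = (Y ^^ m) ((G ^^ n) x)" for n m x
    by (induction m) (simp_all add: GnY)
  have inj: "z = 0" if "G z = 0" for z
  proof -
    have z: "z = - Y (Q z)" using that by (simp add: G_def eq_neg_iff_add_eq_0)
    have "\<exists>w. z = (Y ^^ k) w" for k
    proof (induction k)
      case (Suc k)
      then obtain w where w: "z = (Y ^^ k) w" by auto
      have QYk: "Q ((Y ^^ k) w) = (Y ^^ k) (Q w)" for k by (induction k) (simp_all add: Q(2))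
      have "z = (Y ^^ Suc k) (- Q w)"
        using z w QYk by (simp add: linear_neg[OF linear_Y] linear_neg[OF linear_Y_funpow])
      then show ?case by blast
    qed simp
    then show ?thesis using Y_height by metis
  qed
  have injn: "z = 0" if "(G ^^ n) z = 0" for n z
    using that by (induction n) (auto dest: inj)
  show ?thesis
    using pow[of n x] GnYm[of n n x] injn[of n "(Y ^^ n) x"] linear_0[OF linear_funpow[OF lG]]
    by metis
qed

lemma Y_eq_log: "logf (logf w) = 0 \<Longrightarrow> Y w = logf w"
proof -
  assume "logf (logf w) = 0"
  then have YY: "Y (Y w) = 0" using log_funpow_eq_0_iff[of 2 w] by (simp add: numeral_2_eq_2)
  obtain Q where Q: "linear Q" "\<And>x. Q (Y x) = Y (Q x)" "\<And>x. logf x = Y x + Y (Y (Q x))"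
    using log_factor by metis
  have "Y (Y (Q w)) = Q (Y (Y w))" by (simp add: Q(2))
  then show ?thesis using Q(3)[of w] YY linear_0[OF Q(1)] by simp
qed

text \<open>The range of summation does not depend on \<open>t\<close>, so the right-hand side is a polynomial in \<open>t\<close>.\<close>
lemma funpow_eq_binomial_sum: "(f ^^ t) x = (\<Sum>k<height. real (t choose k) *\<^sub>R (Y ^^ k) x)"
proof (induction t)
  case 0
  show ?case
  proof (cases height)
    case 0
    then show ?thesis using Y_height[of x] by simp
  next
    case (Suc h)
    then show ?thesis by (simp add: sum.lessThan_Suc_shift del: sum.lessThan_Suc)
  qed
next
  case (Suc t)
  have f: "(f ^^ Suc t) x = (f ^^ t) x + Y ((f ^^ t) x)" by (simp add: Y_def)
  have "Y (\<Sum>k<height. real (t choose k) *\<^sub>R (Y ^^ k) x)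
      = (\<Sum>k<height. real (t choose k) *\<^sub>R (Y ^^ Suc k) x)"
    by (simp add: linear_sum[OF linear_Y] linear_scale[OF linear_Y])
  also have "\<dots> = (\<Sum>k<Suc height. (if k = 0 then 0 else real (t choose (k - 1))) *\<^sub>R (Y ^^ k) x)"
    by (subst sum.lessThan_Suc_shift) simp
  also have "\<dots> = (\<Sum>k<height. (if k = 0 then 0 else real (t choose (k - 1))) *\<^sub>R (Y ^^ k) x)"
    by (simp add: Y_height)
  finally have "(f ^^ Suc t) x = (\<Sum>k<height. (real (t choose k) + (if k = 0 then 0 else real (t choose (k - 1)))) *\<^sub>R (Y ^^ k) x)"
    unfolding f Suc by (simp add: sum.distrib scaleR_add_left del: if_split)
  also have "\<dots> = (\<Sum>k<height. real (Suc t choose k) *\<^sub>R (Y ^^ k) x)"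
  proof (intro sum.cong refl)
    fix k show "(real (t choose k) + (if k = 0 then 0 else real (t choose (k - 1)))) *\<^sub>R (Y ^^ k) x
        = real (Suc t choose k) *\<^sub>R (Y ^^ k) x"
      by (cases k) (simp_all add: add.commute)
  qed
  finally show ?case .
qed

end

definition binomial_poly :: "nat \<Rightarrow> real poly" where
  "binomial_poly k = Polynomial.smult (1 / fact k) (\<Prod>i<k. [:- real i, 1:])"

lemma poly_binomial_poly: "poly (binomial_poly k) (real t) = real (t choose k)"
  by (simp add: binomial_poly_def poly_prod binomial_gbinomial gbinomial_prod_rev lessThan_atLeast0)

lemma coeff_0_binomial_poly: "Polynomial.coeff (binomial_poly k) 0 = (if k = 0 then 1 else 0)"
  using poly_binomial_poly[of k 0] by (cases k) (simp_all add: poly_0_coeff_0)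

text \<open>The logarithm is the derivative of \<open>f^t\<close> at \<open>t = 0\<close>, read off from the binomial expansion.\<close>
lemma coeff_1_binomial_poly: "Polynomial.coeff (binomial_poly k) 1 = log_coeff k"
proof (cases k)
  case 0
  then show ?thesis by (simp add: binomial_poly_def log_coeff_def)
next
  case (Suc m)
  have "(\<Prod>i<k. [:- real i, 1:]) = [:0, 1:] * (\<Prod>i<m. [:- real (Suc i), 1:])"
    unfolding Suc by (subst prod.lessThan_Suc_shift) simp
  then have "Polynomial.coeff (\<Prod>i<k. [:- real i, 1:]) 1 = poly (\<Prod>i<m. [:- real (Suc i), 1:]) 0"
    by (simp add: poly_0_coeff_0)
  also have "\<dots> = (\<Prod>i<m. - real (Suc i))" by (simp add: poly_prod)
  also have "\<dots> = (-1) ^ m * fact m"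
    by (induction m) (simp_all add: algebra_simps)
  finally show ?thesis
    by (simp add: binomial_poly_def Suc log_coeff_def divide_simps)
qed

text \<open>
  The function \<open>t \<mapsto> L (f^t a) (f^t b)\<close> is a polynomial that is constant on the natural numbers. So its
  linear coefficient, which is \<open>L (log f a) b + L a (log f b)\<close>, vanishes. This avoids the composition
  of power series that \<open>log (1/f) = - log f\<close> would require.
\<close>
lemma (in unipotent_map) log_antisymmetric:
  assumes L: "bilinear L" and iso: "\<And>a b. L (f a) (f b) = (L a b :: real)"
  shows "L (logf a) b = - L a (logf b)"
proof -
  define P where "P = (\<Sum>k<height. \<Sum>l<height. Polynomial.smult (L ((Y ^^ k) a) ((Y ^^ l) b)) (binomial_poly k * binomial_poly l))"
  have isot: "L ((f ^^ t) a) ((f ^^ t) b) = L a b" for t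
    by (induction t) (simp_all add: iso)
  have lsum: "L (\<Sum>i\<in>I. g i) y = (\<Sum>i\<in>I. L (g i) y)" "L y (\<Sum>i\<in>I. g i) = (\<Sum>i\<in>I. L y (g i))"
    for g y and I :: "nat set"
    using linear_sum[OF bilinear_linear_left[OF L]] linear_sum[OF bilinear_linear_right[OF L]] by auto
  have lsum2: "L (\<Sum>i\<in>I. g i) (\<Sum>j\<in>J. h j) = (\<Sum>i\<in>I. \<Sum>j\<in>J. L (g i) (h j))"
    for g h and I J :: "nat set"
    by (simp only: lsum(1)) (simp only: lsum(2))
  have "poly P (real t) = L a b" for t
  proof -
    have "L a b = L ((f ^^ t) a) ((f ^^ t) b)" by (simp add: isot)
    also have "\<dots> = poly P (real t)"
      unfolding funpow_eq_binomial_sum P_def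
      by (simp add: lsum2 bilinear_lmul[OF L] bilinear_rmul[OF L] poly_sum poly_binomial_poly mult_ac)
    finally show ?thesis by simp
  qed
  then have "range real \<subseteq> {x. poly (P - [:L a b:]) x = 0}" by auto
  moreover have "infinite (range real)"
    by (simp add: range_inj_infinite inj_on_def)
  ultimately have "infinite {x. poly (P - [:L a b:]) x = 0}"
    by (rule infinite_super)
  then have "P - [:L a b:] = 0" using poly_roots_finite[of "P - [:L a b:]"] by argo
  then have "Polynomial.coeff P 1 = 0" by (metis coeff_pCons_Suc coeff_0 One_nat_def eq_iff_diff_eq_0)
  moreover have "Polynomial.coeff (p * q) 1 = Polynomial.coeff p 0 * Polynomial.coeff q 1 + Polynomial.coeff p 1 * Polynomial.coeff q 0" for p q :: "real poly"
    by (simp add: coeff_mult)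
  ultimately have eq: "(\<Sum>k<height. \<Sum>l<height. L ((Y ^^ k) a) ((Y ^^ l) b) *
     ((if k = 0 then 1 else 0) * log_coeff l + log_coeff k * (if l = 0 then 1 else 0))) = 0"
    by (simp add: P_def coeff_sum coeff_0_binomial_poly coeff_1_binomial_poly[unfolded One_nat_def])
  show ?thesis
  proof (cases "height = 0")
    case True
    then show ?thesis using log_eq_sum bilinear_lzero[OF L] bilinear_rzero[OF L] by simp
  next
    case False
    have "(\<Sum>k<height. \<Sum>l<height. L ((Y ^^ k) a) ((Y ^^ l) b) * ((if k = 0 then 1 else 0) * log_coeff l))
        = (\<Sum>k<height. if k = 0 then (\<Sum>l<height. L a ((Y ^^ l) b) * log_coeff l) else 0)"
      by (intro sum.cong) auto
    also have "\<dots> = L a (logf b)"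
      using False by (simp add: log_eq_sum lsum bilinear_rmul[OF L] mult_ac)
    finally have 1: "(\<Sum>k<height. \<Sum>l<height. L ((Y ^^ k) a) ((Y ^^ l) b) * ((if k = 0 then 1 else 0) * log_coeff l))
        = L a (logf b)" .
    have "(\<Sum>k<height. \<Sum>l<height. L ((Y ^^ k) a) ((Y ^^ l) b) * (log_coeff k * (if l = 0 then 1 else 0)))
        = (\<Sum>k<height. \<Sum>l<height. if l = 0 then L ((Y ^^ k) a) b * log_coeff k else 0)"
      by (intro sum.cong) auto
    also have "\<dots> = L (logf a) b"
      using False by (simp add: log_eq_sum lsum bilinear_lmul[OF L] mult_ac)
    finally have 2: "(\<Sum>k<height. \<Sum>l<height. L ((Y ^^ k) a) ((Y ^^ l) b) * (log_coeff k * (if l = 0 then 1 else 0)))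
        = L (logf a) b" .
    show ?thesis using eq 1 2 by (simp add: distrib_left sum.distrib)
  qed
qed

section \<open>Complexification\<close>

interpretation cv: vector_space cscale
  by (rule vector_space_cscale)

lemmas complexification_defs = cscale_def cconj_def cmap_def cform_def

lemma complex_linear_cmap: "linear f \<Longrightarrow> Vector_Spaces.linear cscale cscale (cmap f)"
  by (intro Vector_Spaces.linear_iff[THEN iffD2] conjI vector_space_cscale)
    (simp_all add: complexification_defs linear_add linear_diff linear_scale)

lemma cmap_funpow: "(cmap f ^^ k) v = cmap (f ^^ k) v"
  by (induction k) (simp_all add: cmap_def)

lemma cconj_cconj [simp]: "cconj (cconj v) = v"
  by (simp add: cconj_def)

lemma cconj_cmap: "linear f \<Longrightarrow> cconj (cmap f v) = cmap f (cconj v)"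
  by (simp add: cconj_def cmap_def linear_neg)

lemma cconj_add: "cconj (v + w) = cconj v + cconj w"
  and cconj_cscale: "cconj (cscale c v) = cscale (cnj c) (cconj v)"
  and cconj_0 [simp]: "cconj 0 = 0"
  by (simp_all add: cconj_def cscale_def prod_eq_iff)

lemma cconj_cmap_funpow: "linear f \<Longrightarrow> cconj ((cmap f ^^ k) v) = (cmap f ^^ k) (cconj v)"
  by (simp add: cmap_funpow cconj_cmap linear_funpow)

context
  fixes B :: "'v::real_vector \<Rightarrow> 'v \<Rightarrow> real"
  assumes B: "bilinear B"
begin

lemma cform_linear_right: "Vector_Spaces.linear cscale (*) (cform B v)"
  by (intro Vector_Spaces.linear_iff[THEN iffD2] conjI vector_space_cscale)
    (unfold_locales, simp_all add: complexification_defs bilinear_simps[OF B] complex_eq_iff algebra_simps)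

lemma cform_linear_left: "Vector_Spaces.linear cscale (*) (\<lambda>v. cform B v w)"
  by (intro Vector_Spaces.linear_iff[THEN iffD2] conjI vector_space_cscale)
    (unfold_locales, simp_all add: complexification_defs bilinear_simps[OF B] complex_eq_iff algebra_simps)

lemma cform_simps:
  "cform B (v + v') w = cform B v w + cform B v' w"
  "cform B v (w + w') = cform B v w + cform B v w'"
  "cform B (v - v') w = cform B v w - cform B v' w"
  "cform B v (w - w') = cform B v w - cform B v w'"
  "cform B (- v) w = - cform B v w"
  "cform B v (- w) = - cform B v w"
  "cform B (cscale c v) w = c * cform B v w"
  "cform B v (cscale c w) = c * cform B v w"
  "cform B 0 w = 0"
  "cform B v 0 = 0"
  by (simp_all add: complexification_defs bilinear_simps[OF B] complex_eq_iff algebra_simps)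

lemma cform_cconj: "cform B (cconj v) (cconj w) = cnj (cform B v w)"
  by (simp add: complexification_defs bilinear_simps[OF B] complex_eq_iff)

lemma cform_real [simp]: "cform B (x, 0) (y, 0) = of_real (B x y)"
  by (simp add: complexification_defs bilinear_simps[OF B] complex_eq_iff)

lemma cform_cmap_antisymmetric:
  assumes "linear f" "\<And>a b. B (f a) b = - B a (f b)"
  shows "cform B (cmap f v) w = - cform B v (cmap f w)"
  using assms by (simp add: complexification_defs complex_eq_iff)

end

lemma bilinear_I_s: "bilinear L \<Longrightarrow> bilinear (I_s L)"
  unfolding bilinear_def I_s_def[abs_def] by (auto intro: linear_compose_add)

lemma I_s_sym: "I_s L a b = I_s L b a"
  by (simp add: I_s_def)

lemma cform_I_s: "cform (I_s L) v w = cform L v w + cform L w v"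
  by (simp add: cform_def I_s_def complex_eq_iff)

lemma cform_I_s_sym: "cform (I_s L) v w = cform (I_s L) w v"
  by (simp add: cform_I_s)

lemma eig_space_cconj: "linear f \<Longrightarrow> v \<in> eig_space f c \<Longrightarrow> cconj v \<in> eig_space f (cnj c)"
  by (metis (mono_tags, lifting) cconj_cmap cconj_cscale eig_space_def mem_Collect_eq)

lemma subspace_eig_space: "linear f \<Longrightarrow> module.subspace cscale (eig_space f c)"
proof -
  assume "linear f"
  then interpret Vector_Spaces.linear cscale cscale "cmap f" by (rule complex_linear_cmap)
  show ?thesis
    by (auto simp: cv.subspace_def eig_space_def add scale cv.scale_right_distrib cv.scale_left_commute)
qed

lemma real_in_eig_space: "linear f \<Longrightarrow> (x, 0) \<in> eig_space f (of_real c) \<longleftrightarrow> f x = c *\<^sub>R x"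
  by (auto simp: eig_space_def complexification_defs linear_0)

lemma real_parts_in_eig_space:
  assumes "v \<in> eig_space f (of_real c)"
  shows "f (fst v) = c *\<^sub>R fst v" "f (snd v) = c *\<^sub>R snd v"
  using assms by (auto simp: eig_space_def complexification_defs prod_eq_iff)

lemma cmap_commute_eig_space:
  assumes "linear g" "\<And>x. g (f x) = f (g x)" "v \<in> eig_space f c"
  shows "cmap g v \<in> eig_space f c"
proof -
  have "f (fst v) = Re c *\<^sub>R fst v - Im c *\<^sub>R snd v" "f (snd v) = Re c *\<^sub>R snd v + Im c *\<^sub>R fst v"
    using assms(3) by (auto simp: eig_space_def cmap_def cscale_def prod_eq_iff)
  then show ?thesis
    using assms(1,2) by (simp add: eig_space_def cmap_def cscale_def linear_diff linear_add linear_scale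
        flip: assms(2))
qed

lemma cmap_funpow_eig_space:
  assumes "linear g" "\<And>x. g (f x) = f (g x)" "v \<in> eig_space f c"
  shows "(cmap g ^^ k) v \<in> eig_space f c"
proof (induction k)
  case (Suc k)
  then show ?case using cmap_commute_eig_space[of g f _ c, OF assms(1,2)] by simp
qed (use assms(3) in simp)

lemma cconj_image_span: "cconj ` cv.span X = cv.span (cconj ` X)"
proof -
  have sub: "cconj v \<in> cv.span (cconj ` X)" if "v \<in> cv.span X" for v :: "'a \<times> 'a" and X
    using that
  proof (induction rule: cv.span_induct_alt)
    case (step c x y)
    then show ?case
      by (auto simp: cconj_add cconj_cscale intro: cv.span_add cv.span_scale cv.span_base)
  qed (simp add: cv.span_zero)
  have "v \<in> cconj ` cv.span X" if "v \<in> cv.span (cconj ` X)" for v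
    using sub[OF that] by (simp add: image_image) (metis cconj_cconj image_eqI)
  then show ?thesis using sub by auto
qed

context finite_dim_real
begin

sublocale fcv: finite_dimensional_vector_space cscale "(\<lambda>e. (e, 0)) ` some_basis"
proof
  show "finite ((\<lambda>e. (e, 0 :: 'v)) ` some_basis)" using some_basis(1) by simp
  have emb: "Modules.additive (\<lambda>e::'v. (e, 0 :: 'v))" by unfold_locales simp
  have spanR: "(x, 0) \<in> cv.span ((\<lambda>e. (e, 0)) ` some_basis)" if "x \<in> span some_basis" for x :: 'v
    using that
  proof (induction rule: real_vector.span_induct_alt)
    case (step c x y)
    have "(c *\<^sub>R x + y, 0) = cscale (of_real c) (x, 0) + (y, 0)" by (simp add: cscale_def)
    then show ?case using step by (auto intro: cv.span_add cv.span_scale cv.span_base)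
  qed (simp add: cv.span_zero flip: zero_prod_def)
  have "v \<in> cv.span ((\<lambda>e. (e, 0)) ` some_basis)" for v :: "'v \<times> 'v"
  proof -
    have "v = (fst v, 0) + cscale \<i> (snd v, 0)" by (simp add: cscale_def prod_eq_iff)
    then show ?thesis using spanR some_basis(3) by (metis UNIV_I cv.span_add cv.span_scale)
  qed
  then show "cv.span ((\<lambda>e. (e, 0)) ` some_basis) = UNIV" by auto
  show "\<not> cv.dependent ((\<lambda>e. (e, 0 :: 'v)) ` some_basis)"
  proof (rule cv.independent_if_scalars_zero)
    fix f x assume sum: "(\<Sum>v\<in>(\<lambda>e. (e, 0 :: 'v)) ` some_basis. cscale (f v) v) = 0"
      and x: "x \<in> (\<lambda>e. (e, 0 :: 'v)) ` some_basis"
    have "(\<Sum>v\<in>(\<lambda>e. (e, 0 :: 'v)) ` some_basis. cscale (f v) v)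
        = (\<Sum>e\<in>some_basis. (Re (f (e, 0)) *\<^sub>R e, Im (f (e, 0)) *\<^sub>R e))"
      by (subst sum.reindex) (auto simp: inj_on_def cscale_def)
    also have "\<dots> = (\<Sum>e\<in>some_basis. Re (f (e, 0)) *\<^sub>R e, \<Sum>e\<in>some_basis. Im (f (e, 0)) *\<^sub>R e)"
      by (simp add: sum_prod)
    finally have "(\<Sum>e\<in>some_basis. Re (f (e, 0)) *\<^sub>R e) = 0" "(\<Sum>e\<in>some_basis. Im (f (e, 0)) *\<^sub>R e) = 0"
      using sum by (simp_all add: zero_prod_def)
    then have "\<forall>e\<in>some_basis. Re (f (e, 0)) = 0" "\<forall>e\<in>some_basis. Im (f (e, 0)) = 0"
      using some_basis(1,2) by (auto simp: real_vector.dependent_finite)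
    then show "f x = 0" using x by (auto simp: complex_eq_iff)
  qed (use some_basis(1) in simp)
qed

lemma card_complex_basis: "card ((\<lambda>e. (e, 0 :: 'v)) ` some_basis) = dim (UNIV :: 'v set)"
  by (simp add: card_image inj_on_def)

end

section \<open>Jordan chains with prescribed Gram matrices\<close>

text \<open>A functional that vanishes on all other vectors vanishes on their span and so keeps \<open>x i\<close> out of it.\<close>
lemma (in vector_space) independent_of_functionals:
  assumes lin: "\<And>i. i \<in> I \<Longrightarrow> Vector_Spaces.linear scale (*) (\<phi> i)"
    and ne: "\<And>i. i \<in> I \<Longrightarrow> \<phi> i (x i) \<noteq> 0"
    and zero: "\<And>i j. i \<in> I \<Longrightarrow> j \<in> I \<Longrightarrow> i \<noteq> j \<Longrightarrow> \<phi> i (x j) = 0"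
  shows "inj_on x I" and "independent (x ` I)"
proof -
  show "inj_on x I" using ne zero by (metis inj_onI)
  show "independent (x ` I)"
  proof
    assume "dependent (x ` I)"
    then obtain i where i: "i \<in> I" "x i \<in> span (x ` I - {x i})" by (auto simp: dependent_def)
    interpret p: Vector_Spaces.linear scale "(*)" "\<phi> i" by (rule lin[OF i(1)])
    have z: "\<phi> i y = 0" if "y \<in> x ` I - {x i}" for y
      using that zero[OF i(1)] by auto
    have "\<phi> i v = 0" if "v \<in> span (x ` I - {x i})" for v
      using that by (induction rule: span_induct_alt) (simp_all only: p.zero p.add p.scale z mult_zero_right add_0_left)
    then show False using i ne by blast
  qed
qed

text \<open>
  For uniqueness, the difference of two first components lies in the spans of two disjoint parts of
  a basis, so all its coordinates are zero.
\<close>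
lemma (in vector_space) direct_sum_of_basis_lists:
  assumes "distinct (concat ass)" "independent (set (concat ass))" "span (set (concat ass)) = UNIV"
  shows "direct_sum (map (\<lambda>as. span (set as)) ass)"
proof -
  have ex: "\<exists>ws. list_all2 (\<in>) ws (map (\<lambda>as. span (set as)) ass) \<and> sum_list ws = v"
    if "v \<in> span (set (concat ass))" for v ass
    using that
  proof (induction ass arbitrary: v)
    case (Cons as ass)
    obtain x y where xy: "v = x + y" "x \<in> span (set as)" "y \<in> span (set (concat ass))"
      using Cons.prems by (auto simp: span_Un)
    obtain ws where "list_all2 (\<in>) ws (map (\<lambda>as. span (set as)) ass)" "sum_list ws = y"
      using Cons.IH[OF xy(3)] by auto
    then show ?case using xy by (intro exI[of _ "x # ws"]) simp
  qed simp
  have mem: "sum_list ws \<in> span (set (concat ass))" if "list_all2 (\<in>) ws (map (\<lambda>as. span (set as)) ass)" for ws ass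
    using that
  proof (induction ass arbitrary: ws)
    case (Cons as ass)
    then obtain w ws' where ws: "ws = w # ws'" "w \<in> span (set as)" "list_all2 (\<in>) ws' (map (\<lambda>as. span (set as)) ass)"
      by (auto simp: list_all2_Cons2)
    then show ?case using Cons.IH[OF ws(3)] span_mono[of "set as" "set (concat (as # ass))"]
        span_mono[of "set (concat ass)" "set (concat (as # ass))"] by (auto intro!: span_add)
  qed (simp add: span_zero)
  have uniq: "ws = ws'"
    if "distinct (concat ass)" "independent (set (concat ass))"
      "list_all2 (\<in>) ws (map (\<lambda>as. span (set as)) ass)" "list_all2 (\<in>) ws' (map (\<lambda>as. span (set as)) ass)"
      "sum_list ws = sum_list ws'" for ws ws' ass
    using that
  proof (induction ass arbitrary: ws ws')
    case (Cons as ass)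
    obtain w us where ws: "ws = w # us" "w \<in> span (set as)" "list_all2 (\<in>) us (map (\<lambda>as. span (set as)) ass)"
      using Cons.prems(3) by (auto simp: list_all2_Cons2)
    obtain w' us' where ws': "ws' = w' # us'" "w' \<in> span (set as)" "list_all2 (\<in>) us' (map (\<lambda>as. span (set as)) ass)"
      using Cons.prems(4) by (auto simp: list_all2_Cons2)
    have ind: "independent (set as \<union> set (concat ass))" "set as \<inter> set (concat ass) = {}"
      using Cons.prems(1,2) by auto
    have "w - w' = sum_list us' - sum_list us"
      using Cons.prems(5) ws ws' by (simp add: algebra_simps)
    moreover have "sum_list us' - sum_list us \<in> span (set (concat ass))"
      using mem ws ws' by (simp add: span_diff)
    ultimately have d: "w - w' \<in> span (set as) \<inter> span (set (concat ass))"
      using span_diff[OF ws(2) ws'(2)] by simp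
    have "w - w' = 0"
    proof -
      have "representation (set as \<union> set (concat ass)) (w - w') b = 0" for b
      proof -
        have r1: "representation (set as \<union> set (concat ass)) (w - w') = representation (set as) (w - w')"
          using d representation_extend[OF ind(1), of "w - w'" "set as"] by auto
        have r2: "representation (set as \<union> set (concat ass)) (w - w') = representation (set (concat ass)) (w - w')"
          using d representation_extend[OF ind(1), of "w - w'" "set (concat ass)"] by auto
        show ?thesis
          using r1 r2 representation_ne_zero ind(2) by (metis disjoint_iff)
      qed
      then show ?thesis
        using sum_nonzero_representation_eq[OF ind(1), of "w - w'"] d span_mono[of "set as" "set as \<union> set (concat ass)"]
        by auto
    qed
    then have "w = w'" by simp
    moreover have "us = us'"
      using Cons.IH[of us us'] Cons.prems(1,5) ws ws' \<open>w = w'\<close> ind(1)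
        dependent_mono[of "set (concat ass)" "set as \<union> set (concat ass)"] by auto
    ultimately show ?case using ws ws' by simp
  qed simp
  show ?thesis
    unfolding direct_sum_def using ex uniq[OF assms(1,2)] assms(3) by (metis UNIV_I)
qed

text \<open>
  The products \<open>g b j\<close> are made zero for \<open>j = n - 2, n - 3, ...\<close> in turn; the correction for one index
  must not change the products with higher index. The dual, the hermitian and the isotropic
  normalization below differ only in the correction.
\<close>
lemma kill_lower_coefficients:
  fixes g :: "'b \<Rightarrow> nat \<Rightarrow> 'k::zero"
  assumes step: "\<And>b k. P b \<Longrightarrow> 1 \<le> k \<Longrightarrow> k < n \<Longrightarrow>
      \<exists>b'. P b' \<and> g b' (n - 1 - k) = 0 \<and> (\<forall>j. n - 1 - k < j \<longrightarrow> j < n \<longrightarrow> g b' j = g b j)"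
    and b: "P b"
  shows "\<exists>b'. P b' \<and> g b' (n - 1) = g b (n - 1) \<and> (\<forall>j<n - 1. g b' j = 0)"
proof (cases "n = 0")
  case False
  have "\<exists>b'. P b' \<and> g b' (n - 1) = g b (n - 1) \<and> (\<forall>j<n - 1. n - 1 - k \<le> j \<longrightarrow> g b' j = 0)" if "k < n" for k
    using that
  proof (induction k)
    case 0
    then show ?case using b by (intro exI[of _ b]) auto
  next
    case (Suc k)
    then obtain b' where b': "P b'" "g b' (n - 1) = g b (n - 1)" "\<forall>j<n - 1. n - 1 - k \<le> j \<longrightarrow> g b' j = 0"
      by auto
    obtain c where c: "P c" "g c (n - 1 - Suc k) = 0"
      "\<forall>j. n - 1 - Suc k < j \<longrightarrow> j < n \<longrightarrow> g c j = g b' j"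
      using step[OF b'(1), of "Suc k"] Suc.prems by auto
    show ?case
    proof (intro exI[of _ c] conjI allI impI)
      show "g c (n - 1) = g b (n - 1)" using b'(2) c(3) Suc.prems by simp
      fix j assume j: "j < n - 1" "n - 1 - Suc k \<le> j"
      show "g c j = 0"
      proof (cases "j = n - 1 - Suc k")
        case False
        then have "g c j = g b' j" using j c(3) by auto
        then show ?thesis using b'(3) j False by auto
      qed (use c in simp)
    qed (use c in simp)
  qed
  from this[of "n - 1"] show ?thesis using False by auto
qed (use b in auto)

definition chain :: "('b \<Rightarrow> 'b) \<Rightarrow> nat \<Rightarrow> 'b \<Rightarrow> 'b list" where
  "chain N n a = map (\<lambda>k. (N ^^ k) a) [0..<n]"

lemma length_chain [simp]: "length (chain N n a) = n"
  and nth_chain: "k < n \<Longrightarrow> chain N n a ! k = (N ^^ k) a"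
  by (simp_all add: chain_def)

lemma set_chain: "set (chain N n a) = (\<lambda>k. (N ^^ k) a) ` {..<n}"
  by (auto simp: chain_def)

lemma map_chain: "(\<And>k. h ((N ^^ k) a) = (N' ^^ k) (h a)) \<Longrightarrow> map h (chain N n a) = chain N' n (h a)"
  by (simp add: chain_def)

lemma (in vector_space) acts_by_chain:
  assumes "(N ^^ n) a = 0"
  shows "acts_by scale N (chain N n a) (J_mat n)"
  unfolding acts_by_def
proof (intro conjI allI impI)
  show "J_mat n \<in> carrier_mat (length (chain N n a)) (length (chain N n a))"
    by (simp add: J_mat_def)
  fix k assume k: "k < length (chain N n a)"
  have "(\<Sum>j<n. scale (J_mat n $$ (j, k)) (chain N n a ! j)) = (\<Sum>j<n. if j = k + 1 then (N ^^ (k + 1)) a else 0)"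
    using k by (intro sum.cong) (auto simp: J_mat_def nth_chain)
  also have "\<dots> = (N ^^ (k + 1)) a"
    using k assms by (auto simp: not_less less_Suc_eq_le le_Suc_eq)
  finally show "N (chain N n a ! k) = (\<Sum>j<length (chain N n a). scale (J_mat n $$ (j, k)) (chain N n a ! j))"
    using k by (simp add: nth_chain)
qed

text \<open>The real form \<open>S\<close> and its complex bilinear extension are both instances, with \<open>N = log Mu\<close>.\<close>
locale nilpotent_form_space = finite_dimensional_vector_space scale Basis
  for scale :: "'k::field \<Rightarrow> 'b::ab_group_add \<Rightarrow> 'b" and Basis +
  fixes N :: "'b \<Rightarrow> 'b" and F :: "'b \<Rightarrow> 'b \<Rightarrow> 'k" and n :: nat
  assumes linear_N: "Vector_Spaces.linear scale scale N"
    and F_left: "\<And>y. Vector_Spaces.linear scale (*) (\<lambda>x. F x y)"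
    and F_right: "\<And>x. Vector_Spaces.linear scale (*) (F x)"
    and F_N: "\<And>x y. F (N x) y = - F x (N y)"
    and nilpotent: "\<And>x. (N ^^ n) x = 0"
    and n_pos: "n \<ge> 1"
begin

interpretation N: Vector_Spaces.linear scale scale N by (rule linear_N)
interpretation F1: Vector_Spaces.linear scale "(*)" "\<lambda>x. F x y" for y by (rule F_left)
interpretation F2: Vector_Spaces.linear scale "(*)" "F x" for x by (rule F_right)

lemmas F_simps = F1.add F2.add F1.scale F2.scale F1.zero F2.zero F1.diff F2.diff F1.neg F2.neg

lemma N_funpow_add: "(N ^^ k) (x + y) = (N ^^ k) x + (N ^^ k) y"
  and N_funpow_scale: "(N ^^ k) (scale c x) = scale c ((N ^^ k) x)"
  by (induction k) (simp_all add: N.add N.scale)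

lemma N_funpow_ge: "n \<le> k \<Longrightarrow> (N ^^ k) x = 0"
proof -
  assume "n \<le> k"
  then have "(N ^^ k) x = (N ^^ n) ((N ^^ (k - n)) x)"
    by (simp flip: funpow_add[THEN fun_cong, unfolded o_def])
  then show ?thesis by (simp add: nilpotent)
qed

lemma not_range_of_last_nonzero:
  assumes "(N ^^ (n - 1)) x \<noteq> 0" shows "x \<notin> range N"
proof
  assume "x \<in> range N"
  then obtain y where "x = N y" by blast
  then have "(N ^^ (n - 1)) x = (N ^^ Suc (n - 1)) y" by (simp add: funpow_swap1)
  then show False using assms n_pos by (simp add: nilpotent)
qed

lemma F_N_funpow: "F ((N ^^ j) x) y = (-1) ^ j * F x ((N ^^ j) y)"
proof (induction j arbitrary: y)
  case (Suc j)
  have "F ((N ^^ Suc j) x) y = - F ((N ^^ j) x) (N y)" by (simp add: F_N)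
  then show ?case by (simp add: Suc funpow_swap1)
qed simp

lemma F_N_funpow2: "F ((N ^^ j) x) ((N ^^ k) y) = (-1) ^ j * F x ((N ^^ (j + k)) y)"
  by (simp add: F_N_funpow funpow_add)

text \<open>
  Antisymmetry of \<open>N\<close> reduces all products of the two chains to those of \<open>a\<close> with the second chain; moving \<open>N^j\<close>
  across produces the signs of \<open>E_per\<close>.
\<close>
lemma gram_chain:
  assumes "\<And>k. k < n \<Longrightarrow> F a ((N ^^ k) b) = (if k = n - 1 then c else 0)"
  shows "gram F (chain N n a) (chain N n b) = c \<cdot>\<^sub>m E_per n"
proof (rule eq_matI)
  fix j k assume "j < dim_row (c \<cdot>\<^sub>m E_per n)" "k < dim_col (c \<cdot>\<^sub>m E_per n)"
  then have jk: "j < n" "k < n" by (simp_all add: E_per_def)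
  have "F a ((N ^^ (j + k)) b) = (if j + k + 1 = n then c else 0)"
  proof (cases "j + k < n")
    case True
    then show ?thesis using assms[OF True] by auto
  next
    case False
    then show ?thesis using N_funpow_ge[of "j + k" b] by (simp add: F2.zero)
  qed
  then show "gram F (chain N n a) (chain N n b) $$ (j, k) = (c \<cdot>\<^sub>m E_per n) $$ (j, k)"
    using jk by (simp add: gram_def E_per_def nth_chain F_N_funpow2)
qed (simp_all add: gram_def E_per_def)

lemma gram_chain_0:
  assumes "\<And>k. k < n \<Longrightarrow> F a ((N ^^ k) b) = 0"
  shows "gram F (chain N n a) (chain N n b) = 0\<^sub>m n n"
proof -
  have "gram F (chain N n a) (chain N n b) = 0 \<cdot>\<^sub>m E_per n"
    by (rule gram_chain) (use assms in simp)
  also have "\<dots> = 0\<^sub>m n n" by (rule eq_matI) (simp_all add: E_per_def)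
  finally show ?thesis .
qed

text \<open>
  The generator \<open>gs ! i\<close> has a single nonzero product with the chains, namely with the last vector of
  the chain of its partner \<open>gs ! \<pi> i\<close>. So the Gram matrix of all chains is monomial.
\<close>
context
  fixes gs \<pi> c
  assumes paired: "\<And>i i' k. i < length gs \<Longrightarrow> i' < length gs \<Longrightarrow> k < n \<Longrightarrow>
      F (gs ! i) ((N ^^ k) (gs ! i')) = (if i' = \<pi> i \<and> k = n - 1 then c i else 0)"
    and c: "\<And>i. i < length gs \<Longrightarrow> c i \<noteq> 0"
    and \<pi>: "\<And>i. i < length gs \<Longrightarrow> \<pi> i < length gs" "inj_on \<pi> {..<length gs}"
begin

text \<open>The functional for \<open>N^k (gs ! i)\<close> is the pairing with \<open>N^(n-1-k)\<close> of the partner generator.\<close>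
lemma paired_chains_independent:
  shows "distinct (concat (map (chain N n) gs))"
    and "independent (set (concat (map (chain N n) gs)))"
proof -
  let ?I = "{..<length gs} \<times> {..<n}"
  define x where "x = (\<lambda>(i, k). (N ^^ k) (gs ! i))"
  define \<phi> where "\<phi> = (\<lambda>(i, k) v. F v ((N ^^ (n - 1 - k)) (gs ! \<pi> i)))"
  have F_eq: "\<phi> (i, k) (x (i', k')) = (if i' = i \<and> k' = k then (-1) ^ k * c i else 0)"
    if "i < length gs" "i' < length gs" "k < n" "k' < n" for i i' k k'
  proof -
    have "\<phi> (i, k) (x (i', k')) = (-1) ^ k' * F (gs ! i') ((N ^^ (k' + (n - 1 - k))) (gs ! \<pi> i))"
      by (simp add: \<phi>_def x_def F_N_funpow2)
    moreover have "F (gs ! i') ((N ^^ (k' + (n - 1 - k))) (gs ! \<pi> i)) = (if i' = i \<and> k' = k then c i else 0)"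
    proof (cases "k' + (n - 1 - k) < n")
      case True
      have "\<pi> i = \<pi> i' \<longleftrightarrow> i = i'" using \<pi> that by (metis inj_on_def lessThan_iff)
      then show ?thesis using True that paired[OF that(2) \<pi>(1)[OF that(1)] True] by auto
    next
      case False
      then show ?thesis using that by (auto simp: N_funpow_ge F2.zero)
    qed
    ultimately show ?thesis by simp
  qed
  have ind: "inj_on x ?I" "independent (x ` ?I)"
  proof -
    have "Vector_Spaces.linear scale (*) (\<phi> p)" for p
      by (cases p) (simp add: \<phi>_def F_left)
    moreover have "\<phi> p (x p) \<noteq> 0" if "p \<in> ?I" for p
      using that F_eq c by (cases p) auto
    moreover have "\<phi> p (x q) = 0" if "p \<in> ?I" "q \<in> ?I" "p \<noteq> q" for p q
      using that F_eq by (cases p; cases q) auto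
    ultimately show "inj_on x ?I" "independent (x ` ?I)"
      using independent_of_functionals[of ?I \<phi> x] by blast+
  qed
  have concat: "concat (map (chain N n) gs) = map x (List.product [0..<length gs] [0..<n])"
  proof -
    have "map (chain N n) gs = map (\<lambda>i. chain N n (gs ! i)) [0..<length gs]"
      by (rule nth_equalityI) simp_all
    then have "concat (map (chain N n) gs) = concat (map (\<lambda>i. chain N n (gs ! i)) [0..<length gs])"
      by simp
    also have "\<dots> = map x (List.product [0..<length gs] [0..<n])"
      by (simp add: product_concat_map map_concat chain_def x_def o_def)
    finally show ?thesis .
  qed
  have set: "set (List.product [0..<length gs] [0..<n]) = ?I" by auto
  show "distinct (concat (map (chain N n) gs))"
    unfolding concat using ind(1) set by (simp add: distinct_map distinct_product)
  have setc: "set (concat (map (chain N n) gs)) = x ` ?I"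
    unfolding concat using set by (metis set_map)
  then show "independent (set (concat (map (chain N n) gs)))" using ind by simp
qed

lemma card_paired_chains: "card (set (concat (map (chain N n) gs))) = length gs * n"
proof -
  have "length (concat (map (chain N n) gs)) = length gs * n"
    by (induction gs) simp_all
  then show ?thesis using distinct_card[OF paired_chains_independent(1)] by simp
qed

lemma paired_chains_le: "length gs * n \<le> card Basis"
  using independent_card_le_dim[of _ UNIV, OF _ paired_chains_independent(2)] card_paired_chains
  by simp

lemma paired_chains_basis:
  assumes dim: "card Basis = length gs * n"
  shows "direct_sum (map (\<lambda>g. span (set (chain N n g))) gs)"
    and "g \<in> set gs \<Longrightarrow> is_basis_of scale (chain N n g) (span (set (chain N n g)))"
    and "span (set (concat (map (chain N n) gs))) = UNIV"
proof -
  note dist = paired_chains_independent(1) and ind = paired_chains_independent(2)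
  show span: "span (set (concat (map (chain N n) gs))) = UNIV"
    using ind card_ge_dim_independent[OF _ ind, of UNIV] dim card_paired_chains by auto
  show "direct_sum (map (\<lambda>g. span (set (chain N n g))) gs)"
    using direct_sum_of_basis_lists[OF dist ind span] by (simp add: o_def)
  show "is_basis_of scale (chain N n g) (span (set (chain N n g)))" if g: "g \<in> set gs"
  proof -
    have "distinct (chain N n g)" using dist g by (auto simp: distinct_concat_iff)
    moreover have "set (chain N n g) \<subseteq> set (concat (map (chain N n) gs))" using g by auto
    then have "independent (set (chain N n g))" using ind dependent_mono by blast
    ultimately show ?thesis by (simp add: is_basis_of_def)
  qed
qed

end

lemma span_chain_subset:
  assumes "subspace H" "\<And>x. x \<in> H \<Longrightarrow> N x \<in> H" "a \<in> H"
  shows "span (set (chain N n a)) \<subseteq> H"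
proof (rule span_minimal)
  have "(N ^^ k) a \<in> H" for k by (induction k) (use assms in auto)
  then show "set (chain N n a) \<subseteq> H" by (auto simp: set_chain)
qed (rule assms(1))

text \<open>
  With the top product scaled to \<open>1\<close>, subtracting the multiple \<open>F a (N^(n-1-k) b)\<close> of \<open>N^k b\<close> removes
  that product.
\<close>
lemma exists_dual_generator:
  assumes H: "subspace H" "\<And>x. x \<in> H \<Longrightarrow> N x \<in> H" and b: "b \<in> H"
    and ne: "F a ((N ^^ (n - 1)) b) \<noteq> 0"
  shows "\<exists>b'\<in>H. \<forall>j<n. F a ((N ^^ j) b') = (if j = n - 1 then 1 else 0)"
proof -
  have HN: "(N ^^ k) x \<in> H" if "x \<in> H" for k x by (induction k) (use H that in auto)
  let ?P = "\<lambda>b. b \<in> H \<and> F a ((N ^^ (n - 1)) b) = 1"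
  have "\<exists>b'. ?P b' \<and> F a ((N ^^ (n - 1 - k)) b') = 0
      \<and> (\<forall>j. n - 1 - k < j \<longrightarrow> j < n \<longrightarrow> F a ((N ^^ j) b') = F a ((N ^^ j) b))"
    if P: "?P b" and k: "1 \<le> k" "k < n" for b k
  proof -
    define c where "c = - F a ((N ^^ (n - 1 - k)) b)"
    let ?b = "b + scale c ((N ^^ k) b)"
    have *: "F a ((N ^^ j) ?b) = F a ((N ^^ j) b) + c * F a ((N ^^ (j + k)) b)" for j
      by (simp add: N_funpow_add N_funpow_scale F_simps flip: funpow_add[THEN fun_cong, unfolded o_def])
    have "?b \<in> H" using P HN H(1) by (simp add: subspace_add subspace_scale)
    moreover have hi: "F a ((N ^^ j) ?b) = F a ((N ^^ j) b)" if "n - 1 - k < j" for j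
      using that k unfolding * by (simp add: N_funpow_ge F2.zero)
    moreover have "F a ((N ^^ (n - 1 - k)) ?b) = 0"
      unfolding * using P k by (simp add: c_def)
    ultimately show ?thesis using hi[of "n - 1"] P k by (intro exI[of _ ?b]) auto
  qed
  moreover have "?P (scale (inverse (F a ((N ^^ (n - 1)) b))) b)"
    using b H(1) ne by (simp add: subspace_scale N_funpow_scale F2.scale)
  ultimately obtain b' where "?P b'" "\<forall>j<n - 1. F a ((N ^^ j) b') = 0"
    using kill_lower_coefficients[of ?P n "\<lambda>b j. F a ((N ^^ j) b)"] by blast
  then show ?thesis using n_pos by (intro bexI[of _ b']) auto
qed

text \<open>The effect on the products of the corrections \<open>x \<mapsto> x + c N^k y\<close>.\<close>
lemma F_shift_shift:
  "F (x + scale c ((N ^^ k) y)) ((N ^^ j) (x' + scale c' ((N ^^ k) y')))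
    = F x ((N ^^ j) x') + c' * F x ((N ^^ (j + k)) y')
      + (-1) ^ k * c * (F y ((N ^^ (j + k)) x') + c' * F y ((N ^^ (j + k + k)) y'))"
proof -
  have *: "(N ^^ j) (x' + scale c' ((N ^^ k) y')) = (N ^^ j) x' + scale c' ((N ^^ (j + k)) y')"
    unfolding N_funpow_add N_funpow_scale funpow_add o_def ..
  have "F ((N ^^ k) y) ((N ^^ (j + k)) y') = (-1) ^ k * F y ((N ^^ (j + k + k)) y')"
    "F ((N ^^ k) y) ((N ^^ j) x') = (-1) ^ k * F y ((N ^^ (j + k)) x')"
    unfolding F_N_funpow2 by (simp_all only: add.commute[of k])
  then show ?thesis
    unfolding * F1.add F2.add F1.scale F2.scale by (simp only: distrib_left mult_ac add_ac)
qed

text \<open>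
  For \<open>\<sigma> = id\<close> and \<open>\<tau> = id\<close> this normalizes a symmetric form, for complex conjugations a hermitian
  one. The correction \<open>a + c N^k a\<close> acts through both arguments of \<open>F a (N^j (\<sigma> a))\<close>, which adds
  \<open>(-1)^k c + \<tau> c\<close> times \<open>u\<close>; the symmetry \<open>\<tau> (g a j) = (-1)^j g a j\<close> makes the two contributions equal
  for a suitable \<open>c\<close>, so that every required value is attained.
\<close>
lemma exists_hermitian_generator:
  fixes \<sigma> :: "'b \<Rightarrow> 'b" and \<tau> :: "'k \<Rightarrow> 'k"
  assumes \<sigma>: "\<And>x y. \<sigma> (x + y) = \<sigma> x + \<sigma> y" "\<And>r x. \<sigma> (scale r x) = scale (\<tau> r) (\<sigma> x)"
      "\<And>x. \<sigma> (\<sigma> x) = x" "\<And>x. \<sigma> (N x) = N (\<sigma> x)"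
    and \<tau>: "\<And>x y. \<tau> (x + y) = \<tau> x + \<tau> y" "\<And>x y. \<tau> (x * y) = \<tau> x * \<tau> y" "\<tau> 1 = 1"
    and F_\<sigma>: "\<And>x y. F (\<sigma> x) (\<sigma> y) = \<tau> (F x y)" and sym: "\<And>x y. F x y = F y x"
    and two: "(2 :: 'k) \<noteq> 0"
    and H: "subspace H" "\<And>x. x \<in> H \<Longrightarrow> N x \<in> H" and a: "a \<in> H"
    and u: "F a ((N ^^ (n - 1)) (\<sigma> a)) = u" "u \<noteq> 0" 
  shows "\<exists>a'\<in>H. \<forall>j<n. F a' ((N ^^ j) (\<sigma> a')) = (if j = n - 1 then u else 0)"
proof -
  have HN: "(N ^^ k) x \<in> H" if "x \<in> H" for k x by (induction k) (use H that in auto)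
  have \<sigma>N: "\<sigma> ((N ^^ k) x) = (N ^^ k) (\<sigma> x)" for k x by (induction k) (simp_all add: \<sigma>)
  define g where "g a j = F a ((N ^^ j) (\<sigma> a))" for a j
  have "\<tau> 0 + \<tau> 0 = \<tau> 0 + 0" using \<tau>(1)[of 0 0] by (simp only: add_0_right)
  then have \<tau>0: "\<tau> 0 = 0" by (simp only: add_left_cancel)
  have \<tau>_neg: "\<tau> (- x) = - \<tau> x" for x
    using \<tau>(1)[of x "- x"] \<tau>0 by (simp add: eq_neg_iff_add_eq_0 add.commute)
  have half: "x / 2 + x / 2 = x" for x :: 'k
    using two by (metis mult_2 nonzero_mult_div_cancel_left times_divide_eq_right)
  have \<tau>_half: "\<tau> (x / 2) = \<tau> x / 2" for x
  proof -
    have "\<tau> x = \<tau> (x / 2) + \<tau> (x / 2)" unfolding \<tau>(1)[symmetric] half ..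
    then show ?thesis using two by (metis mult_2 nonzero_mult_div_cancel_left)
  qed
  have \<tau>_pow: "\<tau> ((-1) ^ j) = (-1) ^ j" for j
    by (induction j) (simp_all add: \<tau> \<tau>_neg)
  have sq: "(-1 :: 'k) ^ j * ((-1) ^ j * x) = x" for j x
    by (simp flip: mult.assoc power_add)
  have \<tau>g: "\<tau> (g a j) = (-1) ^ j * g a j" for a j
  proof -
    have "\<tau> (g a j) = F (\<sigma> a) ((N ^^ j) a)"
      unfolding g_def by (simp add: \<sigma>(3) \<sigma>N flip: F_\<sigma>)
    also have "\<dots> = (-1) ^ j * g a j"
      using sym[of "\<sigma> a" "(N ^^ j) a"] by (simp add: g_def F_N_funpow)
    finally show ?thesis .
  qed
  let ?P = "\<lambda>a. a \<in> H \<and> g a (n - 1) = u"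
  have step: "\<exists>b'. ?P b' \<and> g b' (n - 1 - k) = 0 \<and> (\<forall>j. n - 1 - k < j \<longrightarrow> j < n \<longrightarrow> g b' j = g b j)"
    if P: "?P b" and k: "1 \<le> k" "k < n" for b k
  proof -
    (* d is the required total correction; each argument contributes d / 2 *)
    define d where "d = - g b (n - 1 - k) / u"
    define c where "c = (-1) ^ k * (d / 2)"
    let ?b = "b + scale c ((N ^^ k) b)"
    have du: "d * u = - g b (n - 1 - k)" using u(2) by (simp add: d_def)
    have pow: "(-1 :: 'k) ^ (n - 1) = (-1) ^ (n - 1 - k) * (-1) ^ k"
      using k by (simp flip: power_add)
    have "\<tau> d * \<tau> u = \<tau> (- g b (n - 1 - k))" unfolding \<tau>(2)[symmetric] du ..
    also have "\<tau> u = (-1) ^ (n - 1) * u" using \<tau>g[of b "n - 1"] P by simp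
    also have "\<tau> (- g b (n - 1 - k)) = (-1) ^ (n - 1 - k) * (d * u)"
      unfolding \<tau>_neg \<tau>g du by simp
    finally have "((-1) ^ (n - 1 - k) * u) * ((-1) ^ k * \<tau> d) = ((-1) ^ (n - 1 - k) * u) * d"
      unfolding pow by (simp only: mult_ac)
    then have "(-1) ^ k * \<tau> d = d" using u(2) by (simp only: mult_cancel_left) auto
    then have "\<tau> c = d / 2"
      by (simp add: c_def \<tau>(2) \<tau>_pow \<tau>_half)
    have \<sigma>b: "\<sigma> ?b = \<sigma> b + scale (d / 2) ((N ^^ k) (\<sigma> b))"
      by (simp add: \<sigma>(1,2) \<sigma>N \<open>\<tau> c = d / 2\<close>)
    have *: "g ?b j = g b j + (d / 2) * g b (j + k) + (d / 2) * (g b (j + k) + (d / 2) * g b (j + k + k))" for j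
      unfolding g_def \<sigma>b F_shift_shift by (simp only: c_def sq)
    have g_ge: "g b j = 0" if "j \<ge> n" for j b
      using that by (simp add: g_def N_funpow_ge F2.zero)
    have hi: "g ?b j = g b j" if "n - 1 - k < j" for j
      using that k unfolding * by (simp add: g_ge)
    have "g ?b (n - 1 - k) = g b (n - 1 - k) + (d / 2 + d / 2) * u"
      unfolding * using k P by (simp add: g_ge distrib_right)
    also have "d / 2 + d / 2 = d" by (rule half)
    finally have "g ?b (n - 1 - k) = 0" by (simp add: du)
    moreover have "?b \<in> H" using P HN H(1) by (simp add: subspace_add subspace_scale)
    ultimately show ?thesis using hi[of "n - 1"] hi P k by (intro exI[of _ ?b]) auto
  qed
  obtain a' where "?P a'" "\<forall>j<n - 1. g a' j = 0"
    using kill_lower_coefficients[of ?P n g, OF step, of a] a u(1) by (auto simp: g_def)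
  then show ?thesis using n_pos by (intro bexI[of _ a']) (auto simp: g_def)
qed

text \<open>
  For odd \<open>j\<close> the product \<open>F x (N^j x)\<close> vanishes by symmetry. For even \<open>j = n - 1 - k\<close> the exponent \<open>k\<close>
  is odd, and adding \<open>c N^k y\<close> changes the product by \<open>2 c u\<close>. The predicate \<open>P\<close> carries properties that
  survive these corrections.
\<close>
lemma exists_isotropic_generator:
  assumes sym: "\<And>x y. F x y = F y x" and two: "(2 :: 'k) \<noteq> 0" and n: "even n"
    and x: "P x" and P: "\<And>x c k. P x \<Longrightarrow> 1 \<le> k \<Longrightarrow> P (x + scale c ((N ^^ k) y))"
    and Pu: "\<And>x. P x \<Longrightarrow> F x ((N ^^ (n - 1)) y) = u" "u \<noteq> 0"
  shows "\<exists>x. P x \<and> (\<forall>j<n. F x ((N ^^ j) x) = 0)"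
proof -
  define g where "g x j = F x ((N ^^ j) x)" for x j
  have g_odd: "g x j = 0" if "odd j" for x j
  proof -
    have "g x j = - g x j"
      using sym[of x "(N ^^ j) x"] that by (simp add: g_def F_N_funpow)
    then have "2 * g x j = 0" by (metis add.right_inverse mult_2)
    then show ?thesis using two by simp
  qed
  have step: "\<exists>b'. P b' \<and> g b' (n - 1 - k) = 0 \<and> (\<forall>j. n - 1 - k < j \<longrightarrow> j < n \<longrightarrow> g b' j = g b j)"
    if b: "P b" and k: "1 \<le> k" "k < n" for b k
  proof (cases "even k")
    case True
    then have "odd (n - 1 - k)" using n k by simp
    then show ?thesis using b g_odd by blast
  next
    case False
    define c where "c = - g b (n - 1 - k) / (2 * u)"
    let ?b = "b + scale c ((N ^^ k) y)"
    have *: "g ?b j = g b j + c * F b ((N ^^ (j + k)) y)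
        - c * (F y ((N ^^ (j + k)) b) + c * F y ((N ^^ (j + k + k)) y))" for j
      unfolding g_def F_shift_shift using False by simp
    have hi: "g ?b j = g b j" if "n - 1 - k < j" for j
      using that k unfolding * by (simp add: N_funpow_ge F2.zero)
    have "F y ((N ^^ (n - 1)) b) = - u"
      using sym[of y "(N ^^ (n - 1)) b"] Pu(1)[OF b] n n_pos by (simp add: F_N_funpow)
    then have "g ?b (n - 1 - k) = g b (n - 1 - k) + c * u + c * u"
      unfolding * using k Pu(1)[OF b] by (simp add: N_funpow_ge F2.zero)
    also have "\<dots> = g b (n - 1 - k) + c * (2 * u)" by (simp only: mult_2 distrib_left add.assoc)
    also have "c * (2 * u) = - g b (n - 1 - k)" using Pu(2) two by (simp add: c_def)
    finally have "g ?b (n - 1 - k) = 0" by simp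
    then show ?thesis using P[OF b k(1), of c] hi by blast
  qed
  obtain x' where "P x'" "g x' (n - 1) = g x (n - 1)" "\<forall>j<n - 1. g x' j = 0"
    using kill_lower_coefficients[of P n g, OF step, of x] x by auto
  moreover have "g x (n - 1) = 0" using g_odd n n_pos by simp
  moreover have "j < n - 1 \<or> j = n - 1" if "j < n" for j using that by auto
  ultimately show ?thesis unfolding g_def by metis
qed

end

section \<open>Jordan blocks\<close>

lemma list_all2_ex_right: "list_all2 P xs ys \<Longrightarrow> x \<in> set xs \<Longrightarrow> \<exists>y\<in>set ys. P x y"
  by (induction rule: list_all2_induct) auto

lemma list_all2_ex_left: "list_all2 P xs ys \<Longrightarrow> y \<in> set ys \<Longrightarrow> \<exists>x\<in>set xs. P x y"
  by (induction rule: list_all2_induct) auto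

text \<open>A Jordan chain in the order of \<open>jordan_matrix\<close>, with the eigenvector first.\<close>
definition jordan_string :: "('k \<Rightarrow> 'b::ab_group_add \<Rightarrow> 'b) \<Rightarrow> ('b \<Rightarrow> 'b) \<Rightarrow> 'k \<Rightarrow> 'b list \<Rightarrow> bool" where
  "jordan_string s f \<mu> xs \<longleftrightarrow>
     (\<forall>j<length xs. f (xs ! j) = s \<mu> (xs ! j) + (if j = 0 then 0 else xs ! (j - 1)))"

text \<open>The columns of a block-diagonal matrix involve only the basis vectors of their own block.\<close>
lemma (in vector_space) acts_by_jordan_matrix:
  assumes "acts_by scale f es (jordan_matrix bs)"
  obtains ess where "es = concat ess"
    "list_all2 (\<lambda>xs b. length xs = fst b \<and> jordan_string scale f (snd b) xs) ess bs"
proof -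
  have "\<exists>ess. es = concat ess \<and>
      list_all2 (\<lambda>xs b. length xs = fst b \<and> jordan_string scale f (snd b) xs) ess bs"
    using assms
  proof (induction bs arbitrary: es)
    case Nil
    then have "(jordan_matrix [] :: 'a mat) \<in> carrier_mat (length es) (length es)"
      by (simp only: acts_by_def)
    from carrier_matD(1)[OF this] have "length es = 0" by (simp only: jordan_matrix_dim(1) list.map sum_list.Nil)
    then show ?case by (intro exI[of _ "[]"]) simp
  next
    case (Cons b bs)
    obtain k \<mu> where b: "b = (k, \<mu>)" by force
    define m where "m = sum_list (map fst bs)"
    define J where "J = jordan_matrix bs"
    have J: "J \<in> carrier_mat m m" by (simp add: J_def m_def)
    have JM: "jordan_matrix (b # bs) = four_block_mat (jordan_block k \<mu>) (0\<^sub>m k m) (0\<^sub>m m k) J"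
      using J by (simp add: jordan_matrix_def[of "(k, \<mu>) # bs"] b Let_def
          jordan_matrix_def[of bs, folded J_def, symmetric])
    have len: "length es = k + m"
      using Cons.prems by (simp add: acts_by_def b m_def)
        (metis carrier_matD(1) jordan_matrix_dim(1) list.simps(9) sum_list.Cons fst_conv)
    have act: "f (es ! j) = (\<Sum>i<k + m. scale (jordan_matrix (b # bs) $$ (i, j)) (es ! i))" if "j < k + m" for j
      using Cons.prems that len by (simp add: acts_by_def)
    have split: "(\<Sum>i<k + m. g i) = (\<Sum>i<k. g i) + (\<Sum>i<m. g (k + i))" for g :: "nat \<Rightarrow> 'b"
      by (induction m) (simp_all add: add.assoc)
    have first: "jordan_string scale f \<mu> (take k es)"
      unfolding jordan_string_def
    proof (intro allI impI)
      fix j assume "j < length (take k es)"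
      then have j: "j < k" by simp
      have "f (es ! j) = (\<Sum>i<k. scale (jordan_block k \<mu> $$ (i, j)) (es ! i))"
        using j J by (simp add: act split JM)
      also have "\<dots> = (\<Sum>i<k. (if i = j then scale \<mu> (es ! j) else 0) + (if Suc i = j then es ! (j - 1) else 0))"
        using j by (intro sum.cong) auto
      also have "\<dots> = scale \<mu> (es ! j) + (if j = 0 then 0 else es ! (j - 1))"
      proof (cases j)
        case (Suc j')
        then show ?thesis using j by (simp add: sum.distrib)
      qed (use j in \<open>simp add: sum.distrib\<close>)
      finally show "f (take k es ! j) = scale \<mu> (take k es ! j) + (if j = 0 then 0 else take k es ! (j - 1))"
        using j by simp
    qed
    have "acts_by scale f (drop k es) J"
      unfolding acts_by_def
    proof (intro conjI allI impI)
      show "J \<in> carrier_mat (length (drop k es)) (length (drop k es))" using J len by simp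
      fix j assume "j < length (drop k es)"
      then have j: "j < m" using len by simp
      show "f (drop k es ! j) = (\<Sum>i<length (drop k es). scale (J $$ (i, j)) (drop k es ! i))"
        using j J len by (simp add: act split JM)
    qed
    then obtain ess where ess: "drop k es = concat ess"
      "list_all2 (\<lambda>xs b. length xs = fst b \<and> jordan_string scale f (snd b) xs) ess bs"
      using Cons.IH J_def by blast
    moreover have "es = concat (take k es # ess)"
      using append_take_drop_id[of k es] by (simp add: ess)
    ultimately show ?case
      using first len by (intro exI[of _ "take k es # ess"]) (simp add: b)
  qed
  then show ?thesis using that by blast
qed

lemma (in vector_space) jordan_string_funpow:
  assumes "jordan_string scale f \<mu> xs" "j < length xs" "Vector_Spaces.linear scale scale f"
  shows "((\<lambda>v. f v - scale \<mu> v) ^^ i) (xs ! j) = (if i \<le> j then xs ! (j - i) else 0)"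
proof (induction i)
  case (Suc i)
  interpret f: Vector_Spaces.linear scale scale f by fact
  have step: "f (xs ! l) - scale \<mu> (xs ! l) = (if l = 0 then 0 else xs ! (l - 1))" if "l \<le> j" for l
    using assms(1,2) that by (simp add: jordan_string_def)
  show ?case
  proof (cases "i \<le> j")
    case True
    then show ?thesis using Suc step[of "j - i"] by (auto simp: f.zero Suc_diff_Suc)
  qed (use Suc in \<open>simp add: f.zero\<close>)
qed simp

text \<open>This is all that the sequel needs of a Jordan basis; it holds because \<open>f - \<mu>\<close> shifts each string.\<close>
lemma (in vector_space) jordan_matrix_basis:
  assumes basis: "is_basis_of scale es UNIV" and acts: "acts_by scale f es (jordan_matrix bs)"
    and f: "Vector_Spaces.linear scale scale f"
  shows "span {e. \<exists>(k, \<mu>)\<in>set bs. ((\<lambda>v. f v - scale \<mu> v) ^^ k) e = 0} = UNIV" (is "span ?G = UNIV")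
    and "(k, \<mu>) \<in> set bs \<Longrightarrow> k \<ge> 1 \<Longrightarrow>
      \<exists>w. ((\<lambda>v. f v - scale \<mu> v) ^^ k) w = 0 \<and> ((\<lambda>v. f v - scale \<mu> v) ^^ (k - 1)) w \<noteq> 0"
    and "sum_list (map fst bs) = card (set es)"
proof -
  obtain ess where ess: "es = concat ess"
    "list_all2 (\<lambda>xs b. length xs = fst b \<and> jordan_string scale f (snd b) xs) ess bs"
    using acts_by_jordan_matrix[OF acts] by blast
  have "e \<in> ?G" if "e \<in> set es" for e
  proof -
    from that have "e \<in> set (concat ess)" by (simp only: ess(1))
    then obtain xs where xs: "xs \<in> set ess" "e \<in> set xs" by auto
    then obtain b where b: "b \<in> set bs" "length xs = fst b" "jordan_string scale f (snd b) xs"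
      using list_all2_ex_right[OF ess(2)] by blast
    obtain j where "j < length xs" "e = xs ! j" using xs(2) unfolding in_set_conv_nth by blast
    then have "((\<lambda>v. f v - scale (snd b) v) ^^ fst b) e = 0"
      using jordan_string_funpow[OF b(3) _ f, of j "fst b"] b(2) by simp
    then show ?thesis using b(1) by (auto intro!: bexI[of _ b] split: prod.splits)
  qed
  then have "set es \<subseteq> ?G" by blast
  then show "span ?G = UNIV"
    using basis span_mono[of "set es" ?G] by (auto simp: is_basis_of_def)
  have dist: "distinct es" using basis by (simp add: is_basis_of_def)
  have "length es = sum_list (map fst bs)"
    using acts by (simp add: acts_by_def) (metis carrier_matD(1) jordan_matrix_dim(1))
  then show "sum_list (map fst bs) = card (set es)" using dist by (simp add: distinct_card)
  show "\<exists>w. ((\<lambda>v. f v - scale \<mu> v) ^^ k) w = 0 \<and> ((\<lambda>v. f v - scale \<mu> v) ^^ (k - 1)) w \<noteq> 0"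
    if b: "(k, \<mu>) \<in> set bs" and k: "k \<ge> 1"
  proof -
    obtain xs where xs: "xs \<in> set ess" "length xs = k" "jordan_string scale f \<mu> xs"
      using list_all2_ex_left[OF ess(2) b] by auto
    have "xs ! 0 \<in> set es" using xs k ess(1) by (auto intro!: bexI[of _ xs] nth_mem)
    then have "xs ! 0 \<noteq> 0" using basis dependent_zero by (auto simp: is_basis_of_def)
    then show ?thesis
      using jordan_string_funpow[OF xs(3) _ f, of "k - 1" k] jordan_string_funpow[OF xs(3) _ f, of "k - 1" "k - 1"]
        xs(2) k by (intro exI[of _ "xs ! (k - 1)"]) simp
  qed
qed

section \<open>The monodromy as an isometry\<close>

locale seifert_monodromy =
  fixes L :: "'v::real_vector \<Rightarrow> 'v \<Rightarrow> real" and M :: "'v \<Rightarrow> 'v"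
  assumes seifert: "seifert_pair L" and monodromy: "monodromy L M"
begin

sublocale finite_dim_real "TYPE('v)"
  using seifert by unfold_locales (simp add: seifert_pair_def)

abbreviation S :: "'v \<Rightarrow> 'v \<Rightarrow> real" where "S \<equiv> I_s L"

lemma bilinear_L: "bilinear L" and nondegenerate_L: "nondegenerate L"
  using seifert by (auto simp: seifert_pair_def)

lemmas L_simps = bilinear_simps[OF bilinear_L]
lemmas bilinear_S = bilinear_I_s[OF bilinear_L]
lemmas S_simps = bilinear_simps[OF bilinear_S]

lemma L_eq_0: "(\<And>y. L x y = 0) \<Longrightarrow> x = 0"
  using nondegenerate_L by (auto simp: nondegenerate_def)

lemma L_M: "L (M a) b = L b a"
  using monodromy by (simp add: monodromy_def)

lemma L_M_M: "L (M a) (M b) = L a b"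
  by (simp add: L_M)

lemma linear_M: "linear M"
proof
  show "M (x + y) = M x + M y" for x y
  proof -
    have "M (x + y) - (M x + M y) = 0" by (rule L_eq_0) (simp add: L_simps L_M)
    then show ?thesis by simp
  qed
  show "M (c *\<^sub>R x) = c *\<^sub>R M x" for c x
  proof -
    have "M (c *\<^sub>R x) - c *\<^sub>R M x = 0" by (rule L_eq_0) (simp add: L_simps L_M)
    then show ?thesis by simp
  qed
qed

lemma M_eq_0: "M x = 0 \<Longrightarrow> x = 0"
  using nondegenerate_L L_M[of x] by (auto simp: nondegenerate_def L_simps)

lemma bij_M: "bij M"
proof -
  have inj: "inj M" using M_eq_0 linear_M by (simp add: linear_injective_0)
  moreover have "surj M" using rv.linear_inj_imp_surj[of M] linear_M inj by simp
  ultimately show ?thesis by (simp add: bij_def)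
qed

lemma S_eq: "S a b = L (a + M a) b"
  by (simp add: I_s_def L_simps L_M)

lemma S_M_M: "S (M a) (M b) = S a b"
  by (simp add: I_s_def L_M_M)

lemma radical_S: "radical S = {a. M a = - a}"
proof -
  have "a \<in> radical S \<longleftrightarrow> a + M a = 0" for a
    using L_eq_0[of "a + M a"] bilinear_lzero[OF bilinear_L] by (auto simp only: radical_def S_eq mem_Collect_eq)
  then show ?thesis by (auto simp: add_eq_0_iff add.commute)
qed

lemma isometric_triple_S:
  assumes "radical S = {0}"
  shows "isometric_triple M S"
proof -
  have "a = 0" if "\<forall>b. S a b = 0" for a
    using assms that by (auto simp: radical_def)
  then have "nondegenerate S" unfolding nondegenerate_def by (metis I_s_sym)
  then show ?thesis
    unfolding isometric_triple_def
    by (intro conjI disjI1 allI finite_dim bilinear_S linear_M bij_M S_M_M I_s_sym)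
qed

text \<open>
  \<open>1 + M\<close> is injective because \<open>S\<close> is nondegenerate. So it maps \<open>U\<close> onto itself, and
  \<open>S x w = L (x + M x) w\<close> reaches all values \<open>L u w\<close>.
\<close>
lemma L_orthogonal_of_S_orthogonal:
  assumes rad: "radical S = {0}" and U: "subspace U" "M ` U \<subseteq> U" and orth: "\<And>u w. u \<in> U \<Longrightarrow> w \<in> W \<Longrightarrow> S u w = 0"
    and u: "u \<in> U" "w \<in> W"
  shows "L u w = 0"
proof -
  define T where "T x = x + M x" for x
  have lin: "linear T" unfolding T_def[abs_def] using linear_M by (simp add: linear_iff algebra_simps)
  have TU: "T ` U \<subseteq> U" using U by (auto simp: T_def real_vector.subspace_add)
  have "dim (T ` U) + dim {x \<in> U. T x = 0} = dim U" by (rule rank_nullity[OF lin U(1)])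
  moreover have "{x \<in> U. T x = 0} \<subseteq> {0}" using rad radical_S by (auto simp: T_def add_eq_0_iff add.commute)
  then have "dim {x \<in> U. T x = 0} = 0" by simp
  ultimately have "T ` U = U"
    using rv.subspace_dim_equal[OF linear_subspace_image[OF lin U(1)] U(1) TU] by simp
  then obtain x where "x \<in> U" "u = T x" using u by blast
  then show ?thesis using orth[of x w] u by (simp add: S_eq T_def)
qed

lemma irreducible_isometric_triple_S:
  assumes rad: "radical S = {0}" and irr: "irreducible_seifert_pair L"
  shows "irreducible_isometric_triple M S"
proof -
  have orth: "orthogonal_sets L U W"
    if "subspace U" "subspace W" "M ` U \<subseteq> U" "M ` W \<subseteq> W" "orthogonal_sets S U W" for U W
    unfolding orthogonal_sets_def
  proof (intro ballI conjI)
    fix u w assume uw: "u \<in> U" "w \<in> W"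
    show "L u w = 0"
      by (rule L_orthogonal_of_S_orthogonal[OF rad that(1,3) _ uw]) (use that(5) in \<open>simp add: orthogonal_sets_def\<close>)
    show "L w u = 0"
      by (rule L_orthogonal_of_S_orthogonal[OF rad that(2,4) _ uw(2,1)]) (use that(5) in \<open>simp add: orthogonal_sets_def\<close>)
  qed
  show ?thesis
    unfolding irreducible_isometric_triple_def
  proof (intro conjI notI; (elim exE conjE)?)
    show "isometric_triple M S" by (rule isometric_triple_S[OF rad])
    show "\<exists>x::'v. x \<noteq> 0" using irr by (simp add: irreducible_seifert_pair_def)
    fix U V
    assume UV: "subspace U" "subspace V" "U \<noteq> {0}" "V \<noteq> {0}" "M ` U \<subseteq> U" "M ` V \<subseteq> V"
      "direct_sum [U, V]" "orthogonal_sets S U V"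
    show False
      using irr UV(1-4,7) orth[OF UV(1,2,5,6,8)] unfolding irreducible_seifert_pair_def by blast
  qed
qed

end

section \<open>Jordan decomposition of the monodromy\<close>

lemma sum_list_map_additive:
  assumes "\<And>x y. g (x + y) = g x + g y" "g 0 = 0"
  shows "g (sum_list ws) = sum_list (map g ws)"
  by (induction ws) (simp_all add: assms)

text \<open>
  The eigenvalues of \<open>Ms\<close> are given as a list because every type of Seifert form pair prescribes its
  eigenspace decomposition.
\<close>
locale seifert_jordan = seifert_monodromy L M
  for L :: "'v::real_vector \<Rightarrow> 'v \<Rightarrow> real" and M :: "'v \<Rightarrow> 'v" +
  fixes Ms Mu :: "'v \<Rightarrow> 'v" and \<alpha>s :: "complex list"
  assumes parts: "jordan_parts M Ms Mu" and decomp: "direct_sum (map (eig_space Ms) \<alpha>s)"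
begin

sublocale unipotent_map Mu
  using parts by unfold_locales (simp add: jordan_parts_def)

abbreviation N :: "'v \<Rightarrow> 'v" where "N \<equiv> logf"
abbreviation H :: "complex \<Rightarrow> ('v \<times> 'v) set" where "H \<equiv> eig_space Ms"

definition T :: "complex \<Rightarrow> 'v \<times> 'v \<Rightarrow> 'v \<times> 'v" where "T \<mu> v = cmap M v - cscale \<mu> v"

lemma linear_Ms: "linear Ms"
  using parts by (simp add: jordan_parts_def semisimple_def)

lemma M_eq: "M x = Ms (Mu x)" and Ms_Mu: "Ms (Mu x) = Mu (Ms x)"
  using parts by (auto simp: jordan_parts_def fun_eq_iff)

lemma Ms_Y: "Ms (Y x) = Y (Ms x)"
  by (simp add: Y_def Ms_Mu linear_diff[OF linear_Ms])

lemma Ms_N: "Ms (N x) = N (Ms x)"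
  by (rule log_commute[OF linear_Ms]) (rule Ms_Mu)

interpretation cM: Vector_Spaces.linear cscale cscale "cmap M" by (rule complex_linear_cmap[OF linear_M])
interpretation cMs: Vector_Spaces.linear cscale cscale "cmap Ms" by (rule complex_linear_cmap[OF linear_Ms])
interpretation cY: Vector_Spaces.linear cscale cscale "cmap Y" by (rule complex_linear_cmap[OF linear_Y])
interpretation cYk: Vector_Spaces.linear cscale cscale "cmap (Y ^^ k)" for k
  by (rule complex_linear_cmap[OF linear_Y_funpow])

lemma T_add: "T \<mu> (v + w) = T \<mu> v + T \<mu> w" and T_0: "T \<mu> 0 = 0"
  and T_cscale: "T \<mu> (cscale c v) = cscale c (T \<mu> v)"
  by (simp_all add: T_def cM.add cM.zero cM.scale cv.scale_right_distrib cv.scale_right_diff_distrib cv.scale_left_commute)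

lemma T_pow_add: "(T \<mu> ^^ k) (v + w) = (T \<mu> ^^ k) v + (T \<mu> ^^ k) w" and T_pow_0: "(T \<mu> ^^ k) 0 = 0"
  by (induction k) (simp_all add: T_add T_0)

lemma cmap_M_eig: "w \<in> H \<alpha> \<Longrightarrow> cmap M w = cscale \<alpha> (w + cmap Y w)"
proof -
  assume w: "w \<in> H \<alpha>"
  have "cmap M w = cmap Ms (w + cmap Y w)"
    by (simp add: cmap_def M_eq Y_def prod_eq_iff)
  also have "\<dots> = cmap Ms w + cmap Y (cmap Ms w)"
    by (simp add: cMs.add) (simp add: cmap_def Ms_Y)
  also have "\<dots> = cscale \<alpha> (w + cmap Y w)"
    using w by (simp add: eig_space_def cY.scale cv.scale_right_distrib)
  finally show ?thesis .
qed

lemma Y_eig: "w \<in> H \<alpha> \<Longrightarrow> cmap Y w \<in> H \<alpha>"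
  by (rule cmap_commute_eig_space[OF linear_Y]) (simp add: Ms_Y)

lemma N_pow_eig: "w \<in> H \<alpha> \<Longrightarrow> (cmap N ^^ k) w \<in> H \<alpha>"
  by (rule cmap_funpow_eig_space[OF linear_log]) (simp add: Ms_N)

lemma eig_add: "v \<in> H \<alpha> \<Longrightarrow> w \<in> H \<alpha> \<Longrightarrow> v + w \<in> H \<alpha>"
  and eig_cscale: "v \<in> H \<alpha> \<Longrightarrow> cscale c v \<in> H \<alpha>"
  and eig_0: "0 \<in> H \<alpha>"
  using subspace_eig_space[OF linear_Ms, of \<alpha>] by (auto intro: cv.subspace_add cv.subspace_scale cv.subspace_0)

lemma T_eig: "w \<in> H \<alpha> \<Longrightarrow> T \<mu> w \<in> H \<alpha>"
  using subspace_eig_space[OF linear_Ms, of \<alpha>]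
  by (simp add: T_def cmap_M_eig Y_eig eig_add eig_cscale cv.subspace_diff)

lemma T_pow_eig: "w \<in> H \<alpha> \<Longrightarrow> (T \<mu> ^^ k) w \<in> H \<alpha>"
  by (induction k) (simp_all add: T_eig)

lemma T_pow_same: "w \<in> H \<alpha> \<Longrightarrow> (T \<alpha> ^^ k) w = cscale (\<alpha> ^ k) (cmap (Y ^^ k) w)"
proof (induction k)
  case 0
  then show ?case by (simp add: cmap_def)
next
  case (Suc k)
  have "cmap (Y ^^ k) w \<in> H \<alpha>" 
    using cmap_funpow_eig_space[of Y Ms w \<alpha> k, OF linear_Y _ Suc.prems] Ms_Y by (simp add: cmap_funpow)
  then have "T \<alpha> (cmap (Y ^^ k) w) = cscale \<alpha> (cmap (Y ^^ Suc k) w)"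
    by (simp add: T_def cmap_M_eig cv.scale_right_distrib) (simp add: cmap_def o_def)
  then show ?case using Suc by (simp add: T_cscale mult.commute o_def)
qed

text \<open>On \<open>H \<alpha>\<close> the map \<open>T \<mu>\<close> is a nonzero scalar plus a nilpotent map.\<close>
lemma T_injective:
  assumes w: "w \<in> H \<alpha>" "T \<mu> w = 0" "\<alpha> \<noteq> \<mu>"
  shows "w = 0"
proof -
  define c where "c = \<alpha> / (\<mu> - \<alpha>)"
  have "cscale (\<mu> - \<alpha>) w = cscale \<alpha> (cmap Y w)"
    using w(2) by (simp add: T_def cmap_M_eig[OF w(1)] cv.scale_right_distrib cv.scale_left_diff_distrib algebra_simps)
  then have "cscale (inverse (\<mu> - \<alpha>)) (cscale (\<mu> - \<alpha>) w) = cscale (inverse (\<mu> - \<alpha>)) (cscale \<alpha> (cmap Y w))" by simp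
  then have step: "w = cscale c (cmap Y w)"
    using w(3) by (simp add: c_def divide_inverse mult.commute)
  have "w = cscale (c ^ k) (cmap (Y ^^ k) w)" for k
  proof (induction k)
    case (Suc k)
    have "cmap (Y ^^ k) w = cmap (Y ^^ k) (cscale c (cmap Y w))" using step by simp
    also have "\<dots> = cscale c (cmap (Y ^^ Suc k) w)"
      by (simp add: cYk.scale) (simp add: cmap_def funpow_swap1)
    finally have "w = cscale (c ^ k) (cscale c (cmap (Y ^^ Suc k) w))" using Suc by simp
    then show ?case by (simp add: mult.commute o_def)
  qed (simp add: cmap_def)
  from this[of height] show ?thesis by (simp add: cmap_def Y_height flip: zero_prod_def)
qed

lemma T_pow_injective:
  assumes "w \<in> H \<alpha>" "(T \<mu> ^^ k) w = 0" "w \<noteq> 0"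
  shows "\<alpha> = \<mu>"
proof (rule ccontr)
  assume ne: "\<alpha> \<noteq> \<mu>"
  have "(T \<mu> ^^ k) w \<noteq> 0"
    by (induction k) (use assms(1,3) T_injective[OF T_pow_eig[OF assms(1)] _ ne] in auto)
  then show False using assms(2) by simp
qed

lemma eig_ne_0: "w \<in> H \<alpha> \<Longrightarrow> w \<noteq> 0 \<Longrightarrow> \<alpha> \<noteq> 0"
proof
  assume w: "w \<in> H \<alpha>" "w \<noteq> 0" and "\<alpha> = 0"
  then have "cmap M w = 0" by (simp add: cmap_M_eig)
  then show False using w M_eq_0 by (auto simp: cmap_def prod_eq_iff)
qed

text \<open>
  Both maps are tested on the eigenspace components of \<open>v\<close>: as \<open>g\<close> preserves the decomposition, it
  annihilates all components, whereas \<open>h\<close> cannot annihilate all. Thus generalized eigenvectors of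
  \<open>M\<close> are traded for vectors in the eigenspaces of \<open>Ms\<close>.
\<close>
lemma eigenvector_witness:
  fixes g :: "'v \<times> 'v \<Rightarrow> 'v \<times> 'v" and h :: "'v \<times> 'v \<Rightarrow> 'c::ab_group_add"
  assumes g: "\<And>x y. g (x + y) = g x + g y" "\<And>\<alpha> w. w \<in> H \<alpha> \<Longrightarrow> g w \<in> H \<alpha>" "g v = 0"
    and h: "\<And>x y. h (x + y) = h x + h y" "h v \<noteq> 0"
  shows "\<exists>\<alpha>\<in>set \<alpha>s. \<exists>w\<in>H \<alpha>. g w = 0 \<and> h w \<noteq> 0"
proof -
  have g0: "g 0 = 0" using g(1)[of 0 0] by simp
  have h0: "h 0 = 0" using h(1)[of 0 0] by simp
  obtain ws where ws: "list_all2 (\<in>) ws (map H \<alpha>s)" "sum_list ws = v"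
    using decomp unfolding direct_sum_def by blast
  have z: "list_all2 (\<in>) (map (\<lambda>_. 0) ws) (map H \<alpha>s)"
    using ws(1) eig_0 by (auto simp: list_all2_conv_all_nth)
  have gz: "list_all2 (\<in>) (map g ws) (map H \<alpha>s)"
    by (rule list_all2_all_nthI) (use ws(1) g(2) list_all2_lengthD[OF ws(1)] list_all2_nthD[OF ws(1)] in simp_all)
  have "sum_list (map g ws) = 0"
    using sum_list_map_additive[of g ws, OF g(1) g0] ws(2) g(3) by simp
  moreover have "sum_list (map (\<lambda>_. 0 :: 'v \<times> 'v) ws) = 0" by simp
  ultimately have "map g ws = map (\<lambda>_. 0) ws"
    using decomp gz z unfolding direct_sum_def by (metis (no_types, lifting))
  then have gw: "g w = 0" if "w \<in> set ws" for w using that by simp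
  have "sum_list (map h ws) \<noteq> 0"
    using sum_list_map_additive[of h ws, OF h(1) h0] ws(2) h(2) by simp
  moreover have "sum_list (map h us) = 0" if "\<And>w. w \<in> set us \<Longrightarrow> h w = 0" for us
    using that by (induction us) simp_all
  ultimately obtain w where w: "w \<in> set ws" "h w \<noteq> 0" by blast
  obtain \<alpha> where "\<alpha> \<in> set \<alpha>s" "w \<in> H \<alpha>" using list_all2_ex_right[OF ws(1) w(1)] by auto
  then show ?thesis using gw[OF w(1)] w(2) by blast
qed

lemmas eigenvector_witness' = eigenvector_witness[of "\<lambda>_. 0", simplified, OF eig_0]

lemma radical_S_eq_0:
  assumes "-1 \<notin> set \<alpha>s"
  shows "radical S = {0}"
proof -
  have "a = 0" if "M a = - a" for a
  proof (rule ccontr)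
    assume "a \<noteq> 0"
    have "T (-1) (a, 0) = 0"
      using that linear_0[OF linear_M] by (simp add: T_def cmap_def cscale_def zero_prod_def)
    then obtain \<alpha> w where "\<alpha> \<in> set \<alpha>s" "w \<in> H \<alpha>" "T (-1) w = 0" "w \<noteq> 0"
      using eigenvector_witness[of "T (-1)" "(a, 0)" "\<lambda>v. v"] T_add T_eig \<open>a \<noteq> 0\<close>
      by (auto simp: zero_prod_def)
    then show False using T_injective[of w \<alpha> "-1"] assms by blast
  qed
  then show ?thesis using radical_S linear_0[OF linear_M] by auto
qed

text \<open>
  The given blocks are blocks of \<open>M\<close>. On \<open>H \<alpha>\<close> the powers of \<open>M - \<alpha>\<close> are nonzero multiples of those of
  \<open>Y\<close>, and these have the same kernels as the powers of \<open>N\<close>.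
\<close>
lemma jordan_blocks:
  assumes "has_jordan_blocks M bs"
  shows sum_block_sizes: "sum_list (map fst bs) = dim (UNIV :: 'v set)"
    and nilpotent_of_block_sizes: "(\<And>b. b \<in> set bs \<Longrightarrow> fst b \<le> n) \<Longrightarrow> (N ^^ n) x = 0"
    and nonzero_of_block_size: "b \<in> set bs \<Longrightarrow> \<exists>x. (N ^^ (fst b - 1)) x \<noteq> 0"
proof -
  obtain es where es: "is_basis_of cscale es UNIV" "acts_by cscale (cmap M) es (jordan_matrix bs)"
    and ne: "0 \<notin> fst ` set bs"
    using assms by (auto simp: has_jordan_blocks_def)
  note J = cv.jordan_matrix_basis[OF es complex_linear_cmap[OF linear_M], folded T_def]
  have "card (set es) = cv.dim (UNIV :: ('v \<times> 'v) set)"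
    using es(1) cv.basis_card_eq_dim[of "set es" UNIV] by (simp add: is_basis_of_def del: fcv.dim_UNIV)
  then show "sum_list (map fst bs) = dim (UNIV :: 'v set)"
    using J(3) card_complex_basis by simp
  show "(N ^^ n) x = 0" if n: "\<And>b. b \<in> set bs \<Longrightarrow> fst b \<le> n"
  proof -
    have gen: "cmap (Y ^^ n) e = 0" if e: "(k, \<mu>) \<in> set bs" "(T \<mu> ^^ k) e = 0" for e k \<mu>
    proof (rule ccontr)
      assume "cmap (Y ^^ n) e \<noteq> 0"
      then obtain \<alpha> w where w: "w \<in> H \<alpha>" "(T \<mu> ^^ k) w = 0" "cmap (Y ^^ n) w \<noteq> 0"
        using eigenvector_witness[of "T \<mu> ^^ k" e "cmap (Y ^^ n)"] e(2) T_pow_add T_pow_eig cYk.add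
        by blast
      then have "w \<noteq> 0" by (auto simp: cYk.zero)
      then have "\<alpha> = \<mu>" "\<alpha> \<noteq> 0" using T_pow_injective w eig_ne_0 by blast+
      then have "cmap (Y ^^ k) w = 0" using w T_pow_same by simp
      moreover have "n = (n - k) + k" using n[OF e(1)] by simp
      then have "cmap (Y ^^ n) w = cmap (Y ^^ (n - k)) (cmap (Y ^^ k) w)"
        by (metis (no_types, lifting) cmap_def comp_apply fst_conv funpow_add snd_conv)
      ultimately show False using w(3) by (simp add: cYk.zero)
    qed
    have "cmap (Y ^^ n) v = 0" if "v \<in> cv.span {e. \<exists>(k, \<mu>)\<in>set bs. (T \<mu> ^^ k) e = 0}" for v
      using that
    proof (induction rule: cv.span_induct_alt)
      case (step c x y)
      have "cmap (Y ^^ n) x = 0" using step(1) gen by blast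
      then show ?case using step(2) by (simp add: cYk.add cYk.scale)
    qed (simp add: cYk.zero)
    then have "cmap (Y ^^ n) (x, 0) = 0" using J(1) by blast
    then show ?thesis by (simp add: cmap_def log_funpow_eq_0_iff zero_prod_def)
  qed
  show "\<exists>x. (N ^^ (fst b - 1)) x \<noteq> 0" if b: "b \<in> set bs"
  proof -
    obtain k \<mu> where k: "b = (k, \<mu>)" by force
    have "k \<ge> 1" using ne b k by (metis One_nat_def fst_conv image_eqI less_eq_Suc_le not_gr_zero)
    then obtain v where v: "(T \<mu> ^^ k) v = 0" "(T \<mu> ^^ (k - 1)) v \<noteq> 0"
      using J(2)[of k \<mu>] b k by blast
    then obtain \<alpha> w where w: "w \<in> H \<alpha>" "(T \<mu> ^^ k) w = 0" "(T \<mu> ^^ (k - 1)) w \<noteq> 0"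
      using eigenvector_witness[of "T \<mu> ^^ k" v "T \<mu> ^^ (k - 1)"] T_pow_add T_pow_eig by blast
    then have "w \<noteq> 0" by (auto simp: T_pow_0)
    then have "\<alpha> = \<mu>" using T_pow_injective w by blast
    then have "cmap (Y ^^ (k - 1)) w \<noteq> 0" using w T_pow_same[of w \<alpha> "k - 1"] by auto
    then obtain x where "(Y ^^ (k - 1)) x \<noteq> 0" by (auto simp: cmap_def zero_prod_def)
    then show ?thesis using k by (auto simp: log_funpow_eq_0_iff)
  qed
qed

lemma cform_M_M: "cform L (cmap M v) (cmap M w) = cform L v w"
  by (simp add: cform_def cmap_def L_M_M)

text \<open>
  Induction on the heights of \<open>a\<close> and \<open>b\<close> under \<open>Y\<close>: as \<open>M = \<alpha> (1 + Y)\<close> on \<open>H \<alpha>\<close>, expanding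
  \<open>L (M a) (M b) = L a b\<close> leaves \<open>(1 - \<alpha> \<beta>) L a b = 0\<close> up to products of smaller height.
\<close>
lemma eig_orthogonal:
  assumes "a \<in> H \<alpha>" "b \<in> H \<beta>" "\<alpha> * \<beta> \<noteq> 1"
  shows "cform L a b = 0"
proof -
  have *: "cform L a b = 0"
    if "a \<in> H \<alpha>" "b \<in> H \<beta>" "(cmap Y ^^ i) a = 0" "(cmap Y ^^ j) b = 0" "i + j \<le> m"
    for a b i j m
    using that
  proof (induction m arbitrary: a b i j)
    case 0
    then show ?case by (simp add: cform_simps[OF bilinear_L])
  next
    case (Suc m)
    show ?case
    proof (cases "i = 0 \<or> j = 0")
      case True
      then show ?thesis using Suc.prems by (auto simp: cform_simps[OF bilinear_L])
    next
      case False
      then obtain i' j' where ij: "i = Suc i'" "j = Suc j'" by (metis not0_implies_Suc)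
      have Ya: "cmap Y a \<in> H \<alpha>" "(cmap Y ^^ i') (cmap Y a) = 0" using Suc.prems ij Y_eig by (simp_all add: funpow_swap1)
      have Yb: "cmap Y b \<in> H \<beta>" "(cmap Y ^^ j') (cmap Y b) = 0" using Suc.prems ij Y_eig by (simp_all add: funpow_swap1)
      have z: "cform L (cmap Y a) b = 0" "cform L a (cmap Y b) = 0" "cform L (cmap Y a) (cmap Y b) = 0"
        using Suc.IH[OF Ya(1) Suc.prems(2) Ya(2) Suc.prems(4)] Suc.IH[OF Suc.prems(1) Yb(1) Suc.prems(3) Yb(2)]
          Suc.IH[OF Ya(1) Yb(1) Ya(2) Yb(2)] Suc.prems(5) ij by auto
      have "cform L a b = cform L (cmap M a) (cmap M b)" by (simp add: cform_M_M)
      also have "\<dots> = \<alpha> * \<beta> * cform L a b"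
        by (simp add: cmap_M_eig[OF Suc.prems(1)] cmap_M_eig[OF Suc.prems(2)] cform_simps[OF bilinear_L] z)
      finally have "(1 - \<alpha> * \<beta>) * cform L a b = 0" by (simp add: left_diff_distrib)
      then show ?thesis using assms(3) by simp
    qed
  qed
  have "(cmap Y ^^ height) v = 0" for v
    by (simp add: cmap_funpow) (simp add: cmap_def Y_height zero_prod_def)
  then show ?thesis using *[OF assms(1,2), of height height "height + height"] by simp
qed

text \<open>On eigenvectors, the factor \<open>\<alpha> \<beta>\<close> equals \<open>1\<close> wherever \<open>L\<close> does not vanish.\<close>
lemma L_Ms_Ms: "L (Ms a) (Ms b) = L a b"
proof -
  define D where "D v w = cform L (cmap Ms v) (cmap Ms w) - cform L v w" for v w
  have add: "D (v + v') w = D v w + D v' w" "D v (w + w') = D v w + D v w'" for v v' w w'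
    by (simp_all add: D_def cMs.add cform_simps[OF bilinear_L])
  have eig: "D v w = 0" if vw: "v \<in> H \<alpha>" "w \<in> H \<beta>" for v w \<alpha> \<beta>
  proof (cases "\<alpha> * \<beta> = 1")
    case True
    then show ?thesis using vw
      by (simp add: D_def eig_space_def cform_simps[OF bilinear_L] mult.commute[of \<beta> \<alpha>] flip: mult.assoc)
  next
    case False
    then show ?thesis using eig_orthogonal[OF vw] vw by (simp add: D_def eig_space_def cform_simps[OF bilinear_L])
  qed
  have eig': "D v w = 0" if v: "v \<in> H \<alpha>" for v w \<alpha>
  proof (rule ccontr)
    assume "D v w \<noteq> 0"
    then show False using eigenvector_witness'[of "D v" w] add(2) eig[OF v] by blast
  qed
  have "D (a, 0) (b, 0) = 0"
  proof (rule ccontr)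
    assume "D (a, 0) (b, 0) \<noteq> 0"
    then show False using eigenvector_witness'[of "\<lambda>v. D v (b, 0)" "(a, 0)"] add(1) eig' by blast
  qed
  then show ?thesis
    by (simp add: D_def cmap_def linear_0[OF linear_Ms] cform_real[OF bilinear_L] flip: of_real_diff)
qed

lemma L_Mu_Mu: "L (Mu a) (Mu b) = L a b"
  using L_M_M[of a b] by (simp add: M_eq L_Ms_Ms)

lemma L_N: "L (N a) b = - L a (N b)"
  by (rule log_antisymmetric[OF bilinear_L L_Mu_Mu])

lemma S_N: "S (N a) b = - S a (N b)"
  by (simp add: I_s_def L_N)

lemma cform_S_eig_orthogonal:
  "a \<in> H \<alpha> \<Longrightarrow> b \<in> H \<beta> \<Longrightarrow> \<alpha> * \<beta> \<noteq> 1 \<Longrightarrow> cform S a b = 0"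
  by (simp add: cform_I_s eig_orthogonal mult.commute)

lemma cform_L_M: "cform L (cmap M v) w = cform L w v"
  by (simp add: cform_def cmap_def L_M complex_eq_iff)

end

section \<open>Eigenvalues 1 and -1\<close>

text \<open>Exponents \<open>n - 1\<close> occur throughout and should keep this form.\<close>
declare One_nat_def [simp del]

lemma (in unipotent_map) log_eq_0_iff: "logf x = 0 \<longleftrightarrow> Y x = 0"
  using log_funpow_eq_0_iff[of "Suc 0" x] by simp

locale seifert_nilpotent = seifert_jordan L M Ms Mu \<alpha>s
  for L :: "'v::real_vector \<Rightarrow> 'v \<Rightarrow> real" and M Ms Mu :: "'v \<Rightarrow> 'v" and \<alpha>s +
  fixes n :: nat
  assumes N_nilpotent: "\<And>x. (N ^^ n) x = 0" and n_pos: "n \<ge> 1"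
begin

abbreviation F :: "'v \<times> 'v \<Rightarrow> 'v \<times> 'v \<Rightarrow> complex" where "F \<equiv> cform S"
abbreviation NC :: "'v \<times> 'v \<Rightarrow> 'v \<times> 'v" where "NC \<equiv> cmap N"

sublocale rf: nilpotent_form_space "(*\<^sub>R)" some_basis N S n
proof (intro nilpotent_form_space.intro nilpotent_form_space_axioms.intro rv.finite_dimensional_vector_space_axioms)
  show "Vector_Spaces.linear (*\<^sub>R) (*\<^sub>R) N" using linear_log by (simp add: linear_def)
  show "Vector_Spaces.linear (*\<^sub>R) (*) (\<lambda>x. S x y)" for y
    using bilinear_linear_left[OF bilinear_S, of y] by (simp add: linear_def real_scaleR_def[abs_def])
  show "Vector_Spaces.linear (*\<^sub>R) (*) (S x)" for x
    using bilinear_linear_right[OF bilinear_S, of x] by (simp add: linear_def real_scaleR_def[abs_def])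
  show "S (N x) y = - S x (N y)" for x y by (rule S_N)
  show "(N ^^ n) x = 0" for x by (rule N_nilpotent)
qed (rule n_pos)

sublocale cf: nilpotent_form_space cscale "(\<lambda>e. (e, 0)) ` some_basis" NC F n
proof (intro nilpotent_form_space.intro nilpotent_form_space_axioms.intro fcv.finite_dimensional_vector_space_axioms)
  show "(NC ^^ n) v = 0" for v
    by (simp add: cmap_funpow) (simp add: cmap_def N_nilpotent zero_prod_def)
  show "Vector_Spaces.linear cscale cscale NC" by (rule complex_linear_cmap[OF linear_log])
  show "Vector_Spaces.linear cscale (*) (\<lambda>x. F x y)" for y by (rule cform_linear_left[OF bilinear_S])
  show "Vector_Spaces.linear cscale (*) (F x)" for x by (rule cform_linear_right[OF bilinear_S])
  show "F (NC x) y = - F x (NC y)" for x y by (rule cform_cmap_antisymmetric[OF bilinear_S linear_log S_N])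
qed (rule n_pos)

lemma L_N_funpow: "L ((N ^^ j) x) y = (-1) ^ j * L x ((N ^^ j) y)"
proof (induction j arbitrary: y)
  case (Suc j)
  have "L ((N ^^ Suc j) x) y = - L ((N ^^ j) x) (N y)" by (simp add: L_N)
  then show ?case by (simp add: Suc funpow_swap1)
qed simp

lemma Y_N_funpow: "(N ^^ k) (Y x) = Y ((N ^^ k) x)"
  by (induction k) (simp_all add: log_Y)

lemma N_last_Y: "(N ^^ (n - 1)) (Y x) = 0"
proof -
  have "N ((N ^^ (n - 1)) x) = (N ^^ n) x" using n_pos by (cases n) simp_all
  then show ?thesis by (simp add: N_nilpotent log_eq_0_iff Y_N_funpow)
qed

lemma L_Y_N_last: "L (Y x) ((N ^^ (n - 1)) y) = 0"
  using L_N_funpow[of "n - 1" "Y x" y] by (simp add: N_last_Y L_simps)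

lemma S_eq_Y: "Ms x = c *\<^sub>R x \<Longrightarrow> S x y = (1 + c) * L x y + c * L (Y x) y"
proof -
  assume "Ms x = c *\<^sub>R x"
  then have "M x = c *\<^sub>R (x + Y x)"
    by (simp add: M_eq Ms_Mu Y_def linear_scale[OF linear_f])
  then show ?thesis by (simp add: S_eq L_simps algebra_simps)
qed

text \<open>The nilpotent part of \<open>1 + M\<close> does not contribute, because \<open>N^(n-1) Y = 0\<close>.\<close>
lemma F_N_last:
  assumes "u \<in> H \<alpha>"
  shows "F u ((NC ^^ (n - 1)) w) = (1 + \<alpha>) * cform L u ((NC ^^ (n - 1)) w)"
proof -
  have Y: "cform L (cmap Y u) ((NC ^^ (n - 1)) w) = 0"
    by (simp add: cmap_funpow) (simp add: cform_def cmap_def L_Y_N_last complex_eq_iff)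
  have "F u v = cform L u v + cform L (cmap M u) v" for v
    by (simp add: cform_I_s cform_L_M)
  then show ?thesis
    using Y by (simp add: cmap_M_eig[OF assms] cform_simps[OF bilinear_L] distrib_right)
qed

lemma dim_range_N:
  assumes "dim (UNIV :: 'v set) = m * n" "m \<le> dim (range (N ^^ (n - 1)))"
  shows "k \<le> n \<Longrightarrow> dim (range (N ^^ k)) = m * (n - k)" and "dim {x. N x = 0} = m"
  using dim_range_funpow_nilpotent[OF linear_log N_nilpotent assms n_pos] by auto

lemma subspace_range_N: "subspace (range (N ^^ k))"
  using linear_subspace_image[OF linear_funpow[OF linear_log]] by simp

lemma S_range_N: "x \<in> range (N ^^ k) \<Longrightarrow> \<exists>y. S x x = (-1) ^ k * S y ((N ^^ (2 * k)) y)"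
  using rf.F_N_funpow2[of k _ k] by (auto simp: mult_2)

lemma L_range_N: "x \<in> range N \<Longrightarrow> L x ((N ^^ (n - 1)) x) = 0"
proof -
  assume "x \<in> range N"
  then obtain y where y: "x = N y" by blast
  have "(N ^^ (n - 1)) x = (N ^^ Suc (n - 1)) y" by (simp add: y funpow_swap1)
  then show ?thesis using n_pos by (simp add: N_nilpotent L_simps)
qed

lemma dim_range_last_pos: "(N ^^ (n - 1)) x \<noteq> 0 \<Longrightarrow> 1 \<le> dim (range (N ^^ (n - 1)))"
  using rv.independent_card_le_dim[of "{(N ^^ (n - 1)) x}" "range (N ^^ (n - 1))"] by simp

lemma dim_range_last_2:
  assumes "u \<in> range (N ^^ (n - 1))" "v \<in> range (N ^^ (n - 1))" "v \<noteq> 0" "\<And>c. u \<noteq> c *\<^sub>R v"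
  shows "2 \<le> dim (range (N ^^ (n - 1)))"
proof -
  have "u \<notin> span {v}" using assms(4) by (auto simp: real_vector.span_singleton)
  then have "independent {u, v}" using assms(3) by (simp add: real_vector.independent_insert)
  moreover have "u \<noteq> v" using assms(4)[of 1] by simp
  ultimately show ?thesis
    using rv.independent_card_le_dim[of "{u, v}" "range (N ^^ (n - 1))"] assms(1,2) by simp
qed

text \<open>
  The isotropic range of \<open>N^(m+1)\<close> bounds both indices. The range of \<open>N^m\<close>, on which the form has
  the sign \<open>s\<close>, improves the bound on the index of the opposite sign.
\<close>
lemma signature_middle_ranges:
  fixes s :: real
  assumes dims: "dim (range (N ^^ m)) = d1" "dim (range (N ^^ (m + 1))) = d2"
    and q: "dim (radical S) = q" "q \<le> d1" "q \<le> d2" and d: "d1 + d2 = dim (UNIV :: 'v set) + q"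
    and iso: "\<And>y. S y ((N ^^ (2 * (m + 1))) y) = 0"
    and sgn: "\<And>y. 0 \<le> s * ((-1) ^ m * S y ((N ^^ (2 * m)) y))"
  shows "s = 1 \<Longrightarrow> has_signature S (d1 - q, q, d2 - q)"
    and "s = -1 \<Longrightarrow> has_signature S (d2 - q, q, d1 - q)"
proof -
  have iso': "S x x = 0" if x: "x \<in> range (N ^^ (m + 1))" for x
    using S_range_N[OF x] unfolding iso by simp
  have sgn': "0 \<le> s * S x x" if x: "x \<in> range (N ^^ m)" for x
    using S_range_N[OF x] sgn by metis
  note sub = subspace_range_N[of m] subspace_range_N[of "m + 1"]
  show "has_signature S (d1 - q, q, d2 - q)" if "s = 1"
    by (rule has_signature_of_semidefinite[OF bilinear_S I_s_sym sub(1) _ _ sub(2)])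
      (use sgn' iso' that dims q d in auto)
  show "has_signature S (d2 - q, q, d1 - q)" if "s = -1"
    by (rule has_signature_of_semidefinite[OF bilinear_S I_s_sym sub(2) _ _ sub(1)])
      (use sgn' iso' that dims q d in auto)
qed

lemma signature_even:
  assumes dims: "\<And>k. k \<le> n \<Longrightarrow> dim (range (N ^^ k)) = 2 * (n - k)" "dim (UNIV :: 'v set) = 2 * n"
    and n: "even n" and rad: "radical S = {0}"
  shows "has_signature S (n, 0, n)"
proof -
  obtain m where m: "n = 2 * m" using n by blast
  have iso: "S x x = 0" if "x \<in> range (N ^^ m)" for x
    using S_range_N[OF that] N_nilpotent m by (auto simp: S_simps)
  show ?thesis
    by (rule has_signature_of_semidefinite[OF bilinear_S I_s_sym subspace_range_N[of m] _ _ subspace_range_N[of m]])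
      (use iso dims(1)[of m] m rad dims(2) in auto)
qed

context
  fixes c :: real
  assumes Ms_sign: "\<And>x. Ms x = c *\<^sub>R x"
begin

lemma S_N_last_1: "c = 1 \<Longrightarrow> S x ((N ^^ (n - 1)) y) = 2 * L x ((N ^^ (n - 1)) y)"
  using S_eq_Y[OF Ms_sign] L_Y_N_last by simp

lemma S_N_ge: "c = -1 \<Longrightarrow> n - 1 \<le> j \<Longrightarrow> S x ((N ^^ j) y) = 0"
proof -
  assume "c = -1" "n - 1 \<le> j"
  then have "(N ^^ j) y = (N ^^ (n - 1)) ((N ^^ (j - (n - 1))) y)"
    by (simp flip: funpow_add[THEN fun_cong, unfolded o_def])
  then show ?thesis using S_eq_Y[OF Ms_sign] L_Y_N_last \<open>c = -1\<close> by simp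
qed

text \<open>
  Here \<open>1 + M\<close> is \<open>- Y\<close>, and \<open>Y\<close> agrees with \<open>N\<close> on the range of \<open>N^(n-2)\<close>; so passing from \<open>L\<close> to \<open>S\<close>
  lowers the exponent by one.
\<close>
lemma S_N_second_last:
  assumes "c = -1" "n \<ge> 2"
  shows "S x ((N ^^ (n - 2)) y) = L x ((N ^^ (n - 1)) y)"
proof -
  let ?w = "(N ^^ (n - 2)) x"
  have n: "Suc (n - 2) = n - 1" "Suc (n - 1) = n" using assms by auto
  have Nw: "N ?w = (N ^^ (n - 1)) x" unfolding n(1)[symmetric] by simp
  have "N (N ?w) = (N ^^ Suc (n - 1)) x" unfolding Nw by simp
  then have "N (N ?w) = 0" unfolding n(2) by (simp add: N_nilpotent)
  then have Yw: "Y ?w = (N ^^ (n - 1)) x" using Y_eq_log Nw by metis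
  have "S x ((N ^^ (n - 2)) y) = - L (Y x) ((N ^^ (n - 2)) y)"
    using S_eq_Y[OF Ms_sign] assms(1) by simp
  also have "L (Y x) ((N ^^ (n - 2)) y) = (-1) ^ (n - 2) * L (Y ?w) y"
    using L_N_funpow[of "n - 2" "Y x" y] by (simp add: Y_N_funpow flip: mult.assoc power_add)
  also have "L (Y ?w) y = (-1) ^ (n - 1) * L x ((N ^^ (n - 1)) y)"
    by (simp add: Yw L_N_funpow)
  also have "- ((-1) ^ (n - 2) * ((-1) ^ (n - 1) * L x ((N ^^ (n - 1)) y))) = L x ((N ^^ (n - 1)) y)"
    unfolding n(1)[symmetric] by (simp flip: mult.assoc power_add)
  finally show ?thesis .
qed

lemma radical_S_minus: "c = -1 \<Longrightarrow> radical S = {x. N x = 0}"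
proof -
  assume c: "c = -1"
  have "M x = - x \<longleftrightarrow> N x = 0" for x
  proof -
    have "M x = - (x + Y x)" using c by (simp add: M_eq Ms_sign Y_def)
    then have "M x = - x \<longleftrightarrow> Y x = 0" by auto
    then show ?thesis by (simp add: log_eq_0_iff)
  qed
  then show ?thesis by (simp add: radical_S)
qed

context
  fixes \<epsilon> :: int
  assumes \<epsilon>: "\<epsilon> \<in> {1, -1}" and dim_n: "dim (UNIV :: 'v set) = n"
    and N_last_nz: "\<exists>x. (N ^^ (n - 1)) x \<noteq> 0"
    and L_sign: "\<And>a. a \<notin> range N \<Longrightarrow> \<exists>t>0. L a ((N ^^ (n - 1)) a) = of_int \<epsilon> * t"
begin

lemma L_N_last_semidefinite: "0 \<le> of_int \<epsilon> * L x ((N ^^ (n - 1)) x)"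
proof (cases "x \<in> range N")
  case False
  then obtain t where "t > 0" "L x ((N ^^ (n - 1)) x) = of_int \<epsilon> * t" using L_sign by blast
  then show ?thesis using \<epsilon> by auto
qed (simp add: L_range_N)

lemma dim_range_N_1: "k \<le> n \<Longrightarrow> dim (range (N ^^ k)) = n - k" "dim {x. N x = 0} = 1"
  using dim_range_N[of 1] dim_n N_last_nz dim_range_last_pos by auto

lemma signature_one_block_1:
  assumes c: "c = 1" and rad: "radical S = {0}" and n: "n = 2 * m + 1"
  shows "of_int \<epsilon> = (-1 :: real) ^ m \<Longrightarrow> has_signature S (m + 1, 0, m)"
    and "of_int \<epsilon> = - ((-1 :: real) ^ m) \<Longrightarrow> has_signature S (m, 0, m + 1)"
proof -
  have dims: "dim (range (N ^^ m)) = m + 1" "dim (range (N ^^ (m + 1))) = m"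
    using dim_range_N_1 n by auto
  have iso: "S y ((N ^^ (2 * (m + 1))) y) = 0" for y
  proof -
    have "(N ^^ (2 * (m + 1))) y = 0" by (rule rf.N_funpow_ge) (simp add: n)
    then show ?thesis by (simp only: S_simps)
  qed
  have sgn: "0 \<le> (of_int \<epsilon> * (-1) ^ m) * ((-1) ^ m * S y ((N ^^ (2 * m)) y))" for y
    using L_N_last_semidefinite[of y] S_N_last_1[OF c, of y y] n
    by (simp add: mult.left_commute flip: mult.assoc power_add)
  note sig = signature_middle_ranges[OF dims _ _ _ _ iso sgn, of 0]
  show "of_int \<epsilon> = (-1 :: real) ^ m \<Longrightarrow> has_signature S (m + 1, 0, m)"
    using sig(1) rad dim_n n by (simp flip: power_add)
  show "of_int \<epsilon> = - ((-1 :: real) ^ m) \<Longrightarrow> has_signature S (m, 0, m + 1)"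
    using sig(2) rad dim_n n by (simp flip: power_add)
qed

lemma signature_one_block_minus_1:
  assumes c: "c = -1" and n: "n = 2 * m + 2"
  shows "of_int \<epsilon> = (-1 :: real) ^ m \<Longrightarrow> has_signature S (m + 1, 1, m)"
    and "of_int \<epsilon> = - ((-1 :: real) ^ m) \<Longrightarrow> has_signature S (m, 1, m + 1)"
proof -
  have dims: "dim (range (N ^^ m)) = m + 2" "dim (range (N ^^ (m + 1))) = m + 1"
    using dim_range_N_1 n by auto
  have rad: "dim (radical S) = 1" using radical_S_minus[OF c] dim_range_N_1(2) by simp
  have iso: "S y ((N ^^ (2 * (m + 1))) y) = 0" for y
    by (rule S_N_ge[OF c]) (simp add: n)
  have sgn: "0 \<le> (of_int \<epsilon> * (-1) ^ m) * ((-1) ^ m * S y ((N ^^ (2 * m)) y))" for y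
    using L_N_last_semidefinite[of y] S_N_second_last[OF c, of y y] n
    by (simp add: mult.left_commute flip: mult.assoc power_add)
  note sig = signature_middle_ranges[OF dims rad _ _ _ iso sgn]
  show "of_int \<epsilon> = (-1 :: real) ^ m \<Longrightarrow> has_signature S (m + 1, 1, m)"
    using sig(1) dim_n n by (simp flip: power_add Suc_eq_plus1)
  show "of_int \<epsilon> = - ((-1 :: real) ^ m) \<Longrightarrow> has_signature S (m, 1, m + 1)"
    using sig(2) dim_n n by (simp flip: power_add Suc_eq_plus1)
qed

lemma Tr_1_one_block:
  assumes c: "c = 1" and rad: "radical S = {0}" and n: "odd n"
  shows "Tr_1 1 n \<epsilon> M S"
proof -
  obtain x where x: "(N ^^ (n - 1)) x \<noteq> 0" using N_last_nz by blast
  obtain t where t: "t > 0" "L x ((N ^^ (n - 1)) x) = of_int \<epsilon> * t"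
    using L_sign[OF rf.not_range_of_last_nonzero[OF x]] by blast
  define r where "r = 1 / sqrt (2 * t)"
  define a where "a = r *\<^sub>R x"
  have "r * r * (2 * t) = 1" using t(1) by (simp add: r_def field_simps)
  moreover have "S a ((N ^^ (n - 1)) a) = r * r * (2 * t) * of_int \<epsilon>"
    using S_N_last_1[OF c, of a a] t(2) by (simp add: a_def rf.N_funpow_scale L_simps)
  ultimately have Sa: "S a ((N ^^ (n - 1)) a) = of_int \<epsilon>" by simp
  have ne: "(of_int \<epsilon> :: real) \<noteq> 0" using \<epsilon> by auto
  have "\<exists>b\<in>UNIV. \<forall>j<n. S b ((N ^^ j) b) = (if j = n - 1 then of_int \<epsilon> else 0)"
    by (rule rf.exists_hermitian_generator[of "\<lambda>x. x" "\<lambda>x. x" UNIV a])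
      (use Sa ne in \<open>auto simp: module.subspace_def[OF real_vector.module_axioms] intro: I_s_sym\<close>)
  then obtain b where b: "\<And>j. j < n \<Longrightarrow> S b ((N ^^ j) b) = (if j = n - 1 then of_int \<epsilon> else 0)"
    by blast
  note basis = rf.paired_chains_basis[of "[b]" "\<lambda>i. i" "\<lambda>_. of_int \<epsilon>"]
  have "is_basis_of (*\<^sub>R) (chain N n b) UNIV"
    using basis(2,3) b ne dim_n by simp
  then show ?thesis
    unfolding Tr_1_def using isometric_triple_S[OF rad] parts Ms_sign c
      real_vector.acts_by_chain[OF N_nilpotent] rf.gram_chain[OF b]
    by (intro conjI exI[of _ Ms] exI[of _ Mu] exI[of _ "chain N n b"]) (auto simp: acts_as_scalar_def)
qed

end

context
  assumes c: "c = (-1) ^ n" and dim_2n: "dim (UNIV :: 'v set) = 2 * n"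
    and N_last_nz: "\<exists>x. (N ^^ (n - 1)) x \<noteq> 0"
begin

text \<open>Moving \<open>M\<close> and \<open>N^(n-1)\<close> across \<open>L\<close> gives the signs \<open>(-1)^n\<close> and \<open>(-1)^(n-1)\<close>, whose product is \<open>-1\<close>.\<close>
lemma L_N_last_antisymmetric: "L y ((N ^^ (n - 1)) x) = - L x ((N ^^ (n - 1)) y)"
proof -
  let ?w = "(N ^^ (n - 1)) x"
  have "Y ?w = 0" using N_last_Y by (simp add: Y_N_funpow)
  then have "M ?w = c *\<^sub>R ?w" by (simp add: M_eq Ms_Mu Ms_sign Y_def linear_scale[OF linear_f])
  then have "L y ?w = c * L ?w y" using L_M[of ?w y] by (simp add: L_simps)
  also have "\<dots> = (-1) ^ n * ((-1) ^ (n - 1) * L x ((N ^^ (n - 1)) y))" by (simp add: c L_N_funpow)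
  also have "\<dots> = - L x ((N ^^ (n - 1)) y)"
    using n_pos by (cases n) (simp_all flip: mult.assoc power_add)
  finally show ?thesis .
qed

lemma exists_N_last_pair: "\<exists>x y. L x ((N ^^ (n - 1)) y) \<noteq> 0"
  using N_last_nz L_eq_0 L_N_funpow by (metis mult_zero_right)

text \<open>A nonzero alternating form needs two independent vectors \<open>N^(n-1) x\<close> and \<open>N^(n-1) y\<close>.\<close>
lemma dim_range_N_2: "k \<le> n \<Longrightarrow> dim (range (N ^^ k)) = 2 * (n - k)" "dim {x. N x = 0} = 2"
proof -
  obtain x y where xy: "L x ((N ^^ (n - 1)) y) \<noteq> 0" using exists_N_last_pair by blast
  have anti: "L z ((N ^^ (n - 1)) z) = 0" for z using L_N_last_antisymmetric[of z z] by simp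
  have "(N ^^ (n - 1)) x \<noteq> r *\<^sub>R (N ^^ (n - 1)) y" for r
  proof
    assume eq: "(N ^^ (n - 1)) x = r *\<^sub>R (N ^^ (n - 1)) y"
    have "r * L x ((N ^^ (n - 1)) y) = 0" using anti[of x] eq by (simp add: L_simps)
    then have "(N ^^ (n - 1)) x = 0" using eq xy by simp
    then show False using xy L_N_last_antisymmetric[of y x] by (simp add: L_simps)
  qed
  moreover have "(N ^^ (n - 1)) y \<noteq> 0" using xy by (auto simp: L_simps)
  ultimately have "2 \<le> dim (range (N ^^ (n - 1)))"
    using dim_range_last_2[of "(N ^^ (n - 1)) x" "(N ^^ (n - 1)) y"] by (auto simp: L_simps)
  then show "k \<le> n \<Longrightarrow> dim (range (N ^^ k)) = 2 * (n - k)" "dim {x. N x = 0} = 2"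
    using dim_range_N[of 2] dim_2n by auto
qed

lemma signature_two_blocks_even:
  "even n \<Longrightarrow> radical S = {0} \<Longrightarrow> has_signature S (n, 0, n)"
  by (rule signature_even[OF dim_range_N_2(1) dim_2n])

lemma signature_two_blocks_odd:
  assumes n: "odd n"
  shows "has_signature S (n - 1, 2, n - 1)"
proof -
  obtain m where m: "n = 2 * m + 1" using n oddE by blast
  have c': "c = -1" using c n by simp
  have iso: "S x x = 0" if "x \<in> range (N ^^ m)" for x
    using S_range_N[OF that] S_N_ge[OF c'] m by auto
  show ?thesis
    by (rule has_signature_of_semidefinite[OF bilinear_S I_s_sym subspace_range_N[of m] _ _ subspace_range_N[of m]])
      (use iso dim_range_N_2 m radical_S_minus[OF c'] dim_2n in auto)
qed

text \<open>
  After \<open>a\<close> has been made isotropic and \<open>b\<close> dual to \<open>a\<close>, the vector \<open>b\<close> is made isotropic by adding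
  multiples of \<open>N^k a\<close>; this preserves the duality because \<open>a\<close> is isotropic.
\<close>
lemma exists_isotropic_pair:
  assumes n: "even n"
  obtains a b where "\<And>j. j < n \<Longrightarrow> S a ((N ^^ j) a) = 0" "\<And>j. j < n \<Longrightarrow> S b ((N ^^ j) b) = 0"
    "\<And>j. j < n \<Longrightarrow> S a ((N ^^ j) b) = (if j = n - 1 then 1 else 0)"
proof -
  have c': "c = 1" using c n by simp
  obtain x y where xy: "S x ((N ^^ (n - 1)) y) \<noteq> 0"
    using exists_N_last_pair S_N_last_1[OF c'] by fastforce
  have two: "(2 :: real) \<noteq> 0" by simp
  have zero: "S ((N ^^ k) z) ((N ^^ (n - 1)) y) = 0" if "1 \<le> k" for k z y
    using that by (simp add: rf.F_N_funpow2 rf.N_funpow_ge S_simps)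
  obtain a where a: "S a ((N ^^ (n - 1)) y) = S x ((N ^^ (n - 1)) y)" "\<forall>j<n. S a ((N ^^ j) a) = 0"
    using rf.exists_isotropic_generator[OF I_s_sym two n, of "\<lambda>a. S a ((N ^^ (n - 1)) y) = S x ((N ^^ (n - 1)) y)" x y
        "S x ((N ^^ (n - 1)) y)"] xy zero by (auto simp: S_simps)
  obtain b0 where b0: "\<forall>j<n. S a ((N ^^ j) b0) = (if j = n - 1 then 1 else 0)"
    using rf.exists_dual_generator[of UNIV y a] a(1) xy by (auto simp: module.subspace_def[OF real_vector.module_axioms])
  let ?P = "\<lambda>b. \<forall>j<n. S a ((N ^^ j) b) = (if j = n - 1 then 1 else 0)"
  have P: "?P (b + r *\<^sub>R (N ^^ k) a)" if "?P b" for b r k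
  proof (intro allI impI)
    fix j assume j: "j < n"
    have "S a ((N ^^ (j + k)) a) = 0"
      using a(2) by (cases "j + k < n") (simp_all add: rf.N_funpow_ge S_simps)
    then show "S a ((N ^^ j) (b + r *\<^sub>R (N ^^ k) a)) = (if j = n - 1 then 1 else 0)"
      using that j by (simp add: rf.N_funpow_add rf.N_funpow_scale S_simps funpow_add)
  qed
  have Pu: "S b ((N ^^ (n - 1)) a) = -1" if "?P b" for b
  proof -
    have "S b ((N ^^ (n - 1)) a) = (-1) ^ (n - 1) * S a ((N ^^ (n - 1)) b)"
      using I_s_sym[of L b "(N ^^ (n - 1)) a"] by (simp add: rf.F_N_funpow)
    then show ?thesis using that n n_pos by simp
  qed
  obtain b where "?P b" "\<forall>j<n. S b ((N ^^ j) b) = 0"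
    using rf.exists_isotropic_generator[OF I_s_sym two n, of ?P b0 a "-1"] b0 P Pu by auto
  then show ?thesis using that[of a b] a(2) by blast
qed

end

end

end

context seifert_nilpotent
begin

section \<open>Eigenvalues on the unit circle\<close>

lemma NC_real: "(NC ^^ k) (x, 0) = ((N ^^ k) x, 0)"
  using linear_0[OF linear_funpow[OF linear_log]] by (simp add: cmap_funpow) (simp add: cmap_def)

lemma NC_cconj: "(NC ^^ k) (cconj v) = cconj ((NC ^^ k) v)"
  by (simp add: cconj_cmap_funpow[OF linear_log])

lemma F_cconj: "F (cconj v) (cconj w) = cnj (F v w)"
  by (rule cform_cconj[OF bilinear_S])

lemma F_sym: "F v w = F w v"
  by (rule cform_I_s_sym)

lemma F_swap: "F b ((NC ^^ k) a) = (-1) ^ k * F a ((NC ^^ k) b)"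
  using F_sym[of b "(NC ^^ k) a"] by (simp add: cf.F_N_funpow)

lemma F_eig_0: "a \<in> H \<alpha> \<Longrightarrow> b \<in> H \<beta> \<Longrightarrow> \<alpha> * \<beta> \<noteq> 1 \<Longrightarrow> F a ((NC ^^ k) b) = 0"
  by (rule cform_S_eig_orthogonal[OF _ N_pow_eig])

lemma NC_eig: "w \<in> H \<alpha> \<Longrightarrow> NC w \<in> H \<alpha>"
  using N_pow_eig[of w \<alpha> "Suc 0"] by simp

lemmas eig_cconj = eig_space_cconj[OF linear_Ms]

text \<open>
  Stable under inversion and conjugation of \<open>\<alpha>\<close>: if it holds for one eigenvalue of a type, it holds
  for all of them.
\<close>
definition paired :: "complex \<Rightarrow> bool" where
  "paired \<alpha> \<longleftrightarrow> \<alpha> \<noteq> 0 \<and> (\<exists>a\<in>H \<alpha>. \<exists>b\<in>H (inverse \<alpha>). F a ((NC ^^ (n - 1)) b) \<noteq> 0)"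

lemma paired_inverse:
  assumes "paired \<alpha>" shows "paired (inverse \<alpha>)"
proof -
  obtain a b where ab: "\<alpha> \<noteq> 0" "a \<in> H \<alpha>" "b \<in> H (inverse \<alpha>)" "F a ((NC ^^ (n - 1)) b) \<noteq> 0"
    using assms unfolding paired_def by blast
  have "F b ((NC ^^ (n - 1)) a) \<noteq> 0" using ab(4) F_swap[of b "n - 1" a] by simp
  then show ?thesis
    unfolding paired_def inverse_inverse_eq using ab(1-3) by auto
qed

lemma paired_cnj: "paired \<alpha> \<Longrightarrow> paired (cnj \<alpha>)"
proof -
  assume "paired \<alpha>"
  then obtain a b where ab: "\<alpha> \<noteq> 0" "a \<in> H \<alpha>" "b \<in> H (inverse \<alpha>)" "F a ((NC ^^ (n - 1)) b) \<noteq> 0"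
    by (auto simp: paired_def)
  have "cconj a \<in> H (cnj \<alpha>)" "cconj b \<in> H (inverse (cnj \<alpha>))"
    using eig_cconj ab(2,3) by (simp, metis complex_cnj_inverse)
  moreover have "F (cconj a) ((NC ^^ (n - 1)) (cconj b)) \<noteq> 0"
    using ab(4) by (simp add: NC_cconj F_cconj)
  ultimately show ?thesis using ab(1) unfolding paired_def by auto
qed

text \<open>
  Some \<open>N^(n-1) x\<close> has a partner under the nondegenerate form \<open>S\<close>; both vectors are then replaced by
  components in eigenspaces.
\<close>
lemma exists_paired:
  assumes rad: "radical S = {0}" and nz: "\<exists>x. (N ^^ (n - 1)) x \<noteq> 0"
  shows "\<exists>\<alpha>\<in>set \<alpha>s. paired \<alpha>"
proof -
  obtain x where x: "(N ^^ (n - 1)) x \<noteq> 0" using nz by blast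
  then have "(N ^^ (n - 1)) x \<notin> radical S" using rad by simp
  then obtain y where "S ((N ^^ (n - 1)) x) y \<noteq> 0" by (auto simp: radical_def)
  then have "S x ((N ^^ (n - 1)) y) \<noteq> 0" by (simp add: rf.F_N_funpow)
  then have "F (x, 0) ((NC ^^ (n - 1)) (y, 0)) \<noteq> 0" by (simp add: NC_real cform_real[OF bilinear_S])
  then obtain \<alpha> a where a: "\<alpha> \<in> set \<alpha>s" "a \<in> H \<alpha>" "F a ((NC ^^ (n - 1)) (y, 0)) \<noteq> 0"
    using eigenvector_witness'[of "\<lambda>v. F v ((NC ^^ (n - 1)) (y, 0))" "(x, 0)"]
    by (auto simp: cform_simps[OF bilinear_S])
  obtain \<beta> b where b: "b \<in> H \<beta>" "F a ((NC ^^ (n - 1)) b) \<noteq> 0"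
    using eigenvector_witness'[of "\<lambda>v. F a ((NC ^^ (n - 1)) v)" "(y, 0)"] a(3)
    by (auto simp: cform_simps[OF bilinear_S] cf.N_funpow_add)
  have "\<alpha> * \<beta> = 1" using F_eig_0[OF a(2) b(1)] b(2) by blast
  then have "\<alpha> \<noteq> 0" "\<beta> = inverse \<alpha>" using inverse_unique[of \<alpha> \<beta>] by auto
  then show ?thesis using a b unfolding paired_def by blast
qed

lemma paired_dual:
  assumes "paired \<alpha>"
  obtains a b where "a \<in> H \<alpha>" "b \<in> H (inverse \<alpha>)"
    "\<And>j. j < n \<Longrightarrow> F a ((NC ^^ j) b) = (if j = n - 1 then 1 else 0)"
    "\<And>j. j < n \<Longrightarrow> F b ((NC ^^ j) a) = (if j = n - 1 then (-1) ^ (n - 1) else 0)"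
proof -
  obtain a b where ab: "a \<in> H \<alpha>" "b \<in> H (inverse \<alpha>)" "F a ((NC ^^ (n - 1)) b) \<noteq> 0"
    using assms by (auto simp: paired_def)
  have "\<exists>b'\<in>H (inverse \<alpha>). \<forall>j<n. F a ((NC ^^ j) b') = (if j = n - 1 then 1 else 0)"
    by (rule cf.exists_dual_generator[OF subspace_eig_space[OF linear_Ms] _ ab(2,3)])
      (rule NC_eig)
  then obtain b' where "b' \<in> H (inverse \<alpha>)" "\<And>j. j < n \<Longrightarrow> F a ((NC ^^ j) b') = (if j = n - 1 then 1 else 0)"
    by blast
  then show ?thesis using that[of a b'] ab(1) F_swap[of b' _ a] by simp
qed

text \<open>
  The chains of \<open>a\<close> and of a dual \<open>b\<close> are independent. This bounds the size of the blocks on the unit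
  circle, where it is not prescribed.
\<close>
lemma paired_block_size:
  assumes "paired \<alpha>" "\<alpha> * \<alpha> \<noteq> 1"
  shows "2 * n \<le> dim (UNIV :: 'v set)"
proof -
  obtain a b where ab: "a \<in> H \<alpha>" "b \<in> H (inverse \<alpha>)"
    "\<And>j. j < n \<Longrightarrow> F a ((NC ^^ j) b) = (if j = n - 1 then 1 else 0)"
    "\<And>j. j < n \<Longrightarrow> F b ((NC ^^ j) a) = (if j = n - 1 then (-1) ^ (n - 1) else 0)"
    using paired_dual[OF assms(1)] by metis
  have ne: "\<alpha> \<noteq> 0" using assms(1) by (simp add: paired_def)
  have z: "F a ((NC ^^ j) a) = 0" "F b ((NC ^^ j) b) = 0" for j
    using F_eig_0[OF ab(1) ab(1)] F_eig_0[OF ab(2) ab(2)] assms(2)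
    by (simp_all flip: inverse_mult_distrib)
  have "length [a, b] * n \<le> card ((\<lambda>e. (e, 0 :: 'v)) ` some_basis)"
  proof (rule cf.paired_chains_le[of "[a, b]" "\<lambda>i. 1 - i" "\<lambda>i. if i = 0 then 1 else (-1) ^ (n - 1)"])
    fix i i' k assume "i < length [a, b]" "i' < length [a, b]" "k < n"
    then show "F ([a, b] ! i) ((NC ^^ k) ([a, b] ! i'))
        = (if i' = 1 - i \<and> k = n - 1 then if i = 0 then 1 else (-1) ^ (n - 1) else 0)"
      using ab(3,4) z by (auto simp: less_Suc_eq)
  qed (auto simp: inj_on_def less_Suc_eq)
  then show ?thesis unfolding card_complex_basis by simp
qed

lemma Tr_2_circle_of_generator:
  assumes lam: "norm lam = 1" and rad: "radical S = {0}" and dim: "dim (UNIV :: 'v set) = 2 * n"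
    and \<epsilon>: "\<epsilon> \<in> {1, -1}" and a: "a \<in> H lam"
    and iso: "\<And>j. j < n \<Longrightarrow> F a ((NC ^^ j) a) = 0"
    and pair: "\<And>j. j < n \<Longrightarrow> F a ((NC ^^ j) (cconj a)) = (if j = n - 1 then \<i> ^ (n + 1) * of_int \<epsilon> else 0)"
  shows "Tr_2_circle lam n 0 \<epsilon> M S"
proof -
  define u where "u = \<i> ^ (n + 1) * of_int \<epsilon>"
  have u: "u \<noteq> 0" "cnj u = u * (-1) ^ (n + 1)"
    using \<epsilon> by (auto simp: u_def power_mult_distrib[symmetric])
  have iso': "F (cconj a) ((NC ^^ j) (cconj a)) = 0" if "j < n" for j
    using iso[OF that] by (simp add: NC_cconj F_cconj)
  have pair': "F (cconj a) ((NC ^^ j) a) = (if j = n - 1 then u * (-1) ^ (n + 1) else 0)" if "j < n" for j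
  proof -
    have "F (cconj a) ((NC ^^ j) a) = cnj (F a ((NC ^^ j) (cconj a)))"
      using F_cconj[of a "(NC ^^ j) (cconj a)"] by (simp add: NC_cconj)
    then show ?thesis using pair[OF that] u(2) by (simp add: u_def)
  qed
  note basis = cf.paired_chains_basis[of "[a, cconj a]" "\<lambda>i. 1 - i" "\<lambda>i. if i = 0 then u else u * (-1) ^ (n + 1)"]
  have ds: "direct_sum (map (\<lambda>g. cv.span (set (chain NC n g))) [a, cconj a])"
    and bas: "is_basis_of cscale (chain NC n a) (cv.span (set (chain NC n a)))"
    by (rule basis(1,2); use iso iso' pair pair' u(1) card_complex_basis dim in
        \<open>force simp: less_Suc_eq inj_on_def u_def\<close>)+
  let ?H1 = "cv.span (set (chain NC n a))"
  have conj_chain: "map cconj (chain NC n a) = chain NC n (cconj a)"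
    by (rule map_chain) (simp add: NC_cconj)
  have conj_H1: "cconj ` ?H1 = cv.span (set (chain NC n (cconj a)))"
    unfolding cconj_image_span conj_chain[symmetric] by simp
  have sub: "cv.span (set (chain NC n g)) \<subseteq> H \<alpha>" if "g \<in> H \<alpha>" for g \<alpha>
    by (rule cf.span_chain_subset[OF subspace_eig_space[OF linear_Ms] _ that])
      (rule NC_eig)
  have sc: "acts_as_scalar cscale (cmap Ms) lam ?H1"
    "acts_as_scalar cscale (cmap Ms) (cnj lam) (cconj ` ?H1)"
    unfolding conj_H1 using sub[OF a] sub[OF eig_cconj[OF a]]
    by (auto simp: acts_as_scalar_def eig_space_def)
  have gr: "gram_blocks F [chain NC n a, chain NC n (cconj a)] =
     [[0\<^sub>m n n, u \<cdot>\<^sub>m E_per n], [(u * (-1) ^ (n + 1)) \<cdot>\<^sub>m E_per n, 0\<^sub>m n n]]"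
    using cf.gram_chain_0[OF iso] cf.gram_chain_0[OF iso'] cf.gram_chain[OF pair, folded u_def]
      cf.gram_chain[OF pair'] by (simp add: gram_blocks_def)
  show ?thesis
    unfolding Tr_2_circle_def Let_def
    using isometric_triple_S[OF rad] lam dim parts ds bas sc gr
      cv.acts_by_chain[OF cf.nilpotent]
    by (intro conjI exI[of _ Ms] exI[of _ Mu] exI[of _ ?H1] exI[of _ "chain NC n a"])
      (auto simp: conj_chain conj_H1 u_def)
qed

text \<open>
  For \<open>z = a + i t b\<close> the mixed terms of \<open>F z (N^j z)\<close> cancel by antisymmetry in the only relevant
  degree \<open>j = n - 1\<close>, which is odd. In the product with the conjugate they add up to \<open>-2 i t\<close>, and
  \<open>t\<close> is chosen to make this \<open>i^(n+1)\<close>.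
\<close>
lemma Tr_2_circle_of_isotropic_pair:
  assumes rad: "radical S = {0}" and dim: "dim (UNIV :: 'v set) = 2 * n" and n: "even n"
    and Ms: "\<And>x. Ms x = x"
    and a: "\<And>j. j < n \<Longrightarrow> S a ((N ^^ j) a) = 0" and b: "\<And>j. j < n \<Longrightarrow> S b ((N ^^ j) b) = 0"
    and ab: "\<And>j. j < n \<Longrightarrow> S a ((N ^^ j) b) = (if j = n - 1 then 1 else 0)"
  shows "Tr_2_circle 1 n 0 1 M S"
proof -
  define t :: real where "t = - ((-1) ^ (n div 2)) / 2"
  define z where "z = (a, t *\<^sub>R b)"
  have ba: "S b ((N ^^ j) a) = (-1) ^ j * S a ((N ^^ j) b)" for j
    using I_s_sym[of L b "(N ^^ j) a"] by (simp add: rf.F_N_funpow)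
  have ab': "S b ((N ^^ j) a) = - S a ((N ^^ j) b)" if "j < n" for j
    using ab[OF that] ba[of j] n n_pos by auto
  have "F z ((NC ^^ j) z) = 0" if j: "j < n" for j
    using a[OF j] b[OF j] ab'[OF j]
    by (simp add: z_def cmap_funpow) (simp add: cform_def cmap_def rf.N_funpow_scale S_simps complex_eq_iff)
  moreover have "F z ((NC ^^ j) (cconj z)) = (if j = n - 1 then \<i> ^ (n + 1) * of_int 1 else 0)" if j: "j < n" for j
  proof -
    have "\<i> ^ (n + 1) = \<i> * (\<i> ^ 2) ^ (n div 2)"
      unfolding power_mult[symmetric] dvd_mult_div_cancel[OF n] by (simp add: power_add)
    also have "\<dots> = Complex 0 ((-1) ^ (n div 2))" by (simp add: complex_eq_iff)
    finally have i: "\<i> ^ (n + 1) = Complex 0 (- 2 * t)" by (simp add: t_def)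
    have "F z ((NC ^^ j) (cconj z)) = Complex 0 (- 2 * t * S a ((N ^^ j) b))"
      using a[OF j] b[OF j] ab'[OF j] linear_neg[OF linear_funpow[OF linear_log]]
      by (simp add: z_def cconj_def cmap_funpow) (simp add: cform_def cmap_def rf.N_funpow_scale S_simps complex_eq_iff)
    then show ?thesis unfolding i using ab[OF j] by (simp add: complex_eq_iff)
  qed
  moreover have "z \<in> H 1" by (simp add: eig_space_def cmap_def Ms)
  ultimately show ?thesis using Tr_2_circle_of_generator[of 1 1 z] rad dim by simp
qed

context
  fixes lam :: complex and \<epsilon> :: int
  assumes \<alpha>s: "\<alpha>s = [lam, cnj lam]" and lam: "norm lam = 1" "lam \<notin> {1, -1}" and \<epsilon>: "\<epsilon> \<in> {1, -1}"
    and dim_2n: "dim (UNIV :: 'v set) = 2 * n"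
    and N_last_nz: "\<exists>x. (N ^^ (n - 1)) x \<noteq> 0"
    and L_sign: "\<And>a. a \<in> H lam \<Longrightarrow> a \<notin> range NC \<Longrightarrow>
      \<exists>t>0. cform L a ((NC ^^ (n - 1)) (cconj a))
        = (cnj lam + 1) / of_real (norm (lam + 1)) * \<i> ^ (n + 1) * of_int \<epsilon> * of_real t"
begin

lemma circle_lam: "lam * cnj lam = 1" "lam * lam \<noteq> 1" "cnj lam * cnj lam \<noteq> 1" "inverse lam = cnj lam"
  "Im lam \<noteq> 0" "norm (lam + 1) \<noteq> 0"
proof -
  show 1: "lam * cnj lam = 1" using lam(1) by (simp flip: complex_norm_square)
  show 2: "lam * lam \<noteq> 1" using lam(2) by (auto simp: square_eq_1_iff)
  show "cnj lam * cnj lam \<noteq> 1" using 2 by (metis complex_cnj_mult complex_cnj_one complex_cnj_cnj)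
  show "inverse lam = cnj lam" using 1 by (metis inverse_unique)
  show "Im lam \<noteq> 0"
  proof
    assume "Im lam = 0"
    then have "lam = cnj lam" by (simp add: complex_eq_iff)
    then show False using 1 2 by simp
  qed
  show "norm (lam + 1) \<noteq> 0" using lam(2) by (auto simp: add_eq_0_iff minus_equation_iff[of lam])
qed

lemma circle_radical: "radical S = {0}"
  by (rule radical_S_eq_0) (use lam \<alpha>s in \<open>auto simp: complex_eq_iff\<close>)

text \<open>The factor \<open>1 + lam\<close> between \<open>S\<close> and \<open>L\<close> cancels the argument of \<open>cnj lam + 1\<close> in the given unit number.\<close>
lemma F_circle_sign:
  assumes "a \<in> H lam" "a \<notin> range NC"
  shows "\<exists>t>0. F a ((NC ^^ (n - 1)) (cconj a)) = \<i> ^ (n + 1) * of_int \<epsilon> * of_real t"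
proof -
  obtain t where t: "t > 0" "cform L a ((NC ^^ (n - 1)) (cconj a))
        = (cnj lam + 1) / of_real (norm (lam + 1)) * \<i> ^ (n + 1) * of_int \<epsilon> * of_real t"
    using L_sign[OF assms] by blast
  have "(1 + lam) * (cnj lam + 1) = of_real (norm (lam + 1)) * of_real (norm (lam + 1))"
    using complex_norm_square[of "lam + 1"] by (simp add: power2_eq_square add.commute)
  then have "(1 + lam) * ((cnj lam + 1) / of_real (norm (lam + 1))) = of_real (norm (lam + 1))"
    using circle_lam(6) by simp
  then have "F a ((NC ^^ (n - 1)) (cconj a)) = of_real (norm (lam + 1)) * (\<i> ^ (n + 1) * of_int \<epsilon> * of_real t)"
    unfolding F_N_last[OF assms(1)] t(2) by (simp only: mult.assoc[symmetric])
  then show ?thesis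
    using t(1) circle_lam(6) by (intro exI[of _ "norm (lam + 1) * t"]) simp
qed

lemma exists_circle_generator:
  obtains a where "a \<in> H lam" "(NC ^^ (n - 1)) a \<noteq> 0"
proof -
  obtain \<alpha> where "\<alpha> \<in> {lam, cnj lam}" "paired \<alpha>"
    using exists_paired[OF circle_radical N_last_nz] \<alpha>s by auto
  then have "paired lam" using paired_cnj[of \<alpha>] by auto
  then obtain a b where "a \<in> H lam" "F a ((NC ^^ (n - 1)) b) \<noteq> 0" by (auto simp: paired_def)
  moreover from this have "(NC ^^ (n - 1)) a \<noteq> 0"
    using cf.F_N_funpow[of "n - 1" a b] by (auto simp: cform_simps[OF bilinear_S])
  ultimately show ?thesis using that by blast
qed

lemma Tr_2_circle_circle: "Tr_2_circle lam n 0 \<epsilon> M S"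
proof -
  define u where "u = \<i> ^ (n + 1) * (of_int \<epsilon> :: complex)"
  obtain x where x: "x \<in> H lam" "(NC ^^ (n - 1)) x \<noteq> 0" using exists_circle_generator by blast
  obtain t where t: "t > 0" "F x ((NC ^^ (n - 1)) (cconj x)) = u * of_real t"
    using F_circle_sign[OF x(1) cf.not_range_of_last_nonzero[OF x(2)]] unfolding u_def by blast
  define r where "r = 1 / sqrt t"
  have r: "r * r * t = 1" using t(1) by (simp add: r_def field_simps)
  define a where "a = cscale (of_real r) x"
  have aH: "a \<in> H lam" by (simp add: a_def eig_cscale x)
  have "F a ((NC ^^ (n - 1)) (cconj a)) = of_real (r * r * t) * u"
    using t(2) by (simp add: a_def cconj_cscale cf.N_funpow_scale cform_simps[OF bilinear_S])
  then have Fa: "F a ((NC ^^ (n - 1)) (cconj a)) = u" using r by simp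
  have "\<exists>b\<in>H lam. \<forall>j<n. F b ((NC ^^ j) (cconj b)) = (if j = n - 1 then u else 0)"
  proof (rule cf.exists_hermitian_generator[of cconj cnj "H lam" a])
    show "cconj (NC v) = NC (cconj v)" for v by (rule cconj_cmap[OF linear_log])
    show "v \<in> H lam \<Longrightarrow> NC v \<in> H lam" for v
      by (rule NC_eig)
    show "u \<noteq> 0" using \<epsilon> by (auto simp: u_def)
  qed (simp_all add: cconj_add cconj_cscale F_cconj F_sym subspace_eig_space[OF linear_Ms] aH Fa)
  then obtain b where b: "b \<in> H lam" "\<And>j. j < n \<Longrightarrow> F b ((NC ^^ j) (cconj b)) = (if j = n - 1 then u else 0)"
    by blast
  show ?thesis
    by (rule Tr_2_circle_of_generator[OF lam(1) circle_radical dim_2n \<epsilon> b(1) F_eig_0[OF b(1,1) circle_lam(2)]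
        b(2)[unfolded u_def]])
qed

lemma circle_real_part:
  obtains u where "u \<in> H lam" "(x, 0) = u + cconj u"
proof -
  obtain ws where ws: "list_all2 (\<in>) ws [H lam, H (cnj lam)]" "sum_list ws = (x, 0)"
    using decomp unfolding direct_sum_def \<alpha>s by auto blast
  then obtain v w where vw: "v \<in> H lam" "w \<in> H (cnj lam)" "v + w = (x, 0)"
    by (auto simp: list_all2_Cons2)
  define u where "u = cscale (1 / 2) (v + cconj w)"
  have "cconj w \<in> H lam" using eig_cconj[OF vw(2)] by simp
  then have "u \<in> H lam" by (simp add: u_def eig_cscale eig_add vw)
  moreover have "(x, 0) = u + cconj u"
  proof -
    have "u + cconj u = cscale (1 / 2) ((v + w) + cconj (v + w))"
      by (simp add: u_def cconj_add cconj_cscale cv.scale_right_distrib)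
    then show ?thesis unfolding vw(3) by (simp add: cconj_def cscale_def flip: scaleR_add_left)
  qed
  ultimately show ?thesis using that by blast
qed

text \<open>The range of \<open>N^(n-1)\<close> is a nonzero real subspace stable under \<open>Ms\<close>, which has no real eigenvalue.\<close>
lemma dim_range_N_circle: "k \<le> n \<Longrightarrow> dim (range (N ^^ k)) = 2 * (n - k)"
proof -
  obtain x where x: "(N ^^ (n - 1)) x \<noteq> 0" using N_last_nz by blast
  define r where "r = (N ^^ (n - 1)) x"
  have "(N ^^ k) (Ms x) = Ms ((N ^^ k) x)" for k by (induction k) (simp_all add: Ms_N)
  then have Mr: "Ms r \<in> range (N ^^ (n - 1))" unfolding r_def by (metis rangeI)
  have "Ms r \<noteq> c *\<^sub>R r" for c
  proof
    assume eq: "Ms r = c *\<^sub>R r"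
    define g where "g v = cmap Ms v - cscale (of_real c) v" for v
    have "g (r, 0) = 0" using eq linear_0[OF linear_Ms] by (simp add: g_def cmap_def cscale_def zero_prod_def)
    moreover have "g (v + w) = g v + g w" for v w
      by (simp add: g_def cmap_def cscale_def linear_add[OF linear_Ms] prod_eq_iff algebra_simps)
    moreover have "g w \<in> H \<alpha>" if "w \<in> H \<alpha>" for w \<alpha>
      unfolding g_def using that cmap_commute_eig_space[OF linear_Ms refl that]
      by (simp add: cv.subspace_diff[OF subspace_eig_space[OF linear_Ms]] eig_cscale)
    ultimately obtain \<alpha> w where w: "\<alpha> \<in> {lam, cnj lam}" "w \<in> H \<alpha>" "g w = 0" "w \<noteq> 0"
      using eigenvector_witness[of g "(r, 0)" "\<lambda>v. v"] x \<alpha>s by (auto simp: r_def zero_prod_def)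
    have "cscale (\<alpha> - of_real c) w = 0"
      using w(2,3) by (simp add: g_def eig_space_def cv.scale_left_diff_distrib)
    then have "\<alpha> = of_real c" using w(4) by simp
    then show False using w(1) circle_lam(5) by (auto simp: complex_eq_iff)
  qed
  then have "2 \<le> dim (range (N ^^ (n - 1)))"
    using dim_range_last_2[of "Ms r" r] Mr x by (auto simp: r_def)
  then show "k \<le> n \<Longrightarrow> dim (range (N ^^ k)) = 2 * (n - k)"
    using dim_range_N[of 2] dim_2n by auto
qed

lemma signature_circle_even: "even n \<Longrightarrow> has_signature S (n, 0, n)"
  by (rule signature_even[OF dim_range_N_circle dim_2n _ circle_radical])

text \<open>
  With \<open>x = u + cconj u\<close>, isotropy of the two eigenspaces leaves twice the real part of
  \<open>F u (N^(n-1) (cconj u))\<close>.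
\<close>
lemma S_N_last_circle:
  assumes n: "n = 2 * m + 1"
  shows "0 \<le> - (of_int \<epsilon> * ((-1) ^ m * S x ((N ^^ (n - 1)) x)))"
proof -
  obtain u where u: "u \<in> H lam" "(x, 0) = u + cconj u" using circle_real_part by blast
  have "of_real (S x ((N ^^ (n - 1)) x)) = F (u + cconj u) ((NC ^^ (n - 1)) (u + cconj u))"
    unfolding u(2)[symmetric] by (simp add: NC_real cform_real[OF bilinear_S])
  also have "\<dots> = F u ((NC ^^ (n - 1)) (cconj u)) + cnj (F u ((NC ^^ (n - 1)) (cconj u)))"
    using F_eig_0[OF u(1) u(1) circle_lam(2)] F_eig_0[OF eig_cconj[OF u(1)] eig_cconj[OF u(1)] circle_lam(3)]
      F_cconj[of u "(NC ^^ (n - 1)) (cconj u)"]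
    by (simp add: cf.N_funpow_add cform_simps[OF bilinear_S] NC_cconj)
  finally have S: "S x ((N ^^ (n - 1)) x) = 2 * Re (F u ((NC ^^ (n - 1)) (cconj u)))"
    by (metis Re_complex_of_real complex_add_cnj)
  show ?thesis
  proof (cases "u \<in> range NC")
    case True
    then obtain w where w: "u = NC w" by blast
    have "F u ((NC ^^ (n - 1)) (cconj u)) = - F w ((NC ^^ Suc (n - 1)) (cconj u))"
      by (simp add: w cf.F_N)
    then have "F u ((NC ^^ (n - 1)) (cconj u)) = 0"
      using n_pos by (simp add: cf.nilpotent cform_simps[OF bilinear_S])
    then show ?thesis using S by simp
  next
    case False
    then obtain t where t: "t > 0" "F u ((NC ^^ (n - 1)) (cconj u)) = \<i> ^ (n + 1) * of_int \<epsilon> * of_real t"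
      using F_circle_sign[OF u(1)] by blast
    have "\<i> ^ (n + 1) = (\<i> ^ 2) ^ (m + 1)" unfolding power_mult[symmetric] n by (simp add: algebra_simps)
    also have "\<dots> = of_real (- ((-1) ^ m))" by (simp add: power_add)
    finally have "F u ((NC ^^ (n - 1)) (cconj u)) = of_real (- ((-1) ^ m) * of_int \<epsilon> * t)"
      using t(2) by simp
    then have "S x ((N ^^ (n - 1)) x) = 2 * (- ((-1) ^ m) * of_int \<epsilon> * t)"
      unfolding S by (simp only: Re_complex_of_real)
    then have "- (of_int \<epsilon> * ((-1) ^ m * S x ((N ^^ (n - 1)) x)))
        = 2 * (((-1) ^ m * (-1) ^ m) * (of_int \<epsilon> * of_int \<epsilon>) * t)"
      by (simp only: mult_minus_left mult_minus_right minus_minus mult_ac)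
    also have "(-1 :: real) ^ m * (-1) ^ m = 1" by (simp flip: power_add)
    also have "of_int \<epsilon> * of_int \<epsilon> = (1 :: real)" using \<epsilon> by auto
    finally show ?thesis using t(1) by simp
  qed
qed

lemma signature_circle_odd:
  assumes "odd n"
  shows "\<epsilon> = 1 \<Longrightarrow> has_signature S (n - 1, 0, n + 1)" and "\<epsilon> = -1 \<Longrightarrow> has_signature S (n + 1, 0, n - 1)"
proof -
  obtain m where n: "n = 2 * m + 1" using assms oddE by blast
  have dims: "dim (range (N ^^ m)) = n + 1" "dim (range (N ^^ (m + 1))) = n - 1"
    using dim_range_N_circle[of m] dim_range_N_circle[of "m + 1"] n by (simp_all del: funpow.simps)
  have iso: "S y ((N ^^ (2 * (m + 1))) y) = 0" for y
  proof -
    have "(N ^^ (2 * (m + 1))) y = 0" by (rule rf.N_funpow_ge) (simp add: n)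
    then show ?thesis by (simp only: S_simps)
  qed
  have sgn: "0 \<le> - of_int \<epsilon> * ((-1) ^ m * S y ((N ^^ (2 * m)) y))" for y
    using S_N_last_circle[OF n, of y] n by simp
  note sig = signature_middle_ranges[OF dims _ _ _ _ iso sgn, of 0]
  show "\<epsilon> = 1 \<Longrightarrow> has_signature S (n - 1, 0, n + 1)" "\<epsilon> = -1 \<Longrightarrow> has_signature S (n + 1, 0, n - 1)"
    using sig circle_radical dim_2n n_pos by simp_all
qed

end

end

section \<open>Eigenvalues off the unit circle\<close>

lemma one_smult_mat: "1 \<cdot>\<^sub>m A = (A :: 'a::monoid_mult mat)"
  by (rule eq_matI) simp_all

lemma (in seifert_jordan) eig_induct:
  assumes "P 0" "\<And>v w. P v \<Longrightarrow> P w \<Longrightarrow> P (v + w)" "\<And>\<alpha> w. \<alpha> \<in> set \<alpha>s \<Longrightarrow> w \<in> H \<alpha> \<Longrightarrow> P w"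
  shows "P v"
proof -
  obtain ws where ws: "list_all2 (\<in>) ws (map H \<alpha>s)" "sum_list ws = v"
    using decomp unfolding direct_sum_def by blast
  have "P w" if w: "w \<in> set ws" for w
  proof -
    obtain \<alpha> where "\<alpha> \<in> set \<alpha>s" "w \<in> H \<alpha>" using list_all2_ex_right[OF ws(1) w] by auto
    then show ?thesis by (rule assms(3))
  qed
  then have "P (sum_list ws)" by (induction ws) (simp_all add: assms(1,2))
  then show ?thesis using ws(2) by simp
qed

context seifert_nilpotent
begin

lemma subspace_Re_eig: "subspace (fst ` H \<alpha>)"
proof -
  have "c *\<^sub>R fst v \<in> fst ` H \<alpha>" if "v \<in> H \<alpha>" for c v
    by (rule image_eqI[OF _ eig_cscale[OF that, of "of_real c"]]) (simp add: cscale_def)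
  moreover have "fst v + fst w \<in> fst ` H \<alpha>" if "v \<in> H \<alpha>" "w \<in> H \<alpha>" for v w
    by (rule image_eqI[OF _ eig_add[OF that]]) simp
  moreover have "0 \<in> fst ` H \<alpha>"
    by (rule image_eqI[OF _ eig_0]) simp
  ultimately show ?thesis by (auto simp: real_vector.subspace_def)
qed

text \<open>Twice the real part of \<open>v\<close> is \<open>v + cconj v\<close>, a sum of two orthogonal isotropic vectors.\<close>
lemma Re_eig_isotropic:
  assumes "\<alpha> * \<alpha> \<noteq> 1" "\<alpha> * cnj \<alpha> \<noteq> 1" "x \<in> fst ` H \<alpha>"
  shows "S x x = 0"
proof -
  obtain v where v: "v \<in> H \<alpha>" "x = fst v" using assms(3) by blast
  have cv: "cconj v \<in> H (cnj \<alpha>)" by (rule eig_cconj[OF v(1)])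
  have "cnj \<alpha> * cnj \<alpha> \<noteq> 1" using assms(1) by (metis complex_cnj_mult complex_cnj_one complex_cnj_cnj)
  then have "F (v + cconj v) (v + cconj v) = 0"
    using cform_S_eig_orthogonal[OF v(1,1)] cform_S_eig_orthogonal[OF v(1) cv]
      cform_S_eig_orthogonal[OF cv v(1)] cform_S_eig_orthogonal[OF cv cv] assms(1,2)
    by (simp add: cform_simps[OF bilinear_S] mult.commute)
  moreover have "v + cconj v = (x + x, 0)" by (simp add: v(2) cconj_def prod_eq_iff)
  ultimately have "S (x + x) (x + x) = 0" by (simp add: cform_real[OF bilinear_S])
  then show ?thesis by (simp add: S_simps)
qed

text \<open>Conjugate eigenspaces have the same real parts, so two isotropic subspaces suffice.\<close>
lemma signature_hyperbolic:
  assumes \<alpha>s: "set \<alpha>s \<subseteq> {\<alpha>, inverse \<alpha>, cnj \<alpha>, inverse (cnj \<alpha>)}"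
    and \<alpha>: "norm \<alpha> > 1" and rad: "radical S = {0}" and dim: "dim (UNIV :: 'v set) = 2 * m"
  shows "has_signature S (m, 0, m)"
proof -
  have norm: "norm (\<alpha> * \<alpha>) > 1" "norm (\<alpha> * cnj \<alpha>) > 1"
    using \<alpha> by (simp_all add: norm_mult less_1_mult)
  have ne: "\<alpha> * \<alpha> \<noteq> 1" "\<alpha> * cnj \<alpha> \<noteq> 1" using norm by auto
  then have ne': "inverse \<alpha> * inverse \<alpha> \<noteq> 1" "inverse \<alpha> * cnj (inverse \<alpha>) \<noteq> 1"
    by (simp_all flip: inverse_mult_distrib)
  let ?A = "fst ` H \<alpha>" and ?B = "fst ` H (inverse \<alpha>)"
  note subA = subspace_Re_eig[of \<alpha>] and subB = subspace_Re_eig[of "inverse \<alpha>"]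
  have fst_cconj: "fst w \<in> fst ` H \<beta>" if "w \<in> H (cnj \<beta>)" for w \<beta>
    by (rule image_eqI[OF _ eig_cconj[OF that, simplified]]) (simp add: cconj_def)
  have sum: "\<exists>x\<in>?A. \<exists>y\<in>?B. fst v = x + y" for v :: "'v \<times> 'v"
  proof (induction v rule: eig_induct)
    case 1
    then show ?case using real_vector.subspace_0[OF subA] real_vector.subspace_0[OF subB] by force
  next
    case (2 v w)
    then obtain x y x' y' where "x \<in> ?A" "x' \<in> ?A" "y \<in> ?B" "y' \<in> ?B" "fst v = x + y" "fst w = x' + y'"
      by blast
    then show ?case using real_vector.subspace_add[OF subA] real_vector.subspace_add[OF subB]
      by (intro bexI[of _ "x + x'"] bexI[of _ "y + y'"]) auto
  next
    case (3 \<beta> w)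
    then have "fst w \<in> ?A \<or> fst w \<in> ?B"
      using \<alpha>s fst_cconj[of w \<alpha>] fst_cconj[of w "inverse \<alpha>"] by auto
    then show ?case using real_vector.subspace_0[OF subA] real_vector.subspace_0[OF subB]
      by (metis add.left_neutral add.right_neutral)
  qed
  show ?thesis
  proof (rule has_signature_of_isotropic_sum[OF bilinear_S I_s_sym rad subA _ subB _ _ dim])
    show "\<exists>x\<in>?A. \<exists>y\<in>?B. v = x + y" for v using sum[of "(v, 0)"] by simp
  qed (use Re_eig_isotropic ne ne' in blast)+
qed

lemma Tr_2_real_hyperbolic:
  fixes lam :: real
  assumes lam: "lam > 1 \<or> lam < -1" and paired: "paired (of_real lam)"
    and rad: "radical S = {0}" and dim: "dim (UNIV :: 'v set) = 2 * n"
  shows "Tr_2_real lam n 0 M S"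
proof -
  let ?E = "\<lambda>c. {x. Ms x = c *\<^sub>R x}"
  have subE: "subspace (?E c)" for c
    by (auto simp: real_vector.subspace_def linear_0[OF linear_Ms] linear_add[OF linear_Ms]
        linear_scale[OF linear_Ms] algebra_simps)
  have NE: "N x \<in> ?E c" if "x \<in> ?E c" for x c
    using that by (simp add: Ms_N linear_scale[OF linear_log])
  have ne: "lam * lam \<noteq> 1" using lam by (auto simp: square_eq_1_iff)
  have iso: "S x ((N ^^ k) x) = 0" if x: "x \<in> ?E c" and c: "c * c \<noteq> 1" for x c k
  proof -
    have xe: "(x, 0) \<in> H (of_real c)" using x by (simp add: real_in_eig_space[OF linear_Ms])
    have "(of_real c * of_real c :: complex) \<noteq> 1" using c by (metis of_real_1 of_real_eq_iff of_real_mult)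
    then have "F (x, 0) ((NC ^^ k) (x, 0)) = 0" by (rule F_eig_0[OF xe xe])
    then show ?thesis by (simp add: NC_real cform_real[OF bilinear_S])
  qed
  obtain v w where vw: "v \<in> H (of_real lam)" "w \<in> H (of_real (inverse lam))" "F v ((NC ^^ (n - 1)) w) \<noteq> 0"
    using paired by (auto simp: paired_def)
  have "\<exists>a\<in>{fst v, snd v}. \<exists>b\<in>{fst w, snd w}. S a ((N ^^ (n - 1)) b) \<noteq> 0"
  proof (rule ccontr)
    assume "\<not> ?thesis"
    then have "F v ((NC ^^ (n - 1)) w) = 0" unfolding cmap_funpow by (simp add: cform_def cmap_def complex_eq_iff)
    then show False using vw(3) by simp
  qed
  then obtain a b where ab: "a \<in> {fst v, snd v}" "b \<in> {fst w, snd w}" "S a ((N ^^ (n - 1)) b) \<noteq> 0"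
    by blast
  have a: "a \<in> ?E lam" and b: "b \<in> ?E (inverse lam)"
    using ab(1,2) real_parts_in_eig_space[OF vw(1)] real_parts_in_eig_space[OF vw(2)] by auto
  have "\<exists>b'\<in>?E (inverse lam). \<forall>j<n. S a ((N ^^ j) b') = (if j = n - 1 then 1 else 0)"
    by (rule rf.exists_dual_generator[OF _ _ b ab(3)]) (use subE NE in \<open>auto simp: subspace_raw_def\<close>)
  then obtain b' where b': "b' \<in> ?E (inverse lam)"
    "\<And>j. j < n \<Longrightarrow> S a ((N ^^ j) b') = (if j = n - 1 then 1 else 0)" by blast
  have ba: "S b' ((N ^^ j) a) = (if j = n - 1 then (-1) ^ (n - 1) else 0)" if "j < n" for j
    using I_s_sym[of L b' "(N ^^ j) a"] b'(2)[OF that] by (simp add: rf.F_N_funpow)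
  have isoa: "S a ((N ^^ j) a) = 0" for j by (rule iso[OF a ne])
  have isob: "S b' ((N ^^ j) b') = 0" for j
    by (rule iso[OF b'(1)]) (use ne in \<open>simp flip: inverse_mult_distrib\<close>)
  define gs where "gs = [a, b']"
  define c :: "nat \<Rightarrow> real" where "c i = [1, (-1) ^ (n - 1)] ! i" for i
  define \<pi> :: "nat \<Rightarrow> nat" where "\<pi> i = [1, 0] ! i" for i
  note nths = gs_def c_def \<pi>_def less_Suc_eq
  have hyp: "S (gs ! i) ((N ^^ k) (gs ! i')) = (if i' = \<pi> i \<and> k = n - 1 then c i else 0)"
    if "i < length gs" "i' < length gs" "k < n" for i i' k
    using that b'(2) ba isoa isob by (auto simp: nths)
  have c: "c i \<noteq> 0" if "i < length gs" for i using that by (auto simp: nths)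
  have \<pi>: "\<pi> i < length gs" if "i < length gs" for i using that by (auto simp: nths)
  have inj: "inj_on \<pi> {..<length gs}" by (auto simp: nths inj_on_def)
  have card: "card some_basis = length gs * n"
    using dim by (simp add: gs_def)
  note basis = rf.paired_chains_basis[OF hyp c \<pi> inj card, folded span_raw_def]
  have ds: "direct_sum [span (set (chain N n a)), span (set (chain N n b'))]"
    using basis(1) by (simp add: gs_def)
  have bas: "is_basis_of (*\<^sub>R) (chain N n a) (span (set (chain N n a)))"
      "is_basis_of (*\<^sub>R) (chain N n b') (span (set (chain N n b')))"
    using basis(2) by (simp_all add: gs_def)
  have sub: "span (set (chain N n g)) \<subseteq> ?E c" if "g \<in> ?E c" for g c
    by (rule rf.span_chain_subset[folded span_raw_def subspace_raw_def, OF subE NE that])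
  have sgn: "(-1) ^ (n - 1) = (-1 :: real) ^ (n + 1)" using n_pos by (cases n) (auto simp: power_add)
  have gr: "gram_blocks S [chain N n a, chain N n b'] =
     [[0\<^sub>m n n, E_per n], [(-1) ^ (n + 0 + 1) \<cdot>\<^sub>m E_per n, 0\<^sub>m n n]]"
    using rf.gram_chain_0[OF isoa] rf.gram_chain_0[OF isob] rf.gram_chain[OF b'(2)] rf.gram_chain[OF ba]
    by (simp add: gram_blocks_def sgn one_smult_mat)
  have sc: "acts_as_scalar (*\<^sub>R) Ms lam (span (set (chain N n a)))"
    "acts_as_scalar (*\<^sub>R) Ms (inverse lam) (span (set (chain N n b')))"
    using sub[OF a] sub[OF b'(1)] by (auto simp only: acts_as_scalar_def)
  show ?thesis
    unfolding Tr_2_real_def Let_def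
    by (intro conjI exI[of _ Ms] exI[of _ Mu] exI[of _ "span (set (chain N n a))"]
        exI[of _ "span (set (chain N n b'))"] exI[of _ "chain N n a"] exI[of _ "chain N n b'"])
      (rule isometric_triple_S[OF rad] lam parts ds length_chain bas sc gr
        real_vector.acts_by_chain[OF N_nilpotent])+
qed

lemma Tr_4_hyperbolic:
  assumes lam: "norm lam > 1" "Im lam > 0" and paired: "paired lam"
    and rad: "radical S = {0}" and dim: "dim (UNIV :: 'v set) = 4 * n"
  shows "Tr_4 lam n 0 M S"
proof -
  have norm: "norm (lam * lam) > 1" "norm (lam * cnj lam) > 1"
    using lam(1) by (simp_all add: norm_mult less_1_mult)
  have lam0: "lam \<noteq> 0" using lam(1) by auto
  have n1: "lam * lam \<noteq> 1" and n2: "lam * cnj lam \<noteq> 1" using norm by auto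
  have n3: "lam \<noteq> cnj lam" using lam(2) by (simp add: complex_eq_iff)
  obtain a b where a: "a \<in> H lam" and b: "b \<in> H (inverse lam)"
    and ab: "\<And>j. j < n \<Longrightarrow> F a ((NC ^^ j) b) = (if j = n - 1 then 1 else 0)"
    and ba: "\<And>j. j < n \<Longrightarrow> F b ((NC ^^ j) a) = (if j = n - 1 then (-1) ^ (n - 1) else 0)"
    using paired_dual[OF paired] by metis
  define a' b' where "a' = cconj a" and "b' = cconj b"
  have a': "a' \<in> H (cnj lam)" and b': "b' \<in> H (inverse (cnj lam))"
    using eig_cconj[OF a] eig_cconj[OF b] by (simp_all add: a'_def b'_def)
  have ab': "F a' ((NC ^^ j) b') = (if j = n - 1 then 1 else 0)" if "j < n" for j
    using ab[OF that] by (simp add: a'_def b'_def NC_cconj F_cconj)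
  have ba': "F b' ((NC ^^ j) a') = (if j = n - 1 then (-1) ^ (n - 1) else 0)" if "j < n" for j
    using ba[OF that] by (simp add: a'_def b'_def NC_cconj F_cconj)
  have inv: "inverse x * inverse y \<noteq> 1" if "x * y \<noteq> 1" for x y :: complex
    using that by (metis inverse_1 inverse_inverse_eq inverse_mult_distrib)
  have quot: "x * inverse y \<noteq> 1" "inverse y * x \<noteq> 1" if "x \<noteq> y" "y \<noteq> 0" for x y :: complex
    using that by (simp_all add: mult.commute[of _ x] flip: divide_inverse)
  have n1': "cnj lam * cnj lam \<noteq> 1" using n1 by (metis complex_cnj_cnj complex_cnj_mult complex_cnj_one)
  have n2': "cnj lam * lam \<noteq> 1" using n2 by (simp add: mult.commute)
  have lam0': "cnj lam \<noteq> 0" using lam0 by simp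
  note zero = F_eig_0[OF a a n1] F_eig_0[OF a a' n2] F_eig_0[OF a b' quot(1)[OF n3 lam0']]
    F_eig_0[OF b b inv[OF n1]] F_eig_0[OF b a' quot(2)[OF n3[symmetric] lam0]] F_eig_0[OF b b' inv[OF n2]]
    F_eig_0[OF a' a n2'] F_eig_0[OF a' b quot(1)[OF n3[symmetric] lam0]] F_eig_0[OF a' a' n1']
    F_eig_0[OF b' a quot(2)[OF n3 lam0']] F_eig_0[OF b' b inv[OF n2']] F_eig_0[OF b' b' inv[OF n1']]
  define gs where "gs = [a, b, a', b']"
  define c :: "nat \<Rightarrow> complex" where "c i = [1, (-1) ^ (n - 1), 1, (-1) ^ (n - 1)] ! i" for i
  define \<pi> :: "nat \<Rightarrow> nat" where "\<pi> i = [1, 0, 3, 2] ! i" for i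
  note nths = gs_def c_def \<pi>_def less_Suc_eq numeral_eq_Suc
  have hyp: "F (gs ! i) ((NC ^^ k) (gs ! i')) = (if i' = \<pi> i \<and> k = n - 1 then c i else 0)"
    if "i < length gs" "i' < length gs" "k < n" for i i' k
    using that zero ab ba ab' ba' by (auto simp: nths)
  have c: "c i \<noteq> 0" if "i < length gs" for i using that by (auto simp: nths)
  have \<pi>: "\<pi> i < length gs" if "i < length gs" for i using that by (auto simp: nths)
  have inj: "inj_on \<pi> {..<length gs}" by (auto simp: nths inj_on_def)
  have card: "card ((\<lambda>e. (e, 0 :: 'v)) ` some_basis) = length gs * n"
    unfolding card_complex_basis dim by (simp add: gs_def)
  note basis = cf.paired_chains_basis[OF hyp c \<pi> inj card]
  let ?H1 = "cv.span (set (chain NC n a))" and ?H2 = "cv.span (set (chain NC n b))"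
  have conj_chain: "map cconj (chain NC n g) = chain NC n (cconj g)" for g
    by (rule map_chain) (simp add: NC_cconj)
  have conj_H: "cconj ` cv.span (set (chain NC n g)) = cv.span (set (chain NC n (cconj g)))" for g
    unfolding cconj_image_span conj_chain[symmetric] by simp
  have ds: "direct_sum [?H1, ?H2, cconj ` ?H1, cconj ` ?H2]"
    using basis(1) by (simp add: gs_def conj_H a'_def b'_def)
  have bas: "is_basis_of cscale (chain NC n a) ?H1" "is_basis_of cscale (chain NC n b) ?H2"
    using basis(2) by (simp_all add: gs_def)
  have sub: "cv.span (set (chain NC n g)) \<subseteq> H \<alpha>" if "g \<in> H \<alpha>" for g \<alpha>
    by (rule cf.span_chain_subset[OF subspace_eig_space[OF linear_Ms] _ that]) (rule NC_eig)
  have sc: "acts_as_scalar cscale (cmap Ms) lam ?H1" "acts_as_scalar cscale (cmap Ms) (inverse lam) ?H2"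
    "acts_as_scalar cscale (cmap Ms) (cnj lam) (cconj ` ?H1)"
    "acts_as_scalar cscale (cmap Ms) (inverse (cnj lam)) (cconj ` ?H2)"
    unfolding conj_H using sub[OF a] sub[OF b] sub[OF a'] sub[OF b']
    by (auto simp: acts_as_scalar_def eig_space_def a'_def b'_def)
  have sgn: "(-1) ^ (n - 1) = (-1 :: complex) ^ (n + 1)" using n_pos by (cases n) (auto simp: power_add)
  note Z = zero[THEN cf.gram_chain_0]
  have gr: "gram_blocks F [chain NC n a, chain NC n b, map cconj (chain NC n a), map cconj (chain NC n b)] =
     [[0\<^sub>m n n, E_per n, 0\<^sub>m n n, 0\<^sub>m n n],
      [(-1) ^ (n + 0 + 1) \<cdot>\<^sub>m E_per n, 0\<^sub>m n n, 0\<^sub>m n n, 0\<^sub>m n n],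
      [0\<^sub>m n n, 0\<^sub>m n n, 0\<^sub>m n n, E_per n],
      [0\<^sub>m n n, 0\<^sub>m n n, (-1) ^ (n + 0 + 1) \<cdot>\<^sub>m E_per n, 0\<^sub>m n n]]"
    unfolding conj_chain a'_def[symmetric] b'_def[symmetric]
    using cf.gram_chain[OF ab] cf.gram_chain[OF ba] cf.gram_chain[OF ab'] cf.gram_chain[OF ba']
    by (simp add: gram_blocks_def Z sgn one_smult_mat)
  note act = cv.acts_by_chain[OF cf.nilpotent]
  have act': "acts_by cscale NC (map cconj (chain NC n g)) (J_mat n)" for g
    unfolding conj_chain by (rule act)
  show ?thesis
    unfolding Tr_4_def Let_def
    by (intro conjI exI[of _ Ms] exI[of _ Mu] exI[of _ ?H1] exI[of _ ?H2]
        exI[of _ "chain NC n a"] exI[of _ "chain NC n b"])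
      (rule isometric_triple_S[OF rad] parts ds length_chain bas sc act act' gr)+
qed

end

section \<open>The irreducible types\<close>

lemma direct_sum_UNIV: "direct_sum [UNIV]"
  unfolding direct_sum_def
proof
  fix v :: 'a
  show "\<exists>!ws. list_all2 (\<in>) ws [UNIV] \<and> sum_list ws = v"
    by (rule ex1I[of _ "[v]"]) (auto simp: list_all2_Cons2)
qed

lemma (in seifert_jordan) seifert_nilpotent_of_blocks:
  assumes "has_jordan_blocks M bs" "\<And>b. b \<in> set bs \<Longrightarrow> fst b \<le> n" "n \<ge> 1"
  shows "seifert_nilpotent L M Ms Mu \<alpha>s n"
  using nilpotent_of_block_sizes[OF assms(1,2)] assms(3) by unfold_locales

lemma (in seifert_jordan) seifert_nilpotent_of_equal_blocks:
  assumes "has_jordan_blocks M bs" "set (map fst bs) = {n}" "n \<ge> 1"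
  shows "seifert_nilpotent L M Ms Mu \<alpha>s n" and "\<exists>x. (N ^^ (n - 1)) x \<noteq> 0"
proof -
  have b: "fst b = n" if "b \<in> set bs" for b using assms(2) that by auto
  show "seifert_nilpotent L M Ms Mu \<alpha>s n"
    by (rule seifert_nilpotent_of_blocks[OF assms(1) _ assms(3)]) (simp add: b)
  obtain b where "b \<in> set bs" using assms(2) by fastforce
  then show "\<exists>x. (N ^^ (n - 1)) x \<noteq> 0" using nonzero_of_block_size[OF assms(1)] b by metis
qed

lemma seifert_jordanI:
  assumes "seifert_pair L" "monodromy L M" "jordan_parts M Ms Mu" "direct_sum (map (eig_space Ms) \<alpha>s)"
  shows "seifert_jordan L M Ms Mu \<alpha>s"
  using assms by (simp add: seifert_jordan_def seifert_jordan_axioms_def seifert_monodromy_def)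

lemma sign_of_cong_4:
  fixes m :: nat and \<epsilon> :: int
  assumes "\<epsilon> \<in> {1, -1}"
  shows "[2 * int m + 1 = \<epsilon>] (mod 4) \<Longrightarrow> of_int \<epsilon> = (-1 :: real) ^ m"
    and "[2 * int m + 1 = - \<epsilon>] (mod 4) \<Longrightarrow> of_int \<epsilon> = - ((-1 :: real) ^ m)"
proof -
  have "even m \<Longrightarrow> (2 * int m + 1) mod 4 = 1" "odd m \<Longrightarrow> (2 * int m + 1) mod 4 = 3"
    by presburger+
  then show "[2 * int m + 1 = \<epsilon>] (mod 4) \<Longrightarrow> of_int \<epsilon> = (-1 :: real) ^ m"
    "[2 * int m + 1 = - \<epsilon>] (mod 4) \<Longrightarrow> of_int \<epsilon> = - ((-1 :: real) ^ m)"
    using assms by (cases "even m"; auto simp: cong_def)+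
qed

context
  fixes L :: "'v::real_vector \<Rightarrow> 'v \<Rightarrow> real" and M :: "'v \<Rightarrow> 'v" and n :: nat
  assumes n: "n \<ge> 1" and L: "seifert_pair L" and M: "monodromy L M"
begin

lemma Seif_1_nilpotent:
  assumes "Seif_1 lam n \<epsilon> L M"
  obtains Ms Mu where "seifert_nilpotent L M Ms Mu [of_real lam] n" "\<And>x. Ms x = lam *\<^sub>R x"
    "dim (UNIV :: 'v set) = n" "\<exists>x. (log_unipotent Mu ^^ (n - 1)) x \<noteq> 0"
    "\<And>a. a \<notin> range (log_unipotent Mu) \<Longrightarrow> \<exists>t>0. L a ((log_unipotent Mu ^^ (n - 1)) a) = of_int \<epsilon> * t"
proof -
  obtain bs Ms Mu where *: "has_jordan_blocks M bs" "length bs = 1" "jordan_parts M Ms Mu"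
    "eig_space Ms (of_real lam) = UNIV" "dim (UNIV :: 'v set) = n"
    "\<And>a. a \<notin> range (log_unipotent Mu) \<Longrightarrow> \<exists>t>0. L a ((log_unipotent Mu ^^ (n - 1)) a) = of_int \<epsilon> * t"
    using assms unfolding Seif_1_def Let_def by (elim conjE exE) blast
  interpret seifert_jordan L M Ms Mu "[of_real lam]"
    by (rule seifert_jordanI[OF L M *(3)]) (simp add: *(4) direct_sum_UNIV)
  obtain b where "bs = [b]" using *(2) by (metis One_nat_def length_0_conv length_Suc_conv)
  then have "set (map fst bs) = {n}" using sum_block_sizes[OF *(1)] *(5) by simp
  note blocks = seifert_nilpotent_of_equal_blocks[OF *(1) this n]
  show ?thesis
  proof (rule that[OF blocks(1) _ *(5) blocks(2) *(6)])
    show "Ms x = lam *\<^sub>R x" for x using real_in_eig_space[OF linear_Ms, of x lam] *(4) by simp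
  qed
qed

lemma Seif_2_sign_nilpotent:
  assumes "Seif_2_sign lam n L M"
  obtains Ms Mu where "seifert_nilpotent L M Ms Mu [of_real lam] n" "\<And>x. Ms x = lam *\<^sub>R x"
    "lam = (-1) ^ n" "dim (UNIV :: 'v set) = 2 * n" "\<exists>x. (log_unipotent Mu ^^ (n - 1)) x \<noteq> 0"
proof -
  obtain bs Ms Mu where *: "has_jordan_blocks M bs" "map fst bs = [n, n]" "jordan_parts M Ms Mu"
    "eig_space Ms (of_real lam) = UNIV" "dim (UNIV :: 'v set) = 2 * n" "lam = (-1) ^ n"
    using assms unfolding Seif_2_sign_def by (elim conjE exE) (rule that; assumption)
  interpret seifert_jordan L M Ms Mu "[of_real lam]"
    by (rule seifert_jordanI[OF L M *(3)]) (simp add: *(4) direct_sum_UNIV)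
  have "set (map fst bs) = {n}" unfolding *(2) by simp
  note blocks = seifert_nilpotent_of_equal_blocks[OF *(1) this n]
  show ?thesis
  proof (rule that[OF blocks(1) _ *(6,5) blocks(2)])
    show "Ms x = lam *\<^sub>R x" for x using real_in_eig_space[OF linear_Ms, of x lam] *(4) by simp
  qed
qed

text \<open>
  The sizes of the two blocks add up to \<open>2 n\<close>, so the larger one is at least \<open>n\<close>; by
  \<open>paired_block_size\<close> it is at most \<open>n\<close>.
\<close>
lemma Seif_2_circle_nilpotent:
  assumes "Seif_2_circle lam n \<zeta> L M"
  obtains Ms Mu where "seifert_nilpotent L M Ms Mu [lam, cnj lam] n"
    "dim (UNIV :: 'v set) = 2 * n" "\<exists>x. (log_unipotent Mu ^^ (n - 1)) x \<noteq> 0"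
    "\<And>a. a \<in> eig_space Ms lam \<Longrightarrow> a \<notin> range (cmap (log_unipotent Mu)) \<Longrightarrow>
      \<exists>t>0. cform L a ((cmap (log_unipotent Mu) ^^ (n - 1)) (cconj a)) = \<zeta> * of_real t"
proof -
  obtain bs Ms Mu where *: "has_jordan_blocks M bs" "length bs = 2" "jordan_parts M Ms Mu"
    "direct_sum [eig_space Ms lam, eig_space Ms (cnj lam)]" "dim (UNIV :: 'v set) = 2 * n"
    and lam: "norm lam = 1" "lam \<notin> {1, -1}"
    and sign: "\<And>a. a \<in> eig_space Ms lam - range (cmap (log_unipotent Mu)) \<Longrightarrow>
      \<exists>t>0. cform L a ((cmap (log_unipotent Mu) ^^ (n - 1)) (cconj a)) = \<zeta> * of_real t"
    using assms unfolding Seif_2_circle_def Let_def by (elim conjE exE) blast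
  interpret seifert_jordan L M Ms Mu "[lam, cnj lam]"
    by (rule seifert_jordanI[OF L M *(3)]) (simp add: *(4))
  obtain b b' where b: "bs = [b, b']" using *(2) by (auto simp: length_Suc_conv numeral_2_eq_2)
  define k where "k = max (fst b) (fst b')"
  have sum: "fst b + fst b' = 2 * n" using sum_block_sizes[OF *(1)] *(5) b by simp
  have k: "k \<ge> 1" using sum n by (simp add: k_def)
  interpret k: seifert_nilpotent L M Ms Mu "[lam, cnj lam]" k
    by (rule seifert_nilpotent_of_blocks[OF *(1) _ k]) (auto simp: b k_def)
  have nz: "\<exists>x. (log_unipotent Mu ^^ (k - 1)) x \<noteq> 0"
    using nonzero_of_block_size[OF *(1), of b] nonzero_of_block_size[OF *(1), of b'] b
    by (auto simp: k_def max_def)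
  have sq: "lam * lam \<noteq> 1" using lam(2) by (auto simp: square_eq_1_iff)
  then have sq': "cnj lam * cnj lam \<noteq> 1" by (metis complex_cnj_cnj complex_cnj_mult complex_cnj_one)
  have "radical S = {0}" by (rule radical_S_eq_0) (use lam in \<open>auto simp: complex_eq_iff\<close>)
  then obtain \<alpha> where "\<alpha> \<in> {lam, cnj lam}" "k.paired \<alpha>" using k.exists_paired[OF _ nz] by auto
  then have "2 * k \<le> 2 * n" using k.paired_block_size[of \<alpha>] sq sq' *(5) by auto
  then have kn: "k = n" using sum by (simp add: k_def)
  show ?thesis
  proof (rule that)
    show "seifert_nilpotent L M Ms Mu [lam, cnj lam] n" using k.seifert_nilpotent_axioms kn by simp
    show "\<exists>x. (log_unipotent Mu ^^ (n - 1)) x \<noteq> 0" using nz kn by simp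
  qed (use *(5) sign in auto)
qed

lemma Seif_1_plus:
  assumes "odd n" "\<epsilon> \<in> {1, -1}" "Seif_1 1 n \<epsilon> L M"
  shows "[int n = \<epsilon>] (mod 4) \<Longrightarrow> has_signature (I_s L) ((n + 1) div 2, 0, (n - 1) div 2)"
    and "[int n = - \<epsilon>] (mod 4) \<Longrightarrow> has_signature (I_s L) ((n - 1) div 2, 0, (n + 1) div 2)"
    and "Tr_1 1 n \<epsilon> M (I_s L)"
proof -
  obtain Ms Mu where *: "seifert_nilpotent L M Ms Mu [of_real 1] n" "\<And>x. Ms x = 1 *\<^sub>R x"
    "dim (UNIV :: 'v set) = n" "\<exists>x. (log_unipotent Mu ^^ (n - 1)) x \<noteq> 0"
    "\<And>a. a \<notin> range (log_unipotent Mu) \<Longrightarrow> \<exists>t>0. L a ((log_unipotent Mu ^^ (n - 1)) a) = of_int \<epsilon> * t"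
    using Seif_1_nilpotent[OF assms(3)] by metis
  interpret seifert_nilpotent L M Ms Mu "[of_real 1]" n by fact
  have rad: "radical S = {0}" by (rule radical_S_eq_0) simp
  obtain m where m: "n = 2 * m + 1" using assms(1) oddE by blast
  have half: "(n + 1) div 2 = m + 1" "(n - 1) div 2 = m" "int n = 2 * int m + 1" using m by auto
  note sig = signature_one_block_1[OF *(2) assms(2) *(3,4,5) refl rad m]
  show "has_signature S ((n + 1) div 2, 0, (n - 1) div 2)" if "[int n = \<epsilon>] (mod 4)"
    using sig(1) sign_of_cong_4(1)[OF assms(2), of m] that unfolding half by blast
  show "has_signature S ((n - 1) div 2, 0, (n + 1) div 2)" if "[int n = - \<epsilon>] (mod 4)"
    using sig(2) sign_of_cong_4(2)[OF assms(2), of m] that unfolding half by blast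
  show "Tr_1 1 n \<epsilon> M S" by (rule Tr_1_one_block[OF *(2) assms(2) *(3,4,5) refl rad assms(1)])
qed

lemma Seif_1_minus:
  assumes "even n" "\<epsilon> \<in> {1, -1}" "Seif_1 (-1) n \<epsilon> L M"
  shows "[int n - 1 = \<epsilon>] (mod 4) \<Longrightarrow> has_signature (I_s L) (n div 2, 1, (n - 2) div 2)"
    and "[int n - 1 = - \<epsilon>] (mod 4) \<Longrightarrow> has_signature (I_s L) ((n - 2) div 2, 1, n div 2)"
proof -
  obtain Ms Mu where *: "seifert_nilpotent L M Ms Mu [of_real (-1)] n" "\<And>x. Ms x = (-1) *\<^sub>R x"
    "dim (UNIV :: 'v set) = n" "\<exists>x. (log_unipotent Mu ^^ (n - 1)) x \<noteq> 0"
    "\<And>a. a \<notin> range (log_unipotent Mu) \<Longrightarrow> \<exists>t>0. L a ((log_unipotent Mu ^^ (n - 1)) a) = of_int \<epsilon> * t"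
    using Seif_1_nilpotent[OF assms(3)] by metis
  interpret seifert_nilpotent L M Ms Mu "[of_real (-1)]" n by fact
  obtain j where "n = 2 * j" using assms(1) by blast
  then obtain m where m: "n = 2 * m + 2" using n by (cases j) auto
  have half: "n div 2 = m + 1" "(n - 2) div 2 = m" "int n - 1 = 2 * int m + 1" using m by auto
  note sig = signature_one_block_minus_1[OF *(2) assms(2) *(3,4,5) refl m]
  show "has_signature S (n div 2, 1, (n - 2) div 2)" if "[int n - 1 = \<epsilon>] (mod 4)"
    using sig(1) sign_of_cong_4(1)[OF assms(2), of m] that unfolding half by blast
  show "has_signature S ((n - 2) div 2, 1, n div 2)" if "[int n - 1 = - \<epsilon>] (mod 4)"
    using sig(2) sign_of_cong_4(2)[OF assms(2), of m] that unfolding half by blast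
qed

lemma Seif_2_sign_even:
  assumes "even n" "Seif_2_sign 1 n L M"
  shows "has_signature (I_s L) (n, 0, n)" and "Tr_2_circle 1 n 0 1 M (I_s L)"
proof -
  obtain Ms Mu where *: "seifert_nilpotent L M Ms Mu [of_real 1] n" "\<And>x. Ms x = 1 *\<^sub>R x"
    "1 = (-1 :: real) ^ n" "dim (UNIV :: 'v set) = 2 * n" "\<exists>x. (log_unipotent Mu ^^ (n - 1)) x \<noteq> 0"
    using Seif_2_sign_nilpotent[OF assms(2)] by metis
  interpret seifert_nilpotent L M Ms Mu "[of_real 1]" n by fact
  have rad: "radical S = {0}" by (rule radical_S_eq_0) simp
  show "has_signature S (n, 0, n)" by (rule signature_two_blocks_even[OF *(2-5) assms(1) rad])
  obtain a b where ab: "\<And>j. j < n \<Longrightarrow> S a ((N ^^ j) a) = 0" "\<And>j. j < n \<Longrightarrow> S b ((N ^^ j) b) = 0"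
    "\<And>j. j < n \<Longrightarrow> S a ((N ^^ j) b) = (if j = n - 1 then 1 else 0)"
    using exists_isotropic_pair[OF *(2-5) assms(1)] by metis
  show "Tr_2_circle 1 n 0 1 M S"
    by (rule Tr_2_circle_of_isotropic_pair[OF rad *(4) assms(1) _ ab]) (simp_all add: *(2))
qed

lemma Seif_2_sign_odd:
  assumes "odd n" "Seif_2_sign (-1) n L M"
  shows "has_signature (I_s L) (n - 1, 2, n - 1)"
proof -
  obtain Ms Mu where *: "seifert_nilpotent L M Ms Mu [of_real (-1)] n" "\<And>x. Ms x = (-1) *\<^sub>R x"
    "-1 = (-1 :: real) ^ n" "dim (UNIV :: 'v set) = 2 * n" "\<exists>x. (log_unipotent Mu ^^ (n - 1)) x \<noteq> 0"
    using Seif_2_sign_nilpotent[OF assms(2)] by metis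
  interpret seifert_nilpotent L M Ms Mu "[of_real (-1)]" n by fact
  show "has_signature S (n - 1, 2, n - 1)" by (rule signature_two_blocks_odd[OF *(2-5) assms(1)])
qed

lemma Seif_2_circle_cases:
  assumes lam: "norm lam = 1" "lam \<notin> {1, -1}" and \<epsilon>: "\<epsilon> \<in> {1, -1}"
    and Seif: "Seif_2_circle lam n ((cnj lam + 1) / of_real (norm (lam + 1)) * \<i> ^ (n + 1) * of_int \<epsilon>) L M"
  shows "even n \<Longrightarrow> has_signature (I_s L) (n, 0, n)"
    and "odd n \<Longrightarrow> \<epsilon> = 1 \<Longrightarrow> has_signature (I_s L) (n - 1, 0, n + 1)"
    and "odd n \<Longrightarrow> \<epsilon> = -1 \<Longrightarrow> has_signature (I_s L) (n + 1, 0, n - 1)"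
    and "Tr_2_circle lam n 0 \<epsilon> M (I_s L)"
proof -
  obtain Ms Mu where *: "seifert_nilpotent L M Ms Mu [lam, cnj lam] n"
    "dim (UNIV :: 'v set) = 2 * n" "\<exists>x. (log_unipotent Mu ^^ (n - 1)) x \<noteq> 0"
    "\<And>a. a \<in> eig_space Ms lam \<Longrightarrow> a \<notin> range (cmap (log_unipotent Mu)) \<Longrightarrow>
      \<exists>t>0. cform L a ((cmap (log_unipotent Mu) ^^ (n - 1)) (cconj a))
        = (cnj lam + 1) / of_real (norm (lam + 1)) * \<i> ^ (n + 1) * of_int \<epsilon> * of_real t"
    using Seif_2_circle_nilpotent[OF Seif] by metis
  interpret seifert_nilpotent L M Ms Mu "[lam, cnj lam]" n by fact
  note facts = refl lam \<epsilon> *(2,3,4)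
  show "has_signature S (n, 0, n)" if "even n" by (rule signature_circle_even[OF facts that])
  show "has_signature S (n - 1, 0, n + 1)" if "odd n" "\<epsilon> = 1" by (rule signature_circle_odd(1)[OF facts that])
  show "has_signature S (n + 1, 0, n - 1)" if "odd n" "\<epsilon> = -1" by (rule signature_circle_odd(2)[OF facts that])
  show "Tr_2_circle lam n 0 \<epsilon> M S" by (rule Tr_2_circle_circle[OF facts])
qed

lemma Seif_2_real_case:
  assumes lam: "lam > 1 \<or> lam < -1" and Seif: "Seif_2_real lam n L M"
  shows "has_signature (I_s L) (n, 0, n)" and "Tr_2_real lam n 0 M (I_s L)"
proof -
  obtain bs Ms Mu where *: "has_jordan_blocks M bs" "map fst bs = [n, n]" "jordan_parts M Ms Mu"
    "direct_sum [eig_space Ms (of_real lam), eig_space Ms (of_real (inverse lam))]"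
    and dim: "dim (UNIV :: 'v set) = 2 * n"
    using Seif unfolding Seif_2_real_def by (elim conjE exE) (rule that; assumption)
  interpret seifert_jordan L M Ms Mu "[of_real lam, of_real (inverse lam)]"
    by (rule seifert_jordanI[OF L M *(3)]) (use *(4) in simp)
  have "set (map fst bs) = {n}" unfolding *(2) by simp
  note blocks = seifert_nilpotent_of_equal_blocks[OF *(1) this n]
  interpret seifert_nilpotent L M Ms Mu "[of_real lam, of_real (inverse lam)]" n by (rule blocks(1))
  have "inverse lam \<noteq> -1"
  proof
    assume "inverse lam = -1"
    then have "inverse (inverse lam) = inverse (-1)" by simp
    then show False using lam by simp
  qed
  then have rad: "radical S = {0}"
    by (intro radical_S_eq_0) (use lam in \<open>auto simp: complex_eq_iff simp del: of_real_inverse\<close>)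
  obtain \<alpha> where "\<alpha> \<in> {of_real lam, of_real (inverse lam)}" "paired \<alpha>"
    using exists_paired[OF rad blocks(2)] by auto
  then have "paired (of_real lam)" using paired_inverse[of \<alpha>] by auto
  then show "Tr_2_real lam n 0 M S" by (rule Tr_2_real_hyperbolic[OF lam _ rad dim])
  show "has_signature S (n, 0, n)"
    by (rule signature_hyperbolic[of "of_real lam", OF _ _ rad dim]) (use lam in auto)
qed

lemma Seif_4_case:
  assumes lam: "norm lam > 1" "Im lam > 0" and Seif: "Seif_4 lam n L M"
  shows "has_signature (I_s L) (2 * n, 0, 2 * n)" and "Tr_4 lam n 0 M (I_s L)"
proof -
  let ?\<alpha>s = "[lam, inverse lam, cnj lam, inverse (cnj lam)]"
  obtain bs Ms Mu where *: "has_jordan_blocks M bs" "map fst bs = [n, n, n, n]" "jordan_parts M Ms Mu"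
    "direct_sum [eig_space Ms lam, eig_space Ms (inverse lam), eig_space Ms (cnj lam), eig_space Ms (inverse (cnj lam))]"
    and dim: "dim (UNIV :: 'v set) = 4 * n"
    using Seif unfolding Seif_4_def by (elim conjE exE) (rule that; assumption)
  interpret seifert_jordan L M Ms Mu ?\<alpha>s
    by (rule seifert_jordanI[OF L M *(3)]) (use *(4) in simp)
  have "set (map fst bs) = {n}" unfolding *(2) by simp
  note blocks = seifert_nilpotent_of_equal_blocks[OF *(1) this n]
  interpret seifert_nilpotent L M Ms Mu ?\<alpha>s n by (rule blocks(1))
  have "-1 \<notin> set ?\<alpha>s"
  proof
    have "\<forall>x\<in>set ?\<alpha>s. norm x \<noteq> 1"
      using lam(1) by (simp add: norm_inverse)
    moreover assume "-1 \<in> set ?\<alpha>s"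
    ultimately have "norm (-1 :: complex) \<noteq> 1" by blast
    then show False by simp
  qed
  then have rad: "radical S = {0}" by (rule radical_S_eq_0)
  obtain \<alpha> where "\<alpha> \<in> {lam, inverse lam, cnj lam, inverse (cnj lam)}" "paired \<alpha>"
    using exists_paired[OF rad blocks(2)] by auto
  then have "paired lam"
    using paired_inverse[of \<alpha>] paired_cnj[of \<alpha>] paired_cnj[of "inverse \<alpha>"] by auto
  then show "Tr_4 lam n 0 M S" by (rule Tr_4_hyperbolic[OF lam _ rad dim])
  show "has_signature S (2 * n, 0, 2 * n)"
    by (rule signature_hyperbolic[of lam, OF _ lam(1) rad]) (use dim in auto)
qed

end

theorem lemma2p10:
  fixes L :: "'v::real_vector \<Rightarrow> 'v \<Rightarrow> real" and M :: "'v \<Rightarrow> 'v"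
    and n :: nat and \<epsilon> :: int
  assumes "n \<ge> 1" and "\<epsilon> \<in> {1, -1}"
    and "irreducible_seifert_pair L" and "monodromy L M"
  shows
    "(radical (I_s L) = {0} \<longrightarrow> irreducible_isometric_triple M (I_s L))
     \<and> (odd n \<and> Seif_1 1 n \<epsilon> L M \<and> [int n = \<epsilon>] (mod 4) \<longrightarrow>
          has_signature (I_s L) ((n + 1) div 2, 0, (n - 1) div 2) \<and> Tr_1 1 n \<epsilon> M (I_s L))
     \<and> (odd n \<and> Seif_1 1 n \<epsilon> L M \<and> [int n = - \<epsilon>] (mod 4) \<longrightarrow>
          has_signature (I_s L) ((n - 1) div 2, 0, (n + 1) div 2) \<and> Tr_1 1 n \<epsilon> M (I_s L))
     \<and> (even n \<and> Seif_1 (-1) n \<epsilon> L M \<and> [int n - 1 = \<epsilon>] (mod 4) \<longrightarrow>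
          has_signature (I_s L) (n div 2, 1, (n - 2) div 2))
     \<and> (even n \<and> Seif_1 (-1) n \<epsilon> L M \<and> [int n - 1 = - \<epsilon>] (mod 4) \<longrightarrow>
          has_signature (I_s L) ((n - 2) div 2, 1, n div 2))
     \<and> (even n \<and> Seif_2_sign 1 n L M \<longrightarrow>
          has_signature (I_s L) (n, 0, n) \<and> Tr_2_circle 1 n 0 1 M (I_s L))
     \<and> (odd n \<and> Seif_2_sign (-1) n L M \<longrightarrow>
          has_signature (I_s L) (n - 1, 2, n - 1))
     \<and> (\<forall>lam::complex. norm lam = 1 \<and> lam \<notin> {1, -1} \<longrightarrow>
          (let \<zeta> = (cnj lam + 1) / of_real (norm (lam + 1)) * \<i> ^ (n + 1) in
            (even n \<and> Seif_2_circle lam n (\<zeta> * of_int \<epsilon>) L M \<longrightarrow>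
               has_signature (I_s L) (n, 0, n) \<and> Tr_2_circle lam n 0 \<epsilon> M (I_s L))
            \<and> (odd n \<and> Seif_2_circle lam n \<zeta> L M \<longrightarrow>
               has_signature (I_s L) (n - 1, 0, n + 1) \<and> Tr_2_circle lam n 0 1 M (I_s L))
            \<and> (odd n \<and> Seif_2_circle lam n (- \<zeta>) L M \<longrightarrow>
               has_signature (I_s L) (n + 1, 0, n - 1) \<and> Tr_2_circle lam n 0 (-1) M (I_s L))))
     \<and> (\<forall>lam::real. (lam > 1 \<or> lam < -1) \<and> Seif_2_real lam n L M \<longrightarrow>
          has_signature (I_s L) (n, 0, n) \<and> Tr_2_real lam n 0 M (I_s L))
     \<and> (\<forall>lam::complex. norm lam > 1 \<and> Im lam > 0 \<and> Seif_4 lam n L M \<longrightarrow>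
          has_signature (I_s L) (2 * n, 0, 2 * n) \<and> Tr_4 lam n 0 M (I_s L))"
proof -
  have L: "seifert_pair L" using assms(3) by (simp add: irreducible_seifert_pair_def)
  interpret seifert_monodromy L M by unfold_locales (fact L, fact assms(4))
  note facts = assms(1) L assms(4)
  let ?\<zeta> = "\<lambda>lam::complex. (cnj lam + 1) / of_real (norm (lam + 1)) * \<i> ^ (n + 1)"
  have circle_plus: "has_signature (I_s L) (n - 1, 0, n + 1)" "Tr_2_circle lam n 0 1 M (I_s L)"
    if "odd n" "norm lam = 1" "lam \<notin> {1, -1}" "Seif_2_circle lam n (?\<zeta> lam) L M" for lam
    using Seif_2_circle_cases(2,4)[OF facts that(2,3), of 1] that(1,4) by simp_all
  have circle_minus: "has_signature (I_s L) (n + 1, 0, n - 1)" "Tr_2_circle lam n 0 (-1) M (I_s L)"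
    if "odd n" "norm lam = 1" "lam \<notin> {1, -1}" "Seif_2_circle lam n (- ?\<zeta> lam) L M" for lam
    using Seif_2_circle_cases(3,4)[OF facts that(2,3), of "-1"] that(1,4) by simp_all
  show ?thesis
    unfolding Let_def
    by (intro conjI allI impI; (elim conjE)?; rule irreducible_isometric_triple_S[OF _ assms(3)]
        Seif_1_plus[OF facts _ assms(2)] Seif_1_minus[OF facts _ assms(2)] Seif_2_sign_even[OF facts]
        Seif_2_sign_odd[OF facts] Seif_2_circle_cases(1,4)[OF facts _ _ assms(2)] circle_plus circle_minus
        Seif_2_real_case[OF facts] Seif_4_case[OF facts]; assumption)
qed

end
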